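(* Let $K$ be a field of characteristic zero and let $R$ be an affine $K$-algebra which is an integral domain, with a derivation $\delta$. If $R$ is a $\delta$-$G$-ring, then $R$ is $\delta$-primitive. Consequently, $R[\theta;\delta]$ is a primitive ring if and only if $\delta\neq 0$ and $R$ is $\delta$-primitive.
   Context: An affine $K$-algebra is a finitely generated commutative $K$-algebra. A derivation of $R$ is an additive map $\delta: R\to R$ with $\delta(ab)=\delta(a)b+a\delta(b)$ (it is not required to be $K$-linear). A $\delta$-ideal is an ideal $I$ of $R$ with $\delta(I)\subseteq I$. A $\delta$-ideal $P\neq R$ is $\delta$-prime if for all $\delta$-ideals $I,J$ with $IJ\subseteq P$ one has $I\subseteq P$ or $J\subseteq P$; $R$ is $\delta$-prime if $0$ is a $\delta$-prime ideal. $R$ is a $\delta$-$G$-ring if $R$ is $\delta$-prime and the intersection of all non-zero $\delta$-prime ideals of $R$ is non-zero (an empty intersection being $R$). $R$ is $\delta$-primitive if it has a maximal ideal that contains no non-zero $\delta$-ideal of $R$. The differential operator ring $R[\theta;\delta]$ is the free left $R$-module with basis $1,\theta,\theta^2,\ldots$ with multiplication extending that of $R$ and determined by $\theta a = a\theta+\delta(a)$ for $a\in R$. A ring is primitive if it has a faithful simple left module. *)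

theory Defs
  imports "HOL-Algebra.Algebra"
begin

definition char_zero :: "('a, 'm) ring_scheme \<Rightarrow> bool" where
  "char_zero K \<longleftrightarrow> (\<forall>n::nat. 0 < n \<longrightarrow> add_pow K n \<one>\<^bsub>K\<^esub> \<noteq> \<zero>\<^bsub>K\<^esub>)"

text \<open>The subring generated by \<open>A\<close> together with the image of \<open>K\<close> under the structure map
  \<open>k \<mapsto> k \<odot> 1\<close> is the \<open>K\<close>-subalgebra generated by \<open>A\<close>.\<close>

definition affine_algebra ::
    "('k, 'm) ring_scheme \<Rightarrow> ('k, 'a, 'n) module_scheme \<Rightarrow> bool" where
  "affine_algebra K R \<longleftrightarrow> algebra K R \<and>
     (\<exists>A. finite A \<and> A \<subseteq> carrier R \<and>
        generate_ring R ((\<lambda>k. k \<odot>\<^bsub>R\<^esub> \<one>\<^bsub>R\<^esub>) ` carrier K \<union> A) = carrier R)"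

locale derivation = cring R for R (structure) +
  fixes \<delta> :: "'a \<Rightarrow> 'a"
  assumes derivation_closed: "a \<in> carrier R \<Longrightarrow> \<delta> a \<in> carrier R"
    and derivation_add:
      "\<lbrakk>a \<in> carrier R; b \<in> carrier R\<rbrakk> \<Longrightarrow> \<delta> (a \<oplus> b) = \<delta> a \<oplus> \<delta> b"
    and derivation_mult:
      "\<lbrakk>a \<in> carrier R; b \<in> carrier R\<rbrakk> \<Longrightarrow> \<delta> (a \<otimes> b) = \<delta> a \<otimes> b \<oplus> a \<otimes> \<delta> b"

definition delta_ideal ::
    "('a, 'm) ring_scheme \<Rightarrow> ('a \<Rightarrow> 'a) \<Rightarrow> 'a set \<Rightarrow> bool" where
  "delta_ideal R \<delta> I \<longleftrightarrow> ideal I R \<and> \<delta> ` I \<subseteq> I"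

definition delta_prime_ideal ::
    "('a, 'm) ring_scheme \<Rightarrow> ('a \<Rightarrow> 'a) \<Rightarrow> 'a set \<Rightarrow> bool" where
  "delta_prime_ideal R \<delta> P \<longleftrightarrow> delta_ideal R \<delta> P \<and> P \<noteq> carrier R \<and>
     (\<forall>I J. delta_ideal R \<delta> I \<and> delta_ideal R \<delta> J \<and> I \<cdot>\<^bsub>R\<^esub> J \<subseteq> P \<longrightarrow> I \<subseteq> P \<or> J \<subseteq> P)"

definition delta_prime_ring :: "('a, 'm) ring_scheme \<Rightarrow> ('a \<Rightarrow> 'a) \<Rightarrow> bool" where
  "delta_prime_ring R \<delta> \<longleftrightarrow> delta_prime_ideal R \<delta> {\<zero>\<^bsub>R\<^esub>}"

text \<open>Intersecting with \<open>carrier R\<close> makes the empty intersection equal to \<open>R\<close>.\<close>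

definition delta_G_ring :: "('a, 'm) ring_scheme \<Rightarrow> ('a \<Rightarrow> 'a) \<Rightarrow> bool" where
  "delta_G_ring R \<delta> \<longleftrightarrow> delta_prime_ring R \<delta> \<and>
     carrier R \<inter> \<Inter> {P. delta_prime_ideal R \<delta> P \<and> P \<noteq> {\<zero>\<^bsub>R\<^esub>}} \<noteq> {\<zero>\<^bsub>R\<^esub>}"

definition delta_primitive :: "('a, 'm) ring_scheme \<Rightarrow> ('a \<Rightarrow> 'a) \<Rightarrow> bool" where
  "delta_primitive R \<delta> \<longleftrightarrow>
     (\<exists>M. maximalideal M R \<and> (\<forall>I. delta_ideal R \<delta> I \<and> I \<subseteq> M \<longrightarrow> I = {\<zero>\<^bsub>R\<^esub>}))"

text \<open>\<open>R[\<theta>; \<delta>]\<close> has the same underlying left \<open>R\<close>-module as the polynomial ring \<open>UP R\<close>; an element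
  \<open>p\<close> stands for \<open>\<Sum>\<^sub>i p\<^sub>i \<theta>\<^sup>i\<close>. The relation \<open>\<theta> a = a \<theta> + \<delta> a\<close> forces left multiplication by \<open>\<theta>\<close> to send
  \<open>\<Sum>\<^sub>i q\<^sub>i \<theta>\<^sup>i\<close> to \<open>\<Sum>\<^sub>i q\<^sub>i \<theta>\<^sup>i\<^sup>+\<^sup>1 + \<Sum>\<^sub>i \<delta>(q\<^sub>i) \<theta>\<^sup>i\<close>, and this determines the product.\<close>

definition theta_mult ::
    "('a, 'm) ring_scheme \<Rightarrow> ('a \<Rightarrow> 'a) \<Rightarrow> (nat \<Rightarrow> 'a) \<Rightarrow> nat \<Rightarrow> 'a" where
  "theta_mult R \<delta> q = (\<lambda>n. (case n of 0 \<Rightarrow> \<zero>\<^bsub>R\<^esub> | Suc m \<Rightarrow> q m) \<oplus>\<^bsub>R\<^esub> \<delta> (q n))"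

definition diff_op_ring ::
    "('a, 'm) ring_scheme \<Rightarrow> ('a \<Rightarrow> 'a) \<Rightarrow> (nat \<Rightarrow> 'a) ring" where
  "diff_op_ring R \<delta> = \<lparr>
     carrier = carrier (UP R),
     monoid.mult = (\<lambda>p q. \<Oplus>\<^bsub>UP R\<^esub>i\<in>{..deg R p}. p i \<odot>\<^bsub>UP R\<^esub> (theta_mult R \<delta> ^^ i) q),
     monoid.one = \<one>\<^bsub>UP R\<^esub>,
     ring.zero = \<zero>\<^bsub>UP R\<^esub>,
     ring.add = ring.add (UP R)\<rparr>"

text \<open>The following confirms this: \<open>R[\<theta>; \<delta>]\<close> is a ring whose product extends that of \<open>R\<close>, it
  satisfies \<open>\<theta> a = a \<theta> + \<delta> a\<close>, and \<open>\<theta>\<^sup>n\<close> is the \<open>n\<close>-th basis element of the left module \<open>UP R\<close>.\<close>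

context derivation
begin

lemma delta_zero: "\<delta> \<zero> = \<zero>"
proof -
  have "\<delta> \<zero> = \<delta> \<zero> \<oplus> \<delta> \<zero>"
    using derivation_add[of \<zero> \<zero>] by simp
  then show ?thesis
    using derivation_closed[of \<zero>] by (simp add: add.l_cancel_one')
qed

lemma delta_one: "\<delta> \<one> = \<zero>"
proof -
  have "\<delta> \<one> = \<delta> \<one> \<oplus> \<delta> \<one>"
    using derivation_mult[of \<one> \<one>] derivation_closed[of \<one>] by simp
  then show ?thesis
    using derivation_closed[of \<one>] by (simp add: add.l_cancel_one')
qed

end

lemma diff_op_ring_sel:
  "carrier (diff_op_ring R \<delta>) = carrier (UP R)"
  "\<one>\<^bsub>diff_op_ring R \<delta>\<^esub> = \<one>\<^bsub>UP R\<^esub>" "\<zero>\<^bsub>diff_op_ring R \<delta>\<^esub> = \<zero>\<^bsub>UP R\<^esub>"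
  "p \<oplus>\<^bsub>diff_op_ring R \<delta>\<^esub> q = p \<oplus>\<^bsub>UP R\<^esub> q"
  "p \<otimes>\<^bsub>diff_op_ring R \<delta>\<^esub> q
    = (\<Oplus>\<^bsub>UP R\<^esub>i\<in>{..deg R p}. p i \<odot>\<^bsub>UP R\<^esub> (theta_mult R \<delta> ^^ i) q)"
  by (simp_all add: diff_op_ring_def)

lemma coeff_UP: "p \<in> carrier (UP R) \<Longrightarrow> up_ring.coeff (UP R) p n = p n"
  by (simp add: UP_def)

lemma carrier_UP: "carrier (UP R) = {f. (\<forall>i. f i \<in> carrier R) \<and> (\<exists>n. bound \<zero>\<^bsub>R\<^esub> n f)}"
  by (auto simp: UP_def up_def)

locale derivation_UP = R?: derivation R \<delta> + UP_cring R P for R (structure) and \<delta> and P (structure)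
begin

abbreviation "\<Theta> \<equiv> theta_mult R \<delta>"
abbreviation "D \<equiv> diff_op_ring R \<delta>"
abbreviation "opmult p q \<equiv> (\<Oplus>\<^bsub>P\<^esub>i\<in>{..deg R p}. p i \<odot>\<^bsub>P\<^esub> (\<Theta> ^^ i) q)"

lemmas D_sel = diff_op_ring_sel[of R \<delta>, folded P_def]
lemmas coeff_eq = coeff_UP[of _ R, folded P_def]
lemmas carrier_eq = carrier_UP[of R, folded P_def]

lemma app_closed [simp]: "p \<in> carrier P \<Longrightarrow> p n \<in> carrier R"
  using coeff_closed[of p n] by (simp add: coeff_eq)

lemma Theta_closed [simp]:
  assumes "q \<in> carrier P" shows "\<Theta> q \<in> carrier P"
proof -
  obtain k where k: "bound \<zero> k q"
    using assms unfolding carrier_eq by blast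
  have "bound \<zero> (Suc k) (\<Theta> q)"
  proof
    fix m assume "Suc k < m"
    then show "\<Theta> q m = \<zero>"
      using k by (cases m) (auto simp: theta_mult_def bound_def delta_zero)
  qed
  moreover have "\<Theta> q n \<in> carrier R" for n
    using assms by (cases n) (auto simp: theta_mult_def derivation_closed)
  ultimately show ?thesis
    unfolding carrier_eq by blast
qed

lemma coeff_Theta:
  "q \<in> carrier P \<Longrightarrow>
    up_ring.coeff P (\<Theta> q) n = (case n of 0 \<Rightarrow> \<zero> | Suc m \<Rightarrow> up_ring.coeff P q m) \<oplus> \<delta> (up_ring.coeff P q n)"
  by (cases n) (simp_all only: coeff_eq Theta_closed, simp_all add: theta_mult_def)

lemma Theta_app: "\<Theta> q 0 = \<zero> \<oplus> \<delta> (q 0)" "\<Theta> q (Suc n) = q n \<oplus> \<delta> (q (Suc n))"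
  by (simp_all add: theta_mult_def)

lemma Theta_pow_closed [simp]: "q \<in> carrier P \<Longrightarrow> (\<Theta> ^^ i) q \<in> carrier P"
  by (induction i) auto

lemma Theta_add:
  assumes "p \<in> carrier P" "q \<in> carrier P"
  shows "\<Theta> (p \<oplus>\<^bsub>P\<^esub> q) = \<Theta> p \<oplus>\<^bsub>P\<^esub> \<Theta> q"
proof (rule up_eqI)
  fix n
  show "up_ring.coeff P (\<Theta> (p \<oplus>\<^bsub>P\<^esub> q)) n = up_ring.coeff P (\<Theta> p \<oplus>\<^bsub>P\<^esub> \<Theta> q) n"
    using assms
    by (cases n) (simp_all add: coeff_Theta derivation_add derivation_closed R.a_ac)
qed (use assms in auto)

lemma Theta_smult:
  assumes "a \<in> carrier R" "q \<in> carrier P"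
  shows "\<Theta> (a \<odot>\<^bsub>P\<^esub> q) = a \<odot>\<^bsub>P\<^esub> \<Theta> q \<oplus>\<^bsub>P\<^esub> \<delta> a \<odot>\<^bsub>P\<^esub> q"
proof (rule up_eqI)
  fix n
  show "up_ring.coeff P (\<Theta> (a \<odot>\<^bsub>P\<^esub> q)) n = up_ring.coeff P (a \<odot>\<^bsub>P\<^esub> \<Theta> q \<oplus>\<^bsub>P\<^esub> \<delta> a \<odot>\<^bsub>P\<^esub> q) n"
    using assms
    by (cases n) (simp_all add: coeff_Theta derivation_mult derivation_closed R.a_ac R.r_distr)
qed (use assms in \<open>auto simp: derivation_closed\<close>)

lemma Theta_pow_add:
  assumes "p \<in> carrier P" "q \<in> carrier P"
  shows "(\<Theta> ^^ i) (p \<oplus>\<^bsub>P\<^esub> q) = (\<Theta> ^^ i) p \<oplus>\<^bsub>P\<^esub> (\<Theta> ^^ i) q"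
  using assms by (induction i) (simp_all add: Theta_add)

lemma add_hom_finsum:
  fixes n :: nat
  assumes "\<And>x. x \<in> carrier P \<Longrightarrow> h x \<in> carrier P"
    and "\<And>x y. \<lbrakk>x \<in> carrier P; y \<in> carrier P\<rbrakk> \<Longrightarrow> h (x \<oplus>\<^bsub>P\<^esub> y) = h x \<oplus>\<^bsub>P\<^esub> h y"
    and "\<And>i. f i \<in> carrier P"
  shows "h (\<Oplus>\<^bsub>P\<^esub>i\<in>{..n}. f i) = (\<Oplus>\<^bsub>P\<^esub>i\<in>{..n}. h (f i))"
  using assms by (induction n) (auto simp: P.finsum_closed)

lemma opmult_bound:
  assumes "p \<in> carrier P" "q \<in> carrier P" "deg R p \<le> n"
  shows "opmult p q = (\<Oplus>\<^bsub>P\<^esub>i\<in>{..n}. p i \<odot>\<^bsub>P\<^esub> (\<Theta> ^^ i) q)"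
proof -
  have "p i \<odot>\<^bsub>P\<^esub> (\<Theta> ^^ i) q = \<zero>\<^bsub>P\<^esub>" if "deg R p < i" for i
    using deg_aboveD[OF that assms(1)] assms by (simp add: coeff_eq)
  then show ?thesis
    using assms by (intro P.add.finprod_mono_neutral_cong_left) auto
qed

lemma opmult_closed [simp]:
  "\<lbrakk>p \<in> carrier P; q \<in> carrier P\<rbrakk> \<Longrightarrow> opmult p q \<in> carrier P"
  by (intro P.finsum_closed) auto

lemma opmult_add_right:
  assumes "p \<in> carrier P" "q \<in> carrier P" "r \<in> carrier P"
  shows "opmult p (q \<oplus>\<^bsub>P\<^esub> r) = opmult p q \<oplus>\<^bsub>P\<^esub> opmult p r"
proof -
  have "opmult p (q \<oplus>\<^bsub>P\<^esub> r)
      = (\<Oplus>\<^bsub>P\<^esub>i\<in>{..deg R p}. p i \<odot>\<^bsub>P\<^esub> (\<Theta> ^^ i) q \<oplus>\<^bsub>P\<^esub> p i \<odot>\<^bsub>P\<^esub> (\<Theta> ^^ i) r)"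
    using assms by (intro P.finsum_cong') (auto simp: Theta_pow_add UP_smult_r_distr)
  also have "\<dots> = opmult p q \<oplus>\<^bsub>P\<^esub> opmult p r"
    using assms by (intro P.finsum_addf) auto
  finally show ?thesis .
qed

lemma opmult_add_left:
  assumes "p \<in> carrier P" "q \<in> carrier P" "r \<in> carrier P"
  shows "opmult (p \<oplus>\<^bsub>P\<^esub> q) r = opmult p r \<oplus>\<^bsub>P\<^esub> opmult q r"
proof -
  define n where "n = max (deg R (p \<oplus>\<^bsub>P\<^esub> q)) (max (deg R p) (deg R q))"
  have app: "(p \<oplus>\<^bsub>P\<^esub> q) i = p i \<oplus> q i" for i
    using coeff_add[of p q i] assms by (simp add: coeff_eq)
  have "opmult (p \<oplus>\<^bsub>P\<^esub> q) r = (\<Oplus>\<^bsub>P\<^esub>i\<in>{..n}. (p \<oplus>\<^bsub>P\<^esub> q) i \<odot>\<^bsub>P\<^esub> (\<Theta> ^^ i) r)"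
    using assms by (intro opmult_bound) (auto simp: n_def)
  also have "\<dots> = (\<Oplus>\<^bsub>P\<^esub>i\<in>{..n}. p i \<odot>\<^bsub>P\<^esub> (\<Theta> ^^ i) r \<oplus>\<^bsub>P\<^esub> q i \<odot>\<^bsub>P\<^esub> (\<Theta> ^^ i) r)"
    using assms by (intro P.finsum_cong') (auto simp: app UP_smult_l_distr)
  also have "\<dots> = (\<Oplus>\<^bsub>P\<^esub>i\<in>{..n}. p i \<odot>\<^bsub>P\<^esub> (\<Theta> ^^ i) r) \<oplus>\<^bsub>P\<^esub> (\<Oplus>\<^bsub>P\<^esub>i\<in>{..n}. q i \<odot>\<^bsub>P\<^esub> (\<Theta> ^^ i) r)"
    using assms by (intro P.finsum_addf) auto
  also have "\<dots> = opmult p r \<oplus>\<^bsub>P\<^esub> opmult q r"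
    using assms opmult_bound[of p r n] opmult_bound[of q r n] by (simp add: n_def)
  finally show ?thesis .
qed

lemma opmult_smult:
  assumes "a \<in> carrier R" "p \<in> carrier P" "r \<in> carrier P"
  shows "opmult (a \<odot>\<^bsub>P\<^esub> p) r = a \<odot>\<^bsub>P\<^esub> opmult p r"
proof -
  define n where "n = max (deg R (a \<odot>\<^bsub>P\<^esub> p)) (deg R p)"
  have app: "(a \<odot>\<^bsub>P\<^esub> p) i = a \<otimes> p i" for i
    using coeff_smult[of a p i] assms by (simp add: coeff_eq)
  have "opmult (a \<odot>\<^bsub>P\<^esub> p) r = (\<Oplus>\<^bsub>P\<^esub>i\<in>{..n}. (a \<odot>\<^bsub>P\<^esub> p) i \<odot>\<^bsub>P\<^esub> (\<Theta> ^^ i) r)"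
    using assms by (intro opmult_bound) (auto simp: n_def)
  also have "\<dots> = (\<Oplus>\<^bsub>P\<^esub>i\<in>{..n}. a \<odot>\<^bsub>P\<^esub> (p i \<odot>\<^bsub>P\<^esub> (\<Theta> ^^ i) r))"
    using assms by (intro P.finsum_cong') (auto simp: app UP_smult_assoc1)
  also have "\<dots> = a \<odot>\<^bsub>P\<^esub> (\<Oplus>\<^bsub>P\<^esub>i\<in>{..n}. p i \<odot>\<^bsub>P\<^esub> (\<Theta> ^^ i) r)"
    using assms by (intro add_hom_finsum[symmetric]) (auto simp: UP_smult_r_distr)
  also have "\<dots> = a \<odot>\<^bsub>P\<^esub> opmult p r"
    using assms opmult_bound[of p r n] by (simp add: n_def)
  finally show ?thesis .
qed

lemma opmult_Theta:
  assumes "p \<in> carrier P" "r \<in> carrier P"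
  shows "opmult (\<Theta> p) r = \<Theta> (opmult p r)"
proof -
  define n where "n = max (deg R (\<Theta> p)) (deg R p)"
  let ?g = "\<lambda>i. p i \<odot>\<^bsub>P\<^esub> (\<Theta> ^^ Suc i) r"
  let ?d = "\<lambda>i. \<delta> (p i) \<odot>\<^bsub>P\<^esub> (\<Theta> ^^ i) r"
  have cl: "?g i \<in> carrier P" "?d i \<in> carrier P" for i
    using assms by (auto simp: derivation_closed simp del: funpow.simps)
  have g0: "p i = \<zero>" if "n < i" for i
    using deg_aboveD[of p i] that assms by (simp add: coeff_eq n_def)
  have "opmult (\<Theta> p) r = (\<Oplus>\<^bsub>P\<^esub>i\<in>{..Suc n}. \<Theta> p i \<odot>\<^bsub>P\<^esub> (\<Theta> ^^ i) r)"
    using assms by (intro opmult_bound) (auto simp: n_def)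
  also have "\<dots> = (\<Oplus>\<^bsub>P\<^esub>i\<in>{..Suc n}. (case i of 0 \<Rightarrow> \<zero>\<^bsub>P\<^esub> | Suc j \<Rightarrow> ?g j) \<oplus>\<^bsub>P\<^esub> ?d i)"
  proof (intro P.finsum_cong')
    fix i
    show "\<Theta> p i \<odot>\<^bsub>P\<^esub> (\<Theta> ^^ i) r = (case i of 0 \<Rightarrow> \<zero>\<^bsub>P\<^esub> | Suc j \<Rightarrow> ?g j) \<oplus>\<^bsub>P\<^esub> ?d i"
      using assms
      by (cases i) (simp_all add: Theta_app UP_smult_l_distr derivation_closed)
  qed (use cl in \<open>auto split: nat.split simp del: funpow.simps\<close>)
  also have "\<dots> = (\<Oplus>\<^bsub>P\<^esub>i\<in>{..Suc n}. (case i of 0 \<Rightarrow> \<zero>\<^bsub>P\<^esub> | Suc j \<Rightarrow> ?g j))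
      \<oplus>\<^bsub>P\<^esub> (\<Oplus>\<^bsub>P\<^esub>i\<in>{..Suc n}. ?d i)"
    using cl by (intro P.finsum_addf) (auto split: nat.split simp del: funpow.simps)
  also have "(\<Oplus>\<^bsub>P\<^esub>i\<in>{..Suc n}. (case i of 0 \<Rightarrow> \<zero>\<^bsub>P\<^esub> | Suc j \<Rightarrow> ?g j)) = (\<Oplus>\<^bsub>P\<^esub>i\<in>{..n}. ?g i)"
    using cl by (subst P.finsum_Suc2) (auto split: nat.split simp del: funpow.simps
        intro!: P.finsum_closed P.r_zero)
  also have "(\<Oplus>\<^bsub>P\<^esub>i\<in>{..Suc n}. ?d i) = (\<Oplus>\<^bsub>P\<^esub>i\<in>{..n}. ?d i)"
  proof -
    have "?d (Suc n) = \<zero>\<^bsub>P\<^esub>"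
      using g0[of "Suc n"] assms by (simp add: delta_zero del: funpow.simps)
    moreover have "(\<Oplus>\<^bsub>P\<^esub>i\<in>{..n}. ?d i) \<in> carrier P"
      using cl by (intro P.finsum_closed) auto
    ultimately show ?thesis
      using cl by (subst P.finsum_Suc) (auto simp del: funpow.simps)
  qed
  also have "(\<Oplus>\<^bsub>P\<^esub>i\<in>{..n}. ?g i) \<oplus>\<^bsub>P\<^esub> (\<Oplus>\<^bsub>P\<^esub>i\<in>{..n}. ?d i) = (\<Oplus>\<^bsub>P\<^esub>i\<in>{..n}. ?g i \<oplus>\<^bsub>P\<^esub> ?d i)"
    using cl by (intro P.finsum_addf[symmetric]) (auto simp del: funpow.simps)
  also have "\<dots> = (\<Oplus>\<^bsub>P\<^esub>i\<in>{..n}. \<Theta> (p i \<odot>\<^bsub>P\<^esub> (\<Theta> ^^ i) r))"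
    using assms cl by (intro P.finsum_cong') (auto simp: Theta_smult derivation_closed)
  also have "\<dots> = \<Theta> (\<Oplus>\<^bsub>P\<^esub>i\<in>{..n}. p i \<odot>\<^bsub>P\<^esub> (\<Theta> ^^ i) r)"
    using assms by (intro add_hom_finsum[symmetric]) (auto simp: Theta_add)
  also have "\<dots> = \<Theta> (opmult p r)"
    using assms opmult_bound[of p r n] by (simp add: n_def)
  finally show ?thesis .
qed

lemma opmult_Theta_pow:
  assumes "p \<in> carrier P" "r \<in> carrier P"
  shows "opmult ((\<Theta> ^^ i) p) r = (\<Theta> ^^ i) (opmult p r)"
  using assms by (induction i) (simp_all add: opmult_Theta)

lemma opmult_assoc:
  assumes "p \<in> carrier P" "q \<in> carrier P" "r \<in> carrier P"
  shows "opmult (opmult p q) r = opmult p (opmult q r)"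
proof -
  have "opmult (opmult p q) r = (\<Oplus>\<^bsub>P\<^esub>i\<in>{..deg R p}. opmult (p i \<odot>\<^bsub>P\<^esub> (\<Theta> ^^ i) q) r)"
    using assms
    by (intro add_hom_finsum[where h = "\<lambda>x. opmult x r"]) (simp_all add: opmult_add_left)
  also have "\<dots> = opmult p (opmult q r)"
    using assms by (intro P.finsum_cong') (simp_all add: opmult_smult opmult_Theta_pow)
  finally show ?thesis .
qed

lemma Theta_monom: "\<Theta> (up_ring.monom P \<one> n) = up_ring.monom P \<one> (Suc n)"
proof (rule up_eqI)
  fix i
  show "up_ring.coeff P (\<Theta> (up_ring.monom P \<one> n)) i = up_ring.coeff P (up_ring.monom P \<one> (Suc n)) i"
    by (cases i) (auto simp: coeff_Theta delta_zero delta_one)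
qed auto

lemma Theta_pow_one: "(\<Theta> ^^ i) \<one>\<^bsub>P\<^esub> = up_ring.monom P \<one> i"
proof (induction i)
  case 0
  show ?case using monom_one by simp
next
  case (Suc i)
  then show ?case by (simp add: Theta_monom)
qed

lemma opmult_one_right:
  assumes "p \<in> carrier P" shows "opmult p \<one>\<^bsub>P\<^esub> = p"
proof -
  have "opmult p \<one>\<^bsub>P\<^esub> = (\<Oplus>\<^bsub>P\<^esub>i\<in>{..deg R p}. up_ring.monom P (up_ring.coeff P p i) i)"
  proof (intro P.finsum_cong')
    fix i
    show "p i \<odot>\<^bsub>P\<^esub> (\<Theta> ^^ i) \<one>\<^bsub>P\<^esub> = up_ring.monom P (up_ring.coeff P p i) i"
      using assms monom_mult_smult[of "p i" \<one> i] by (simp add: Theta_pow_one coeff_eq)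
  qed (use assms in simp_all)
  then show ?thesis using up_repr[OF assms] by simp
qed

lemma opmult_monom_zero:
  assumes "a \<in> carrier R" "q \<in> carrier P"
  shows "opmult (up_ring.monom P a 0) q = a \<odot>\<^bsub>P\<^esub> q"
  using assms coeff_monom[of a 0 0] by (simp add: coeff_eq)

lemma monom_app: "a \<in> carrier R \<Longrightarrow> up_ring.monom P a 0 0 = a"
  using coeff_monom[of a 0 0] by (simp add: coeff_eq)

lemma ring_diff_op_ring: "ring D"
proof (rule ringI)
  show "abelian_group D"
    by (rule abelian_groupI) (auto simp: D_sel P.a_ac intro: P.add.l_inv_ex)
  show "monoid D"
    using opmult_monom_zero[of \<one>] monom_one
    by (intro monoidI) (simp_all add: D_sel opmult_assoc opmult_one_right)
qed (simp_all add: D_sel opmult_add_left opmult_add_right)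

lemma diff_op_ring_relation:
  assumes "a \<in> carrier R"
  shows "up_ring.monom P \<one> 1 \<otimes>\<^bsub>D\<^esub> up_ring.monom P a 0
    = up_ring.monom P a 0 \<otimes>\<^bsub>D\<^esub> up_ring.monom P \<one> 1 \<oplus>\<^bsub>D\<^esub> up_ring.monom P (\<delta> a) 0"
proof -
  have eq: "\<Theta> (up_ring.monom P a 0) = a \<odot>\<^bsub>P\<^esub> up_ring.monom P \<one> 1 \<oplus>\<^bsub>P\<^esub> up_ring.monom P (\<delta> a) 0"
  proof (rule up_eqI)
    fix i
    show "up_ring.coeff P (\<Theta> (up_ring.monom P a 0)) i
        = up_ring.coeff P (a \<odot>\<^bsub>P\<^esub> up_ring.monom P \<one> 1 \<oplus>\<^bsub>P\<^esub> up_ring.monom P (\<delta> a) 0) i"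
      using assms
      by (cases i) (auto simp: coeff_Theta delta_zero derivation_closed split: nat.split)
  qed (use assms in \<open>auto simp: derivation_closed\<close>)
  have "up_ring.monom P \<one> 1 = \<Theta> \<one>\<^bsub>P\<^esub>"
    using Theta_monom[of 0] monom_one by simp
  then have "opmult (up_ring.monom P \<one> 1) (up_ring.monom P a 0) = \<Theta> (opmult \<one>\<^bsub>P\<^esub> (up_ring.monom P a 0))"
    using opmult_Theta[of "\<one>\<^bsub>P\<^esub>" "up_ring.monom P a 0"] assms by simp
  also have "opmult \<one>\<^bsub>P\<^esub> (up_ring.monom P a 0) = up_ring.monom P a 0"
    using opmult_monom_zero[of \<one> "up_ring.monom P a 0"] monom_one assms by simp
  finally show ?thesis
    using assms eq by (simp add: D_sel monom_app)
qed

lemma diff_op_ring_extends: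
  "\<lbrakk>a \<in> carrier R; b \<in> carrier R\<rbrakk> \<Longrightarrow>
    up_ring.monom P a 0 \<otimes>\<^bsub>D\<^esub> up_ring.monom P b 0 = up_ring.monom P (a \<otimes> b) 0"
  by (simp add: D_sel monom_app monom_mult_smult)

lemma diff_op_ring_theta_pow: "up_ring.monom P \<one> 1 [^]\<^bsub>D\<^esub> (n::nat) = up_ring.monom P \<one> n"
proof -
  interpret D: ring D by (rule ring_diff_op_ring)
  have th: "up_ring.monom P \<one> 1 = \<Theta> \<one>\<^bsub>P\<^esub>"
    using Theta_monom[of 0] monom_one by simp
  have cl: "up_ring.monom P \<one> 1 \<in> carrier D" by (simp add: D_sel)
  show ?thesis
  proof (induction n)
    case 0
    show ?case using monom_one by (simp add: D_sel)
  next
    case (Suc n)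
    have "up_ring.monom P \<one> 1 [^]\<^bsub>D\<^esub> Suc n = up_ring.monom P \<one> 1 \<otimes>\<^bsub>D\<^esub> up_ring.monom P \<one> 1 [^]\<^bsub>D\<^esub> n"
      using D.nat_pow_Suc2[OF cl] by simp
    also have "\<dots> = opmult (\<Theta> \<one>\<^bsub>P\<^esub>) (up_ring.monom P \<one> n)"
      using Suc th by (simp add: D_sel)
    also have "\<dots> = \<Theta> (opmult \<one>\<^bsub>P\<^esub> (up_ring.monom P \<one> n))"
      by (intro opmult_Theta) auto
    also have "opmult \<one>\<^bsub>P\<^esub> (up_ring.monom P \<one> n) = up_ring.monom P \<one> n"
      using opmult_monom_zero[of \<one> "up_ring.monom P \<one> n"] monom_one by simp
    finally show ?case by (simp add: Theta_monom)
  qed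
qed

end

text \<open>The library's \<open>module\<close> requires a commutative ring of scalars.\<close>

locale left_module = R?: ring R + M?: abelian_group M
  for R :: "('s, 'm) ring_scheme" (structure) and M :: "('s, 'b, 'n) module_scheme" (structure) +
  assumes smult_closed:
      "\<lbrakk>a \<in> carrier R; x \<in> carrier M\<rbrakk> \<Longrightarrow> a \<odot>\<^bsub>M\<^esub> x \<in> carrier M"
    and smult_l_distr:
      "\<lbrakk>a \<in> carrier R; b \<in> carrier R; x \<in> carrier M\<rbrakk> \<Longrightarrow>
        (a \<oplus> b) \<odot>\<^bsub>M\<^esub> x = a \<odot>\<^bsub>M\<^esub> x \<oplus>\<^bsub>M\<^esub> b \<odot>\<^bsub>M\<^esub> x"
    and smult_r_distr:
      "\<lbrakk>a \<in> carrier R; x \<in> carrier M; y \<in> carrier M\<rbrakk> \<Longrightarrow>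
        a \<odot>\<^bsub>M\<^esub> (x \<oplus>\<^bsub>M\<^esub> y) = a \<odot>\<^bsub>M\<^esub> x \<oplus>\<^bsub>M\<^esub> a \<odot>\<^bsub>M\<^esub> y"
    and smult_assoc:
      "\<lbrakk>a \<in> carrier R; b \<in> carrier R; x \<in> carrier M\<rbrakk> \<Longrightarrow>
        (a \<otimes> b) \<odot>\<^bsub>M\<^esub> x = a \<odot>\<^bsub>M\<^esub> (b \<odot>\<^bsub>M\<^esub> x)"
    and smult_one: "x \<in> carrier M \<Longrightarrow> \<one> \<odot>\<^bsub>M\<^esub> x = x"

definition simple_left_module ::
    "('s, 'm) ring_scheme \<Rightarrow> ('s, 'b, 'n) module_scheme \<Rightarrow> bool" where
  "simple_left_module S M \<longleftrightarrow> left_module S M \<and> carrier M \<noteq> {\<zero>\<^bsub>M\<^esub>} \<and>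
     (\<forall>N. submodule N S M \<longrightarrow> N = {\<zero>\<^bsub>M\<^esub>} \<or> N = carrier M)"

definition faithful_left_module ::
    "('s, 'm) ring_scheme \<Rightarrow> ('s, 'b, 'n) module_scheme \<Rightarrow> bool" where
  "faithful_left_module S M \<longleftrightarrow> left_module S M \<and>
     (\<forall>s\<in>carrier S. (\<forall>x\<in>carrier M. s \<odot>\<^bsub>M\<^esub> x = \<zero>\<^bsub>M\<^esub>) \<longrightarrow> s = \<zero>\<^bsub>S\<^esub>)"

text \<open>HOL cannot quantify over the type of module elements inside a definition. Taking them to be
  subsets of \<open>S\<close> loses nothing: for \<open>m \<noteq> 0\<close> in a simple module, \<open>x \<mapsto> {s. s \<odot> m = x}\<close> embeds
  the module into the subsets of \<open>S\<close> (see \<open>primitive_ringI\<close> below).\<close>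

definition primitive_ring :: "('s, 'm) ring_scheme \<Rightarrow> bool" where
  "primitive_ring S \<longleftrightarrow>
     (\<exists>M :: ('s, 's set) module. simple_left_module S M \<and> faithful_left_module S M)"

lemma primitive_ringI:
  assumes simple: "simple_left_module S M" and faithful: "faithful_left_module S M"
  shows "primitive_ring S"
proof -
  interpret M: left_module S M
    using simple by (simp add: simple_left_module_def)
  obtain m where m: "m \<in> carrier M" "m \<noteq> \<zero>\<^bsub>M\<^esub>"
    using simple M.M.zero_closed unfolding simple_left_module_def by blast
  define N where "N = (\<lambda>s. s \<odot>\<^bsub>M\<^esub> m) ` carrier S"
  have sub_N: "submodule N S M"
  proof (unfold_locales)
    have zero: "\<zero>\<^bsub>S\<^esub> \<odot>\<^bsub>M\<^esub> m = \<zero>\<^bsub>M\<^esub>"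
      using M.smult_l_distr[of "\<zero>\<^bsub>S\<^esub>" "\<zero>\<^bsub>S\<^esub>" m] m M.smult_closed[of "\<zero>\<^bsub>S\<^esub>" m]
      by (simp add: M.M.add.l_cancel_one')
    then show "\<one>\<^bsub>add_monoid M\<^esub> \<in> N"
      by (auto simp: N_def image_iff intro!: bexI[of _ "\<zero>\<^bsub>S\<^esub>"])
    show "N \<subseteq> carrier (add_monoid M)"
      using m by (auto simp: N_def M.smult_closed)
    show "x \<otimes>\<^bsub>add_monoid M\<^esub> y \<in> N" if "x \<in> N" "y \<in> N" for x y
    proof -
      obtain s t where "s \<in> carrier S" "x = s \<odot>\<^bsub>M\<^esub> m" "t \<in> carrier S" "y = t \<odot>\<^bsub>M\<^esub> m"
        using \<open>x \<in> N\<close> \<open>y \<in> N\<close> by (auto simp: N_def)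
      then show ?thesis
        using m by (auto simp: N_def M.smult_l_distr intro!: image_eqI[of _ _ "s \<oplus>\<^bsub>S\<^esub> t"])
    qed
    show "inv\<^bsub>add_monoid M\<^esub> x \<in> N" if "x \<in> N" for x
    proof -
      obtain s where s: "s \<in> carrier S" "x = s \<odot>\<^bsub>M\<^esub> m"
        using \<open>x \<in> N\<close> by (auto simp: N_def)
      have "(\<ominus>\<^bsub>S\<^esub> s) \<odot>\<^bsub>M\<^esub> m \<oplus>\<^bsub>M\<^esub> x = \<zero>\<^bsub>M\<^esub>"
        using s m zero M.smult_l_distr[of "\<ominus>\<^bsub>S\<^esub> s" s m] by (simp add: M.R.l_neg)
      then have "\<ominus>\<^bsub>M\<^esub> x = (\<ominus>\<^bsub>S\<^esub> s) \<odot>\<^bsub>M\<^esub> m"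
        using s m by (intro M.M.minus_equality) (auto simp: M.smult_closed)
      then show ?thesis
        using s by (auto simp: N_def a_inv_def)
    qed
    show "a \<odot>\<^bsub>M\<^esub> x \<in> N" if "a \<in> carrier S" "x \<in> N" for a x
      using that m by (auto simp: N_def M.smult_assoc[symmetric])
  qed
  moreover have "m \<in> N"
    using m M.smult_one[of m] by (force simp: N_def)
  ultimately have gen: "N = carrier M"
    using simple m unfolding simple_left_module_def by blast
  define f where "f x = {s \<in> carrier S. s \<odot>\<^bsub>M\<^esub> m = x}" for x
  have f_inj: "inj_on f (carrier M)"
  proof (rule inj_onI)
    fix x y assume "x \<in> carrier M" "y \<in> carrier M" and eq: "f x = f y"
    then obtain s where "s \<in> carrier S" "x = s \<odot>\<^bsub>M\<^esub> m"
      using gen by (auto simp: N_def)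
    then have "s \<in> f y" using eq by (auto simp: f_def)
    then show "x = y" using \<open>x = _\<close> by (simp add: f_def)
  qed
  define g where "g = the_inv_into (carrier M) f"
  have gf: "g (f x) = x" if "x \<in> carrier M" for x
    using that f_inj by (simp add: g_def the_inv_into_f_f)
  define M' :: "('a, 'a set) module" where
    "M' = \<lparr>carrier = f ` carrier M, monoid.mult = (\<lambda>x y. x), monoid.one = f \<zero>\<^bsub>M\<^esub>,
       ring.zero = f \<zero>\<^bsub>M\<^esub>, ring.add = (\<lambda>x y. f (g x \<oplus>\<^bsub>M\<^esub> g y)),
       smult = (\<lambda>s x. f (s \<odot>\<^bsub>M\<^esub> g x))\<rparr>"
  have sel: "carrier M' = f ` carrier M" "\<zero>\<^bsub>M'\<^esub> = f \<zero>\<^bsub>M\<^esub>"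
    "x \<oplus>\<^bsub>M'\<^esub> y = f (g x \<oplus>\<^bsub>M\<^esub> g y)" "s \<odot>\<^bsub>M'\<^esub> x = f (s \<odot>\<^bsub>M\<^esub> g x)" for s x y
    by (simp_all add: M'_def)
  have M': "left_module S M'"
  proof (intro left_module.intro left_module_axioms.intro)
    show "ring S" by (rule M.R.ring_axioms)
    show "abelian_group M'"
    proof (rule abelian_groupI)
      fix x assume "x \<in> carrier M'"
      then obtain y where "y \<in> carrier M" "x = f y" by (auto simp: sel)
      then show "\<exists>z\<in>carrier M'. z \<oplus>\<^bsub>M'\<^esub> x = \<zero>\<^bsub>M'\<^esub>"
        by (intro bexI[of _ "f (\<ominus>\<^bsub>M\<^esub> y)"]) (simp_all add: sel gf M.M.l_neg)
    qed (auto simp: sel gf M.M.a_ac)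
  qed (auto simp: sel gf M.smult_closed M.smult_l_distr M.smult_r_distr M.smult_assoc M.smult_one)
  have "N' = {\<zero>\<^bsub>M'\<^esub>} \<or> N' = carrier M'" if N': "submodule N' S M'" for N'
  proof -
    interpret M': left_module S M' by (rule M')
    interpret N': submodule N' S M' by (rule N')
    have sub: "N' \<subseteq> f ` carrier M" using N'.subset by (simp add: sel)
    have cl: "g x \<in> carrier M" "f (g x) = x" if "x \<in> N'" for x
      using that sub gf by auto
    have "submodule (g ` N') S M"
    proof (unfold_locales)
      show "g ` N' \<subseteq> carrier (add_monoid M)" using cl by auto
      show "\<one>\<^bsub>add_monoid M\<^esub> \<in> g ` N'"
        using N'.one_closed gf[of "\<zero>\<^bsub>M\<^esub>"] by (force simp: sel)
      show "x \<otimes>\<^bsub>add_monoid M\<^esub> y \<in> g ` N'" if xy: "x \<in> g ` N'" "y \<in> g ` N'" for x y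
      proof -
        obtain u v where uv: "u \<in> N'" "x = g u" "v \<in> N'" "y = g v" using xy by auto
        then have "f (g u \<oplus>\<^bsub>M\<^esub> g v) \<in> N'" using N'.m_closed[of u v] by (simp add: sel)
        moreover have "g (f (g u \<oplus>\<^bsub>M\<^esub> g v)) = x \<oplus>\<^bsub>M\<^esub> y" using uv cl by (simp add: gf)
        ultimately show ?thesis by (metis imageI monoid.simps(1))
      qed
      show sm: "a \<odot>\<^bsub>M\<^esub> x \<in> g ` N'" if ax: "a \<in> carrier S" "x \<in> g ` N'" for a x
      proof -
        obtain u where u: "u \<in> N'" "x = g u" using ax by auto
        then have "f (a \<odot>\<^bsub>M\<^esub> g u) \<in> N'" using N'.smult_closed[of a u] ax by (simp add: sel)
        moreover have "g (f (a \<odot>\<^bsub>M\<^esub> g u)) = a \<odot>\<^bsub>M\<^esub> x"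
          using u ax cl by (simp add: gf M.smult_closed)
        ultimately show ?thesis by (metis imageI)
      qed
      show "inv\<^bsub>add_monoid M\<^esub> x \<in> g ` N'" if x: "x \<in> g ` N'" for x
      proof -
        obtain u where u: "u \<in> N'" "x = g u" using x by auto
        let ?v = "\<ominus>\<^bsub>M'\<^esub> u"
        have v: "?v \<in> N'" unfolding a_inv_def using u(1) by (rule N'.m_inv_closed)
        have "u \<in> carrier M'" using u sub by (auto simp: sel)
        then have "?v \<oplus>\<^bsub>M'\<^esub> u = \<zero>\<^bsub>M'\<^esub>" by (rule M'.M.l_neg)
        then have "f (g ?v \<oplus>\<^bsub>M\<^esub> g u) = f \<zero>\<^bsub>M\<^esub>" by (simp add: sel)
        then have "g ?v \<oplus>\<^bsub>M\<^esub> g u = \<zero>\<^bsub>M\<^esub>"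
          using cl u v gf by (metis M.M.add.m_closed M.M.zero_closed)
        then have "\<ominus>\<^bsub>M\<^esub> x = g ?v"
          using u v cl by (intro M.M.minus_equality) auto
        then show ?thesis using v unfolding a_inv_def by (metis imageI)
      qed
    qed
    then have "g ` N' = {\<zero>\<^bsub>M\<^esub>} \<or> g ` N' = carrier M"
      using simple by (simp add: simple_left_module_def)
    moreover have "f ` g ` N' = N'" using cl by (force simp: image_image)
    ultimately show ?thesis by (auto simp: sel)
  qed
  moreover have "carrier M' \<noteq> {\<zero>\<^bsub>M'\<^esub>}"
  proof
    assume "carrier M' = {\<zero>\<^bsub>M'\<^esub>}"
    then have "f m = f \<zero>\<^bsub>M\<^esub>" using m by (auto simp: sel)
    then show False using m gf by (metis M.M.zero_closed)
  qed
  ultimately have "simple_left_module S M'"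
    using M' by (simp add: simple_left_module_def)
  moreover have "faithful_left_module S M'"
    unfolding faithful_left_module_def
  proof (intro conjI ballI impI M')
    fix s assume s: "s \<in> carrier S" and "\<forall>x\<in>carrier M'. s \<odot>\<^bsub>M'\<^esub> x = \<zero>\<^bsub>M'\<^esub>"
    then have "f (s \<odot>\<^bsub>M\<^esub> x) = f \<zero>\<^bsub>M\<^esub>" if "x \<in> carrier M" for x
      using that by (auto simp: sel gf)
    then have "s \<odot>\<^bsub>M\<^esub> x = \<zero>\<^bsub>M\<^esub>" if "x \<in> carrier M" for x
      using that s gf by (metis M.M.zero_closed M.smult_closed)
    then show "s = \<zero>\<^bsub>S\<^esub>"
      using faithful s by (simp add: faithful_left_module_def)
  qed
  ultimately show ?thesis
    unfolding primitive_ring_def by blast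
qed

end

theory Submission
  imports Defs
begin

text \<open>
  Let \<open>L\<close> be a left ideal of \<open>R[\<theta>; \<delta>]\<close> without nonzero constants. If \<open>c\<close> is the leading coefficient of
  an element of minimal degree of \<open>L\<close>, then modulo a prime ideal \<open>Q\<close> of \<open>R\<close> with \<open>c \<notin> Q\<close> no element
  of \<open>L\<close> becomes a nonzero constant. For \<open>\<delta> = 0\<close> this shows that maximal ideals of \<open>R\<close> avoiding \<open>c\<close>
  survive in \<open>R[x]\<close>, whence an affine domain has zero Jacobson radical.

  The largest \<open>\<delta>\<close>-ideal inside a prime ideal is prime in characteristic zero. If \<open>R\<close> is a
  \<open>\<delta>\<close>-\<open>G\<close>-ring, choose a nonzero \<open>f\<close> in all nonzero \<open>\<delta>\<close>-prime ideals and a maximal ideal \<open>M\<close> with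
  \<open>f \<notin> M\<close>: the largest \<open>\<delta>\<close>-ideal inside \<open>M\<close> must vanish.

  If \<open>R\<close> is \<open>\<delta>\<close>-primitive, witnessed by \<open>M\<close>, and \<open>L\<close> is a maximal left ideal containing \<open>M\<close>, then \<open>L\<close>
  contains no nonzero two-sided ideal, as such an ideal would meet \<open>R\<close> in a nonzero \<open>\<delta>\<close>-ideal inside
  \<open>M\<close>. Conversely let \<open>V\<close> be a faithful simple module. If some \<open>v \<in> V\<close> has no \<open>R\<close>-torsion, apply the
  first paragraph to its annihilator and take a maximal ideal \<open>M\<close> avoiding \<open>c\<close>. Otherwise, \<open>R\<close> being
  noetherian, some nonzero \<open>v\<close> has a prime annihilator \<open>A\<close> in \<open>R\<close>; it contains no nonzero
  \<open>\<delta>\<close>-ideal, and commutators with \<open>p \<in> A\<close>, \<open>\<delta> p \<notin> A\<close> show that \<open>A\<close> is maximal.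
\<close>

section \<open>Left ideals without nonzero constants\<close>

text \<open>The field \<open>K\<close> and finite generation enter only through three facts about
  \<open>R\<close>: it is noetherian, its Jacobson radical is zero, and positive integers are units
  in it. The first two are obtained together by adjoining one generator at a time to the image of
  \<open>K\<close>. Localization is avoided: the constant \<open>c\<close>, a leading coefficient,
  does the work of a denominator, and maximal ideals merely have to avoid it. In the converse the
  annihilator of a vector is only a left ideal, so no single argument covers all cases. Without
  torsion it contains no nonzero constants, and \<open>c\<close> controls reduction modulo every
  prime avoiding \<open>c\<close>, in particular modulo the largest \<open>\<delta>\<close>-ideal
  inside \<open>M\<close>. With torsion constants do occur, and degrees are lowered by commutators
  instead. A commutator multiplies the leading coefficient by its degree, so integers have to be
  divided out again.\<close>

lemma (in ideal) I_minus_closed: "\<lbrakk>a \<in> I; b \<in> I\<rbrakk> \<Longrightarrow> a \<ominus> b \<in> I"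
  by (simp add: a_minus_def a_inv_closed a_closed)

locale derivation_domain = derivation_UP + UP_domain R P
begin

text \<open>Multiplying by \<open>\<theta>\<close> shifts the coefficients up by one and adds a
  coefficientwise \<open>\<delta>\<close>, which cannot raise the degree. So a minimal element of a
  left ideal can be moved up to cancel an element of larger degree.\<close>

lemma coeff_Theta_pow_shift:
  assumes "q \<in> carrier P" "deg R q \<le> n"
  shows "deg R ((\<Theta> ^^ k) q) \<le> n + k" "up_ring.coeff P ((\<Theta> ^^ k) q) (n + k) = up_ring.coeff P q n"
proof (induction k)
  case (Suc k)
  let ?r = "(\<Theta> ^^ k) q"
  have above: "up_ring.coeff P ?r m = \<zero>" if "n + k < m" for m
    using assms Suc that by (intro deg_aboveD) auto
  have rP: "?r \<in> carrier P" using assms by simp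
  show "deg R ((\<Theta> ^^ Suc k) q) \<le> n + Suc k"
  proof (rule deg_aboveI)
    fix m assume m: "n + Suc k < m"
    then obtain m' where "m = Suc m'" "n + k < m'" by (cases m) auto
    then show "up_ring.coeff P ((\<Theta> ^^ Suc k) q) m = \<zero>"
      using coeff_Theta[OF rP, of m] above[of m'] above[of m] by (simp add: delta_zero)
  qed (use assms in simp)
  have "up_ring.coeff P ((\<Theta> ^^ Suc k) q) (n + Suc k) = up_ring.coeff P ?r (n + k) \<oplus> \<zero>"
    using coeff_Theta[OF rP, of "n + Suc k"] above[of "n + Suc k"] by (simp add: delta_zero)
  then show "up_ring.coeff P ((\<Theta> ^^ Suc k) q) (n + Suc k) = up_ring.coeff P q n"
    using Suc(2) rP assms by simp
qed (use assms in auto)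

text \<open>If the leading coefficient of \<open>f \<in> L\<close> lies in \<open>Q\<close>, cancelling it with the minimal element \<open>g\<close>
  multiplies \<open>f\<close> by \<open>c\<close> modulo \<open>Q\<close>, so the set of degrees whose coefficient is outside \<open>Q\<close> is unchanged.
  By induction on the degree, some such degree is at least \<open>deg g > 0\<close>.\<close>

lemma avoid_primes:
  assumes L_sub: "L \<subseteq> carrier P"
    and minus: "\<And>f g. \<lbrakk>f \<in> L; g \<in> L\<rbrakk> \<Longrightarrow> f \<ominus>\<^bsub>P\<^esub> g \<in> L"
    and smult: "\<And>a f. \<lbrakk>a \<in> carrier R; f \<in> L\<rbrakk> \<Longrightarrow> a \<odot>\<^bsub>P\<^esub> f \<in> L"
    and Theta: "\<And>f. f \<in> L \<Longrightarrow> \<Theta> f \<in> L"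
    and const: "\<And>f. \<lbrakk>f \<in> L; deg R f = 0\<rbrakk> \<Longrightarrow> f = \<zero>\<^bsub>P\<^esub>"
  obtains c where "c \<in> carrier R" "c \<noteq> \<zero>"
    "\<And>Q f. \<lbrakk>primeideal Q R; c \<notin> Q; f \<in> L; \<And>i. 0 < i \<Longrightarrow> up_ring.coeff P f i \<in> Q\<rbrakk>
      \<Longrightarrow> up_ring.coeff P f 0 \<in> Q"
proof (cases "\<exists>g\<in>L. g \<noteq> \<zero>\<^bsub>P\<^esub>")
  case False
  have "up_ring.coeff P f 0 \<in> Q" if "primeideal Q R" "f \<in> L" for Q f
  proof -
    interpret Q: primeideal Q R by fact
    show ?thesis using False that Q.zero_closed by (metis coeff_zero)
  qed
  then show ?thesis using that[of \<one>] by (auto simp: one_not_zero)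
next
  case True
  define g where "g = arg_min (deg R) (\<lambda>g. g \<in> L \<and> g \<noteq> \<zero>\<^bsub>P\<^esub>)"
  have g: "g \<in> L" "g \<noteq> \<zero>\<^bsub>P\<^esub>" and g_min: "\<And>f. \<lbrakk>f \<in> L; f \<noteq> \<zero>\<^bsub>P\<^esub>\<rbrakk> \<Longrightarrow> deg R g \<le> deg R f"
    using arg_min_nat_lemma[of "\<lambda>g. g \<in> L \<and> g \<noteq> \<zero>\<^bsub>P\<^esub>"] True unfolding g_def by blast+
  have gP [simp]: "g \<in> carrier P" using g L_sub by auto
  define n where "n = deg R g"
  define c where "c = up_ring.coeff P g n"
  have n_pos: "n > 0" using const g by (auto simp: n_def)
  have c [simp]: "c \<in> carrier R" "c \<noteq> \<zero>"
    using lcoeff_nonzero[OF g(2)] by (auto simp: c_def n_def)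
  have L_pow: "(\<Theta> ^^ k) g \<in> L" for k by (induction k) (auto simp: g Theta)
  have high: "\<exists>j\<ge>n. up_ring.coeff P f j \<notin> Q"
    if Q: "primeideal Q R" "c \<notin> Q" and f: "f \<in> L" "up_ring.coeff P f j \<notin> Q" for Q f j
    using f
  proof (induction "deg R f" arbitrary: f j rule: less_induct)
    case less
    interpret Q: primeideal Q R by fact
    have fP [simp]: "f \<in> carrier P" using less L_sub by auto
    define e where "e = deg R f"
    have f_nz: "f \<noteq> \<zero>\<^bsub>P\<^esub>" using less Q.zero_closed by auto
    then have ne: "n \<le> e" using g_min less by (auto simp: n_def e_def)
    define a where "a = up_ring.coeff P f e"
    have a [simp]: "a \<in> carrier R" by (simp add: a_def)
    show ?case
    proof (cases "a \<in> Q")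
      case False
      then show ?thesis using ne by (auto simp: a_def)
    next
      case True
      define h where "h = c \<odot>\<^bsub>P\<^esub> f \<ominus>\<^bsub>P\<^esub> a \<odot>\<^bsub>P\<^esub> (\<Theta> ^^ (e - n)) g"
      have hL: "h \<in> L" using less L_pow by (auto simp: h_def intro!: minus smult)
      have co: "up_ring.coeff P h i = c \<otimes> up_ring.coeff P f i \<ominus> a \<otimes> up_ring.coeff P ((\<Theta> ^^ (e - n)) g) i" for i
        by (simp add: h_def coeff_minus)
      have degpow: "deg R ((\<Theta> ^^ (e - n)) g) \<le> e" "up_ring.coeff P ((\<Theta> ^^ (e - n)) g) e = c"
        using coeff_Theta_pow_shift[of g n "e - n"] ne by (auto simp: n_def c_def)
      have iff: "up_ring.coeff P h i \<in> Q \<longleftrightarrow> up_ring.coeff P f i \<in> Q" for i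
      proof -
        let ?z = "a \<otimes> up_ring.coeff P ((\<Theta> ^^ (e - n)) g) i"
        have z: "?z \<in> Q" using True by (intro Q.I_r_closed) auto
        have eq: "c \<otimes> up_ring.coeff P f i = up_ring.coeff P h i \<oplus> ?z"
          unfolding co a_minus_def by (simp add: R.a_assoc R.l_neg)
        show ?thesis
        proof
          assume "up_ring.coeff P h i \<in> Q"
          then have "c \<otimes> up_ring.coeff P f i \<in> Q" unfolding eq using z by (rule Q.a_closed)
          then show "up_ring.coeff P f i \<in> Q" using Q.I_prime[of c "up_ring.coeff P f i"] Q(2) by simp
        next
          assume "up_ring.coeff P f i \<in> Q"
          then have "c \<otimes> up_ring.coeff P f i \<in> Q" by (intro Q.I_l_closed) auto
          then show "up_ring.coeff P h i \<in> Q" unfolding co using z by (rule Q.I_minus_closed)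
        qed
      qed
      have "up_ring.coeff P h j \<notin> Q" using less iff by simp
      moreover have "deg R h < deg R f"
      proof -
        have hP: "h \<in> carrier P" using hL L_sub by auto
        have "up_ring.coeff P h m = \<zero>" if "e \<le> m" for m
        proof (cases "m = e")
          case True
          then show ?thesis unfolding co by (simp add: degpow a_def R.m_comm R.r_neg a_minus_def)
        next
          case False
          then have "up_ring.coeff P f m = \<zero>" "up_ring.coeff P ((\<Theta> ^^ (e - n)) g) m = \<zero>"
            using that degpow(1) by (auto intro!: deg_aboveD simp: e_def)
          then show ?thesis unfolding co by (simp add: a_minus_def)
        qed
        \<comment> \<open>The truncated \<open>e - 1\<close> is a strict decrease because
          \<open>0 < n \<le> e\<close>.\<close>
        then have "deg R h \<le> e - 1"
          by (intro deg_aboveI hP) auto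
        then show ?thesis using ne n_pos by (auto simp: e_def)
      qed
      ultimately show ?thesis using less.hyps[of h j] hL iff by auto
    qed
  qed
  show ?thesis
  proof (rule that[of c])
    fix Q f assume Q: "primeideal Q R" "c \<notin> Q" and f: "f \<in> L"
      and i: "\<And>i. 0 < i \<Longrightarrow> up_ring.coeff P f i \<in> Q"
    \<comment> \<open>Otherwise \<open>high\<close> with \<open>j = 0\<close> would give a
      coefficient outside \<open>Q\<close> in some degree at least \<open>n\<close>, which is
      positive.\<close>
    show "up_ring.coeff P f 0 \<in> Q"
      using high[OF Q f, of 0] i n_pos by (meson less_le_trans)
  qed simp_all
qed

end

section \<open>Maximal ideals in extensions by one generator\<close>

lemma (in ring) exists_maximalideal:
  assumes I: "ideal I R" "\<one> \<notin> I"
  obtains M where "maximalideal M R" "I \<subseteq> M"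
proof -
  define F where "F = {J. ideal J R \<and> I \<subseteq> J \<and> \<one> \<notin> J}"
  have "\<exists>M\<in>F. \<forall>J\<in>F. M \<subseteq> J \<longrightarrow> J = M"
  proof (rule subset_Zorn_nonempty)
    show "F \<noteq> {}" using I by (auto simp: F_def)
    fix C assume C: "C \<noteq> {}" "subset.chain F C"
    then have "subset.chain {J. ideal J R} C"
      by (auto simp: pred_on.chain_def F_def)
    from chain_Union_is_ideal[OF this] have "ideal (\<Union>C) R" using C by simp
    moreover have "I \<subseteq> J" "\<one> \<notin> J" if "J \<in> C" for J
      using C that by (auto simp: pred_on.chain_def F_def)
    ultimately show "\<Union>C \<in> F" using C(1) by (auto simp: F_def)
  qed
  then obtain M where "M \<in> F" and max_F: "\<forall>J\<in>F. M \<subseteq> J \<longrightarrow> J = M" by blast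
  then have M: "ideal M R" "I \<subseteq> M" "\<one> \<notin> M" by (simp_all add: F_def)
  have max: "J = M" if "ideal J R" "M \<subseteq> J" "\<one> \<notin> J" for J
    using max_F M(2) that by (auto simp: F_def)
  have "maximalideal M R"
  proof (rule maximalidealI[OF M(1)])
    show "carrier R \<noteq> M" using M(3) by blast
    show "J = M \<or> J = carrier R" if "ideal J R" "M \<subseteq> J" for J
      using max[OF that] ideal.one_imp_carrier[OF that(1)] by blast
  qed
  then show thesis using M(2) by (rule that)
qed

lemma (in ring_hom_ring) ideal_image:
  assumes I: "ideal I R" and surj: "h ` carrier R = carrier S"
  shows "ideal (h ` I) S"
proof -
  interpret I: ideal I R by fact
  show ?thesis
  proof (rule idealI[OF S.ring_axioms])
    show "subgroup (h ` I) (add_monoid S)"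
    proof (rule S.add.subgroupI)
      show "h ` I \<subseteq> carrier S" using I.Icarr by auto
      show "h ` I \<noteq> {}" using I.zero_closed by blast
      show "\<ominus>\<^bsub>S\<^esub> a \<in> h ` I" if "a \<in> h ` I" for a
        using that I.Icarr I.a_inv_closed by (auto simp flip: hom_a_inv)
      show "a \<oplus>\<^bsub>S\<^esub> b \<in> h ` I" if "a \<in> h ` I" "b \<in> h ` I" for a b
        using that I.Icarr I.a_closed by (auto simp flip: hom_add)
    qed
    fix a x assume "a \<in> h ` I" "x \<in> carrier S"
    then obtain i r where ir: "i \<in> I" "a = h i" "r \<in> carrier R" "x = h r"
      using surj by blast
    show "x \<otimes>\<^bsub>S\<^esub> a \<in> h ` I" "a \<otimes>\<^bsub>S\<^esub> x \<in> h ` I"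
      using ir I.Icarr[OF ir(1)] I.I_l_closed[OF ir(1,3)] I.I_r_closed[OF ir(1,3)]
      by (simp_all flip: hom_mult)
  qed
qed

text \<open>The Jacobson radical is zero, stated one element at a time because each use needs a
  maximal ideal avoiding one given element.\<close>

definition jacobson_semisimple :: "('a, 'm) ring_scheme \<Rightarrow> bool" where
  "jacobson_semisimple R \<longleftrightarrow>
     (\<forall>a\<in>carrier R. a \<noteq> \<zero>\<^bsub>R\<^esub> \<longrightarrow> (\<exists>M. maximalideal M R \<and> a \<notin> M))"

text \<open>With the zero derivation \<open>\<theta>\<close> becomes the ordinary variable, so
  \<open>avoid_primes\<close> applies to ideals of the polynomial ring.\<close>

lemma (in UP_cring) theta_mult_zero:
  assumes "q \<in> carrier P"
  shows "theta_mult R (\<lambda>_. \<zero>) q = up_ring.monom P \<one> 1 \<otimes>\<^bsub>P\<^esub> q"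
proof -
  interpret N: derivation_UP R "\<lambda>_. \<zero>" P
    by unfold_locales (auto simp: P_def)
  show ?thesis
  proof (rule up_eqI)
    fix n
    show "up_ring.coeff P (theta_mult R (\<lambda>_. \<zero>) q) n = up_ring.coeff P (up_ring.monom P \<one> 1 \<otimes>\<^bsub>P\<^esub> q) n"
    proof (cases n)
      case 0
      then show ?thesis using assms by (simp add: N.coeff_Theta)
    next
      case (Suc m)
      then show ?thesis using assms coeff_monom_mult[of \<one> q 1 m] by (simp add: N.coeff_Theta)
    qed
  qed (use assms in auto)
qed

text \<open>Describes \<open>S\<close> as a domain generated by \<open>x\<close> over a copy of
  \<open>R\<close>. Surjectivity of evaluation lets ideals of \<open>S\<close> be studied through
  their preimages among the polynomials.\<close>

locale one_generator_extension =
  UP_pre_univ_prop R S h P + R?: domain R + S?: domain S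
  for R (structure) and S (structure) and h and P (structure) +
  fixes x
  assumes x_closed [simp]: "x \<in> carrier S"
    and inj: "inj_on h (carrier R)"
    and eval_surj: "UnivPoly.eval R S h x ` carrier P = carrier S"
begin

definition E where "E = UnivPoly.eval R S h x"

lemmas E_surj = eval_surj[folded E_def]

sublocale UP_domain R P by unfold_locales
sublocale E: ring_hom_cring P S E
  unfolding E_def by (rule ring_homD[OF UP_pre_univ_prop.eval_ring_hom[OF UP_pre_univ_prop_axioms x_closed, folded P_def]])

lemma h_eq_zero: "\<lbrakk>a \<in> carrier R; h a = \<zero>\<^bsub>S\<^esub>\<rbrakk> \<Longrightarrow> a = \<zero>"
  using inj by (metis R.zero_closed hom_zero inj_onD)

lemma E_const [simp]: "a \<in> carrier R \<Longrightarrow> E (up_ring.monom P a 0) = h a"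
  unfolding E_def by (rule UP_pre_univ_prop.eval_const[OF UP_pre_univ_prop_axioms x_closed, folded P_def])

lemma E_X [simp]: "E (up_ring.monom P \<one> 1) = x"
  unfolding E_def by (rule UP_pre_univ_prop.eval_monom1[OF UP_pre_univ_prop_axioms x_closed, folded P_def])

lemma E_smult [simp]: "\<lbrakk>a \<in> carrier R; p \<in> carrier P\<rbrakk> \<Longrightarrow> E (a \<odot>\<^bsub>P\<^esub> p) = h a \<otimes>\<^bsub>S\<^esub> E p"
  using E.hom_mult[of "up_ring.monom P a 0" p] by (simp add: monom_mult_is_smult)

text \<open>By the hypothesis on \<open>W\<close>, its preimage \<open>L\<close> has no nonzero
  constants, so \<open>avoid_primes\<close> supplies \<open>c\<close>. If \<open>M\<close> avoids
  \<open>c\<close>, then \<open>M S + W\<close> is proper: from \<open>1 = E p + w\<close> with the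
  coefficients of \<open>p\<close> in \<open>M\<close>, the polynomial \<open>1 - p\<close> lies in
  \<open>L\<close> and has its higher coefficients in \<open>M\<close>, hence also its constant one,
  which would put \<open>1\<close> into \<open>M\<close>. A maximal ideal above
  \<open>M S + W\<close> contracts to \<open>M\<close>.\<close>

lemma lying_over:
  assumes W: "ideal W S" and W0: "\<And>a. \<lbrakk>a \<in> carrier R; h a \<in> W\<rbrakk> \<Longrightarrow> a = \<zero>"
  obtains c where "c \<in> carrier R" "c \<noteq> \<zero>"
    "\<And>M. \<lbrakk>maximalideal M R; c \<notin> M\<rbrakk> \<Longrightarrow>
      \<exists>N. maximalideal N S \<and> W \<subseteq> N \<and> {a \<in> carrier R. h a \<in> N} = M"
proof -
  interpret W: ideal W S by fact
  interpret N: derivation_domain R "\<lambda>_. \<zero>" P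
    by unfold_locales (auto simp: P_def)
  define L where "L = {p \<in> carrier P. E p \<in> W}"
  have E_minus: "E (f \<ominus>\<^bsub>P\<^esub> g) = E f \<ominus>\<^bsub>S\<^esub> E g" if "f \<in> carrier P" "g \<in> carrier P" for f g
    using that by (simp add: a_minus_def)
  obtain c where c: "c \<in> carrier R" "c \<noteq> \<zero>" and avoid:
    "\<And>Q f. \<lbrakk>primeideal Q R; c \<notin> Q; f \<in> L; \<And>i. 0 < i \<Longrightarrow> up_ring.coeff P f i \<in> Q\<rbrakk> \<Longrightarrow> up_ring.coeff P f 0 \<in> Q"
  proof (rule N.avoid_primes)
    show "L \<subseteq> carrier P" by (auto simp: L_def)
    show "f \<ominus>\<^bsub>P\<^esub> g \<in> L" if "f \<in> L" "g \<in> L" for f g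
      using that by (simp add: L_def E_minus W.I_minus_closed)
    show "a \<odot>\<^bsub>P\<^esub> f \<in> L" if "a \<in> carrier R" "f \<in> L" for a f
      using that by (simp add: L_def W.I_l_closed)
    show "theta_mult R (\<lambda>_. \<zero>) f \<in> L" if "f \<in> L" for f
      using that by (simp add: L_def theta_mult_zero W.I_l_closed del: One_nat_def)
    show "f = \<zero>\<^bsub>P\<^esub>" if f: "f \<in> L" "deg R f = 0" for f
    proof -
      have fP: "f \<in> carrier P" "E f \<in> W" using f by (auto simp: L_def)
      define a where "a = up_ring.coeff P f 0"
      have a: "a \<in> carrier R" using fP by (simp add: a_def)
      have eq: "f = up_ring.monom P a 0"
        unfolding a_def using fP f(2) by (intro deg_zero_impl_monom)
      then have "h a \<in> W" using fP(2) a by simp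
      then show ?thesis using W0[OF a] eq by simp
    qed
  qed blast
  have "\<exists>N. maximalideal N S \<and> W \<subseteq> N \<and> {a \<in> carrier R. h a \<in> N} = M"
    if M: "maximalideal M R" "c \<notin> M" for M
  proof -
    interpret M: maximalideal M R by fact
    have M1: "\<one> \<notin> M" using M.I_notcarr M.one_imp_carrier by auto
    define K where "K = {p \<in> carrier P. \<forall>i. up_ring.coeff P p i \<in> M}"
    have K: "ideal K P"
    proof (rule idealI[OF P.ring_axioms])
      show "subgroup K (add_monoid P)"
      proof (rule P.add.subgroupI)
        show "K \<noteq> {}" using M.zero_closed by (auto simp: K_def intro!: exI[of _ "\<zero>\<^bsub>P\<^esub>"])
        show "\<ominus>\<^bsub>P\<^esub> p \<in> K" if "p \<in> K" for p
          using that by (simp add: K_def M.a_inv_closed)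
        show "p \<oplus>\<^bsub>P\<^esub> q \<in> K" if "p \<in> K" "q \<in> K" for p q
          using that by (simp add: K_def M.a_closed)
      qed (auto simp: K_def)
      have l: "q \<otimes>\<^bsub>P\<^esub> p \<in> K" if "p \<in> K" "q \<in> carrier P" for p q
      proof -
        have "(\<Oplus>i\<in>{..n}. up_ring.coeff P q i \<otimes> up_ring.coeff P p (n - i)) \<in> M" for n
        proof -
          have "(\<Oplus>i\<in>{..k}. up_ring.coeff P q i \<otimes> up_ring.coeff P p (n - i)) \<in> M" for k
          proof (induction k)
            case 0
            then show ?case using that by (simp add: K_def M.I_l_closed)
          next
            case (Suc k)
            then show ?case using that
              by (subst R.finsum_Suc) (simp_all add: K_def M.I_l_closed M.a_closed Pi_def)
          qed
          then show ?thesis .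
        qed
        then show ?thesis using that by (simp add: K_def)
      qed
      then show "q \<otimes>\<^bsub>P\<^esub> p \<in> K" "p \<otimes>\<^bsub>P\<^esub> q \<in> K" if "p \<in> K" "q \<in> carrier P" for p q
        using that P.m_comm[of p q] by (auto simp: K_def)
    qed
    have EK: "ideal (E ` K) S" by (rule E.ring.ideal_image[OF K E_surj])
    define I where "I = E ` K <+>\<^bsub>S\<^esub> W"
    have I: "ideal I S" unfolding I_def by (rule S.add_ideals[OF EK W])
    have "\<one>\<^bsub>S\<^esub> \<notin> I"
    proof
      assume "\<one>\<^bsub>S\<^esub> \<in> I"
      then have "\<exists>y\<in>E ` K. \<exists>w\<in>W. \<one>\<^bsub>S\<^esub> = y \<oplus>\<^bsub>S\<^esub> w"
        by (simp only: I_def set_add_def' UN_iff singleton_iff)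
      then obtain p w where pw: "p \<in> K" "w \<in> W" "\<one>\<^bsub>S\<^esub> = E p \<oplus>\<^bsub>S\<^esub> w"
        by (elim bexE imageE) metis
      have pP: "p \<in> carrier P" using pw(1) by (simp add: K_def)
      have wS: "w \<in> carrier S" using pw(2) by (rule W.Icarr)
      have EpS: "E p \<in> carrier S" using pP by simp
      have "E (\<one>\<^bsub>P\<^esub> \<ominus>\<^bsub>P\<^esub> p) = \<one>\<^bsub>S\<^esub> \<ominus>\<^bsub>S\<^esub> E p"
        using pP E_minus[of "\<one>\<^bsub>P\<^esub>" p] by simp
      also have "\<dots> = (w \<oplus>\<^bsub>S\<^esub> E p) \<ominus>\<^bsub>S\<^esub> E p"
        unfolding pw(3) using S.a_comm[OF EpS wS] by simp
      also have "\<dots> = w"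
        using EpS wS by (simp add: a_minus_def S.a_assoc S.r_neg)
      finally have "E (\<one>\<^bsub>P\<^esub> \<ominus>\<^bsub>P\<^esub> p) = w" .
      then have f: "\<one>\<^bsub>P\<^esub> \<ominus>\<^bsub>P\<^esub> p \<in> L" using pw(2) pP by (simp add: L_def)
      have pM: "up_ring.coeff P p i \<in> M" for i using pw(1) by (simp add: K_def)
      have "up_ring.coeff P (\<one>\<^bsub>P\<^esub> \<ominus>\<^bsub>P\<^esub> p) 0 \<in> M"
      proof (rule avoid[OF R.maximalideal_prime[OF M(1)] M(2) f])
        fix i :: nat assume "0 < i"
        then show "up_ring.coeff P (\<one>\<^bsub>P\<^esub> \<ominus>\<^bsub>P\<^esub> p) i \<in> M"
          using pP pM[of i] by (simp add: coeff_minus M.I_minus_closed M.zero_closed)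
      qed
      then have "(\<one> \<ominus> up_ring.coeff P p 0) \<oplus> up_ring.coeff P p 0 \<in> M"
        using pP pM[of 0] by (intro M.a_closed) (simp_all add: coeff_minus)
      moreover have "(\<one> \<ominus> up_ring.coeff P p 0) \<oplus> up_ring.coeff P p 0 = \<one>"
        using pP by (simp add: a_minus_def R.a_assoc R.l_neg)
      ultimately show False using M1 by simp
    qed
    then obtain N where N: "maximalideal N S" "I \<subseteq> N"
      using S.exists_maximalideal[OF I] by blast
    interpret N: maximalideal N S by fact
    have WN: "W \<subseteq> N"
    proof
      fix w assume w: "w \<in> W"
      have "\<zero>\<^bsub>S\<^esub> \<oplus>\<^bsub>S\<^esub> w \<in> I"
        unfolding I_def set_add_def' using w additive_subgroup.zero_closed[OF ideal.axioms(1)[OF EK]] by blast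
      then show "w \<in> N" using N(2) S.l_zero[OF W.Icarr[OF w]] by auto
    qed
    have MN: "h a \<in> N" if a: "a \<in> M" for a
    proof -
      have aR: "a \<in> carrier R" using a by (rule M.Icarr)
      have "up_ring.monom P a 0 \<in> K" using a aR by (simp add: K_def)
      then have "E (up_ring.monom P a 0) \<oplus>\<^bsub>S\<^esub> \<zero>\<^bsub>S\<^esub> \<in> I"
        unfolding I_def set_add_def' using W.zero_closed by blast
      then show ?thesis using N(2) E_const[OF aR] S.r_zero[OF hom_closed[OF aR]] by auto
    qed
    have "{a \<in> carrier R. h a \<in> N} = M"
    proof -
      have "{a \<in> carrier R. h a \<in> N} = M \<or> {a \<in> carrier R. h a \<in> N} = carrier R"
      proof (rule M.I_maximal)
        show "ideal {a \<in> carrier R. h a \<in> N} R"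
          by (rule ring.ideal_vimage) (rule N.is_ideal)
        show "M \<subseteq> {a \<in> carrier R. h a \<in> N}" using MN M.Icarr by auto
      qed auto
      moreover have "\<one> \<notin> {a \<in> carrier R. h a \<in> N}"
        using N.I_notcarr N.one_imp_carrier by auto
      ultimately show ?thesis using R.one_closed by blast
    qed
    then show ?thesis using N(1) WN by blast
  qed
  then show thesis using c that by blast
qed

text \<open>Contrapositively: if \<open>x\<close> is algebraic over \<open>R\<close>, then every nonzero ideal of \<open>S\<close> meets \<open>R\<close>.\<close>

lemma injective_E_if_disjoint:
  assumes b: "b \<in> carrier S" "b \<noteq> \<zero>\<^bsub>S\<^esub>"
    and disjoint: "\<And>a. \<lbrakk>a \<in> carrier R; h a \<in> PIdl\<^bsub>S\<^esub> b\<rbrakk> \<Longrightarrow> a = \<zero>"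
    and p: "p \<in> carrier P" "E p = \<zero>\<^bsub>S\<^esub>"
  shows "p = \<zero>\<^bsub>P\<^esub>"
proof (rule ccontr)
  assume "p \<noteq> \<zero>\<^bsub>P\<^esub>"
  define B where "B = PIdl\<^bsub>S\<^esub> b"
  have B: "ideal B S" unfolding B_def using b(1) by (rule S.cgenideal_ideal)
  note B_l = ideal.I_l_closed[OF B] and B_r = ideal.I_r_closed[OF B]
  \<comment> \<open>A relation of least degree for \<open>x\<close> over \<open>R\<close>. As
    \<open>R\<close> is only a domain, pseudo-division takes the place of division below.\<close>
  define d where "d = arg_min (deg R) (\<lambda>p. p \<in> carrier P \<and> E p = \<zero>\<^bsub>S\<^esub> \<and> p \<noteq> \<zero>\<^bsub>P\<^esub>)"
  have d: "d \<in> carrier P" "E d = \<zero>\<^bsub>S\<^esub>" "d \<noteq> \<zero>\<^bsub>P\<^esub>"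
    and d_min: "\<And>q. \<lbrakk>q \<in> carrier P; E q = \<zero>\<^bsub>S\<^esub>; q \<noteq> \<zero>\<^bsub>P\<^esub>\<rbrakk> \<Longrightarrow> deg R d \<le> deg R q"
    using arg_min_nat_lemma[of "\<lambda>p. p \<in> carrier P \<and> E p = \<zero>\<^bsub>S\<^esub> \<and> p \<noteq> \<zero>\<^bsub>P\<^esub>" p "deg R"] p
      \<open>p \<noteq> \<zero>\<^bsub>P\<^esub>\<close> unfolding d_def by blast+
  obtain \<beta> where "\<beta> \<in> carrier P" "E \<beta> = b" using b E_surj by (metis imageE)
  then have \<beta>: "\<beta> \<in> carrier P \<and> E \<beta> \<in> B \<and> E \<beta> \<noteq> \<zero>\<^bsub>S\<^esub>"
    using b S.cgenideal_self by (simp add: B_def)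
  \<comment> \<open>Requiring \<open>E p\<close> rather than \<open>p\<close> to be nonzero keeps
    the relations of \<open>x\<close> out.\<close>
  define g where "g = arg_min (deg R) (\<lambda>p. p \<in> carrier P \<and> E p \<in> B \<and> E p \<noteq> \<zero>\<^bsub>S\<^esub>)"
  have g: "g \<in> carrier P" "E g \<in> B" "E g \<noteq> \<zero>\<^bsub>S\<^esub>"
    and g_min: "\<And>q. \<lbrakk>q \<in> carrier P; E q \<in> B; E q \<noteq> \<zero>\<^bsub>S\<^esub>\<rbrakk> \<Longrightarrow> deg R g \<le> deg R q"
    using arg_min_nat_lemma[of "\<lambda>p. p \<in> carrier P \<and> E p \<in> B \<and> E p \<noteq> \<zero>\<^bsub>S\<^esub>" \<beta> "deg R"] \<beta>
    unfolding g_def by blast+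
  have g0: "g \<noteq> \<zero>\<^bsub>P\<^esub>" using g(3) by auto
  have g_pos: "deg R g > 0"
  proof (rule ccontr)
    assume "\<not> deg R g > 0"
    define a where "a = up_ring.coeff P g 0"
    have a: "a \<in> carrier R" using g(1) by (simp add: a_def)
    have eq: "g = up_ring.monom P a 0"
      unfolding a_def using g(1) \<open>\<not> deg R g > 0\<close> by (intro deg_zero_impl_monom) auto
    then have "h a \<in> B" using g(2) a by simp
    then have "a = \<zero>" using disjoint a by (simp add: B_def)
    then show False using eq g0 by simp
  qed
  have lcoeff_pow: "up_ring.coeff P q (deg R q) [^] k \<in> carrier R"
    "up_ring.coeff P q (deg R q) [^] k \<noteq> \<zero>"
    if "q \<in> carrier P" "q \<noteq> \<zero>\<^bsub>P\<^esub>" for q and k :: nat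
  proof -
    have c: "up_ring.coeff P q (deg R q) \<in> carrier R" "up_ring.coeff P q (deg R q) \<noteq> \<zero>"
      using that lcoeff_nonzero by auto
    then show "up_ring.coeff P q (deg R q) [^] k \<in> carrier R" by simp
    show "up_ring.coeff P q (deg R q) [^] k \<noteq> \<zero>"
      using c by (induction k) (auto simp: R.integral_iff)
  qed
  \<comment> \<open>Pseudo-division of \<open>g\<close> by \<open>d\<close>: the remainder has value
    \<open>h l \<otimes> E g\<close>, again nonzero in \<open>B\<close>, so its degree is at least
    that of \<open>g\<close>.\<close>
  have g_less_d: "deg R g < deg R d"
  proof -
    obtain q r and k :: nat where qr: "q \<in> carrier P" "r \<in> carrier P"
      "up_ring.coeff P d (deg R d) [^] k \<odot>\<^bsub>P\<^esub> g = d \<otimes>\<^bsub>P\<^esub> q \<oplus>\<^bsub>P\<^esub> r"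
      "r = \<zero>\<^bsub>P\<^esub> \<or> deg R r < deg R d"
      using long_div_theorem[OF d(1) g(1) d(3)] by blast
    define l where "l = up_ring.coeff P d (deg R d) [^] k"
    have l: "l \<in> carrier R" "l \<noteq> \<zero>" using lcoeff_pow[OF d(1,3)] by (auto simp: l_def)
    have "E (l \<odot>\<^bsub>P\<^esub> g) = E (d \<otimes>\<^bsub>P\<^esub> q \<oplus>\<^bsub>P\<^esub> r)" using qr(3) by (simp add: l_def)
    then have Er: "E r = h l \<otimes>\<^bsub>S\<^esub> E g" using qr(1,2) d g(1) l by simp
    then have "E r \<in> B" "E r \<noteq> \<zero>\<^bsub>S\<^esub>"
      using B_l[OF g(2)] g l h_eq_zero[of l] by (auto simp: S.integral_iff)
    then have "deg R g \<le> deg R r" "r \<noteq> \<zero>\<^bsub>P\<^esub>" using g_min qr(2) by auto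
    then show ?thesis using qr(4) by auto
  qed
  \<comment> \<open>Now \<open>d\<close> is divided by \<open>g\<close>. The remainder has its value
    in \<open>B\<close> and degree below that of \<open>g\<close>, so the value is zero; as
    \<open>g\<close> has smaller degree than \<open>d\<close>, minimality of \<open>d\<close> makes
    the remainder itself zero. Then \<open>q\<close> is a relation of degree below that of
    \<open>d\<close>, a contradiction.\<close>
  obtain q r and k :: nat where qr: "q \<in> carrier P" "r \<in> carrier P"
    "up_ring.coeff P g (deg R g) [^] k \<odot>\<^bsub>P\<^esub> d = g \<otimes>\<^bsub>P\<^esub> q \<oplus>\<^bsub>P\<^esub> r"
    "r = \<zero>\<^bsub>P\<^esub> \<or> deg R r < deg R g"
    using long_div_theorem[OF g(1) d(1) g0] by blast
  define l where "l = up_ring.coeff P g (deg R g) [^] k"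
  have l: "l \<in> carrier R" "l \<noteq> \<zero>" using lcoeff_pow[OF g(1) g0] by (auto simp: l_def)
  have "E (l \<odot>\<^bsub>P\<^esub> d) = E (g \<otimes>\<^bsub>P\<^esub> q \<oplus>\<^bsub>P\<^esub> r)" using qr(3) by (simp add: l_def)
  then have Eqr: "E g \<otimes>\<^bsub>S\<^esub> E q \<oplus>\<^bsub>S\<^esub> E r = \<zero>\<^bsub>S\<^esub>" using qr(1,2) d g(1) l by simp
  then have "E r = \<ominus>\<^bsub>S\<^esub> (E g \<otimes>\<^bsub>S\<^esub> E q)"
    using qr(1,2) g(1) by (metis E.hom_closed S.a_comm S.m_closed S.minus_equality)
  then have "E r \<in> B"
    using B_r[OF g(2), of "E q"] qr(1) by (simp add: additive_subgroup.a_inv_closed[OF ideal.axioms(1)[OF B]])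
  then have Er: "E r = \<zero>\<^bsub>S\<^esub>" if "r \<noteq> \<zero>\<^bsub>P\<^esub>"
    using g_min[OF qr(2)] qr(4) that by auto
  have r0: "r = \<zero>\<^bsub>P\<^esub>"
    using Er d_min[OF qr(2)] qr(4) g_less_d by (meson leD less_trans)
  then have "E g \<otimes>\<^bsub>S\<^esub> E q = \<zero>\<^bsub>S\<^esub>" using Eqr qr(1) g(1) by simp
  then have Eq: "E q = \<zero>\<^bsub>S\<^esub>" using S.integral[of "E g" "E q"] g qr(1) by simp
  have eq: "l \<odot>\<^bsub>P\<^esub> d = g \<otimes>\<^bsub>P\<^esub> q" using qr r0 g(1) by (simp add: l_def)
  have "l \<odot>\<^bsub>P\<^esub> d \<noteq> \<zero>\<^bsub>P\<^esub>"
  proof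
    assume "l \<odot>\<^bsub>P\<^esub> d = \<zero>\<^bsub>P\<^esub>"
    then have "l \<otimes> up_ring.coeff P d (deg R d) = \<zero>"
      using l d(1) by (metis coeff_smult coeff_zero)
    then show False using l d lcoeff_nonzero[OF d(3,1)] R.integral[of l] by auto
  qed
  then have q0: "q \<noteq> \<zero>\<^bsub>P\<^esub>" using eq g(1) by auto
  then have "deg R d \<le> deg R q" using d_min qr(1) Eq by blast
  moreover have "deg R g + deg R q = deg R d"
    using arg_cong[OF eq, of "deg R"] l d(1) deg_mult[OF g0 q0 g(1) qr(1)] by simp
  ultimately show False using g_pos by simp
qed

text \<open>If the ideal of \<open>b\<close> contains a nonzero \<open>a\<close> from
  \<open>R\<close>, a maximal ideal of \<open>S\<close> over one of \<open>R\<close> that avoids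
  \<open>c \<otimes> a\<close> cannot contain \<open>b\<close>. Otherwise \<open>x\<close> is
  transcendental, and a maximal ideal containing \<open>1 + x b\<close> is used: it cannot contain
  \<open>b\<close> without containing \<open>1\<close>.\<close>

lemma jacobson_semione_generator_extension:
  assumes R: "jacobson_semisimple R"
  shows "jacobson_semisimple S"
  unfolding jacobson_semisimple_def
proof (intro ballI impI)
  fix b assume b: "b \<in> carrier S" "b \<noteq> \<zero>\<^bsub>S\<^esub>"
  show "\<exists>N. maximalideal N S \<and> b \<notin> N"
  proof (cases "\<exists>a\<in>carrier R. a \<noteq> \<zero> \<and> h a \<in> PIdl\<^bsub>S\<^esub> b")
    case True
    then obtain a where a: "a \<in> carrier R" "a \<noteq> \<zero>" "h a \<in> PIdl\<^bsub>S\<^esub> b" by blast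
    obtain c where c: "c \<in> carrier R" "c \<noteq> \<zero>" and over: "\<And>M. \<lbrakk>maximalideal M R; c \<notin> M\<rbrakk> \<Longrightarrow>
        \<exists>N. maximalideal N S \<and> {\<zero>\<^bsub>S\<^esub>} \<subseteq> N \<and> {a \<in> carrier R. h a \<in> N} = M"
      using lying_over[OF S.zeroideal] h_eq_zero by auto
    have "c \<otimes> a \<noteq> \<zero>" using a c by (simp add: R.integral_iff)
    then obtain M where M: "maximalideal M R" "c \<otimes> a \<notin> M"
      using R a c unfolding jacobson_semisimple_def by (meson R.m_closed)
    have "ideal M R" using M(1) by (rule maximalideal.axioms)
    then have "c \<notin> M" "a \<notin> M"
      using M(2) a(1) c(1) ideal.I_l_closed ideal.I_r_closed by metis+
    then obtain N where N: "maximalideal N S" "{a \<in> carrier R. h a \<in> N} = M"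
      using over M(1) by blast
    have "ideal N S" using N(1) by (rule maximalideal.axioms)
    then have "b \<notin> N"
      using S.cgenideal_minimal[of N b] a N(2) \<open>a \<notin> M\<close> by blast
    then show ?thesis using N(1) by blast
  next
    case False
    then have inj_E: "p = \<zero>\<^bsub>P\<^esub>" if "p \<in> carrier P" "E p = \<zero>\<^bsub>S\<^esub>" for p
      using injective_E_if_disjoint[OF b _ that] by blast
    obtain \<beta> where \<beta>: "\<beta> \<in> carrier P" "E \<beta> = b" using b E_surj by (metis imageE)
    have \<beta>0: "\<beta> \<noteq> \<zero>\<^bsub>P\<^esub>" using \<beta> b by auto
    \<comment> \<open>The factor \<open>x\<close> makes \<open>q\<close> nonconstant whatever
      \<open>b\<close> is, so no nonzero multiple of it is constant and \<open>lying_over\<close>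
      applies to the ideal generated by its value.\<close>
    define q where "q = \<one>\<^bsub>P\<^esub> \<oplus>\<^bsub>P\<^esub> up_ring.monom P \<one> 1 \<otimes>\<^bsub>P\<^esub> \<beta>"
    have q: "q \<in> carrier P" using \<beta> by (simp add: q_def)
    have Eq: "E q = \<one>\<^bsub>S\<^esub> \<oplus>\<^bsub>S\<^esub> x \<otimes>\<^bsub>S\<^esub> b" using \<beta> by (simp add: q_def del: One_nat_def)
    have q_deg: "deg R q \<ge> 1"
    proof -
      have "up_ring.coeff P q (deg R \<beta> + 1) = up_ring.coeff P \<beta> (deg R \<beta>)"
        using \<beta>(1) coeff_monom_mult[of \<one> \<beta> 1 "deg R \<beta>"] by (simp add: q_def)
      then have "deg R \<beta> + 1 \<le> deg R q"
        using lcoeff_nonzero[OF \<beta>0 \<beta>(1)] q by (intro deg_belowI) auto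
      then show ?thesis by simp
    qed
    define W where "W = PIdl\<^bsub>S\<^esub> (E q)"
    have W: "ideal W S" unfolding W_def using q by (intro S.cgenideal_ideal) simp
    have W0: "a = \<zero>" if a: "a \<in> carrier R" "h a \<in> W" for a
    proof (rule ccontr)
      assume "a \<noteq> \<zero>"
      obtain u where u: "u \<in> carrier S" "h a = u \<otimes>\<^bsub>S\<^esub> E q"
        using a(2) unfolding W_def cgenideal_def by blast
      obtain r where r: "r \<in> carrier P" "E r = u" using u E_surj by (metis imageE)
      have "E (r \<otimes>\<^bsub>P\<^esub> q \<ominus>\<^bsub>P\<^esub> up_ring.monom P a 0) = \<zero>\<^bsub>S\<^esub>"
        using r q u a(1) by (simp add: a_minus_def S.r_neg)
      then have "r \<otimes>\<^bsub>P\<^esub> q \<ominus>\<^bsub>P\<^esub> up_ring.monom P a 0 = \<zero>\<^bsub>P\<^esub>"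
        using r q a(1) by (intro inj_E) auto
      then have eq: "r \<otimes>\<^bsub>P\<^esub> q = up_ring.monom P a 0"
        using r q a(1) by simp
      have "up_ring.monom P a 0 \<noteq> \<zero>\<^bsub>P\<^esub>"
        using \<open>a \<noteq> \<zero>\<close> a(1) coeff_monom[of a 0 0] by (metis coeff_zero)
      then have "r \<noteq> \<zero>\<^bsub>P\<^esub>" using eq q by auto
      moreover have "q \<noteq> \<zero>\<^bsub>P\<^esub>" using q_deg by auto
      ultimately have "deg R r + deg R q = deg R (up_ring.monom P a 0)"
        using deg_mult[of r q] r q eq by simp
      then show False using q_deg a(1) by simp
    qed
    obtain c where c: "c \<in> carrier R" "c \<noteq> \<zero>" and over: "\<And>M. \<lbrakk>maximalideal M R; c \<notin> M\<rbrakk> \<Longrightarrow>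
        \<exists>N. maximalideal N S \<and> W \<subseteq> N \<and> {a \<in> carrier R. h a \<in> N} = M"
      using lying_over[OF W W0] by blast
    obtain M where "maximalideal M R" "c \<notin> M"
      using R c unfolding jacobson_semisimple_def by blast
    then obtain N where N: "maximalideal N S" "W \<subseteq> N" using over by blast
    interpret N: maximalideal N S by fact
    have "b \<notin> N"
    proof
      assume "b \<in> N"
      have "E q \<in> N" using N(2) q S.cgenideal_self[of "E q"] by (auto simp: W_def)
      then have "(\<one>\<^bsub>S\<^esub> \<oplus>\<^bsub>S\<^esub> x \<otimes>\<^bsub>S\<^esub> b) \<ominus>\<^bsub>S\<^esub> x \<otimes>\<^bsub>S\<^esub> b \<in> N"
        unfolding Eq using \<open>b \<in> N\<close> by (intro N.I_minus_closed N.I_l_closed) auto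
      moreover have "(\<one>\<^bsub>S\<^esub> \<oplus>\<^bsub>S\<^esub> x \<otimes>\<^bsub>S\<^esub> b) \<ominus>\<^bsub>S\<^esub> x \<otimes>\<^bsub>S\<^esub> b = \<one>\<^bsub>S\<^esub>"
        using b by (simp add: a_minus_def S.a_assoc S.r_neg)
      ultimately have "N = carrier S" using N.one_imp_carrier by simp
      then show False using N.I_notcarr by simp
    qed
    then show ?thesis using N(1) by blast
  qed
qed

end

section \<open>Hilbert's basis theorem\<close>

context UP_cring
begin

text \<open>The leading coefficients in degree \<open>n\<close>, together with zero: admitting
  smaller degrees makes the set closed under addition.\<close>

definition lead_ideal :: "nat \<Rightarrow> (nat \<Rightarrow> 'a) set \<Rightarrow> 'a set" where
  "lead_ideal n I = {up_ring.coeff P p n | p. p \<in> I \<and> deg R p \<le> n}"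

lemma lead_idealI: "\<lbrakk>p \<in> I; deg R p \<le> n; up_ring.coeff P p n = a\<rbrakk> \<Longrightarrow> a \<in> lead_ideal n I"
  by (auto simp: lead_ideal_def)

lemma lead_idealE:
  assumes "a \<in> lead_ideal n I"
  obtains p where "p \<in> I" "deg R p \<le> n" "up_ring.coeff P p n = a"
  using assms by (auto simp: lead_ideal_def)

lemma ideal_lead_ideal:
  assumes I: "ideal I P"
  shows "ideal (lead_ideal n I) R"
proof -
  have sub: "p \<in> carrier P" if "p \<in> I" for p using ideal.Icarr[OF I that] .
  note add_sub = ideal.axioms(1)[OF I]
  have smult: "a \<odot>\<^bsub>P\<^esub> p \<in> I" if "p \<in> I" "a \<in> carrier R" for a p
    using ideal.I_l_closed[OF I that(1), of "up_ring.monom P a 0"] that(2) sub[OF that(1)]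
    by (simp add: monom_mult_is_smult)
  have l: "x \<otimes> a \<in> lead_ideal n I" if a: "a \<in> lead_ideal n I" and x: "x \<in> carrier R" for a x
  proof -
    obtain p where p: "p \<in> I" "deg R p \<le> n" "up_ring.coeff P p n = a"
      using a by (rule lead_idealE)
    show ?thesis
      using p x deg_smult_decr[OF x sub[OF p(1)]] sub[OF p(1)]
      by (intro lead_idealI[OF smult[OF p(1) x]]) auto
  qed
  have carr: "a \<in> carrier R" if "a \<in> lead_ideal n I" for a
    using that sub by (auto elim!: lead_idealE)
  show ?thesis
  proof (rule idealI[OF R.ring_axioms])
    show "subgroup (lead_ideal n I) (add_monoid R)"
    proof (rule R.add.subgroupI)
      show "lead_ideal n I \<subseteq> carrier R" using carr by blast
      have "\<zero> \<in> lead_ideal n I"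
        by (rule lead_idealI[OF additive_subgroup.zero_closed[OF add_sub]]) simp_all
      then show "lead_ideal n I \<noteq> {}" by blast
      show "\<ominus> a \<in> lead_ideal n I" if a: "a \<in> lead_ideal n I" for a
      proof -
        obtain p where p: "p \<in> I" "deg R p \<le> n" "up_ring.coeff P p n = a"
          using a by (rule lead_idealE)
        show ?thesis
          using p sub[OF p(1)]
          by (intro lead_idealI[OF additive_subgroup.a_inv_closed[OF add_sub p(1)]]) auto
      qed
      show "a \<oplus> b \<in> lead_ideal n I" if ab: "a \<in> lead_ideal n I" "b \<in> lead_ideal n I" for a b
      proof -
        obtain p where p: "p \<in> I" "deg R p \<le> n" "up_ring.coeff P p n = a"
          using ab(1) by (rule lead_idealE)
        obtain q where q: "q \<in> I" "deg R q \<le> n" "up_ring.coeff P q n = b"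
          using ab(2) by (rule lead_idealE)
        have "deg R (p \<oplus>\<^bsub>P\<^esub> q) \<le> n"
          using deg_add[OF sub[OF p(1)] sub[OF q(1)]] p(2) q(2) by linarith
        then show ?thesis
          using p q sub[OF p(1)] sub[OF q(1)]
          by (intro lead_idealI[OF additive_subgroup.a_closed[OF add_sub p(1) q(1)]]) auto
      qed
    qed
    fix a x assume ax: "a \<in> lead_ideal n I" "x \<in> carrier R"
    show "x \<otimes> a \<in> lead_ideal n I" using l[OF ax] .
    then show "a \<otimes> x \<in> lead_ideal n I" using R.m_comm[OF carr[OF ax(1)] ax(2)] by simp
  qed
qed

lemma X_pow_mult:
  assumes "p \<in> carrier P" "deg R p \<le> n"
  shows "deg R (up_ring.monom P \<one> k \<otimes>\<^bsub>P\<^esub> p) \<le> n + k"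
    and "up_ring.coeff P (up_ring.monom P \<one> k \<otimes>\<^bsub>P\<^esub> p) (n + k) = up_ring.coeff P p n"
proof -
  show "deg R (up_ring.monom P \<one> k \<otimes>\<^bsub>P\<^esub> p) \<le> n + k"
    using deg_mult_ring[of "up_ring.monom P \<one> k" p] deg_monom_le[of \<one> k] assms by simp
  show "up_ring.coeff P (up_ring.monom P \<one> k \<otimes>\<^bsub>P\<^esub> p) (n + k) = up_ring.coeff P p n"
    using coeff_monom_mult[of \<one> p k n] assms by simp
qed

lemma lead_ideal_mono:
  assumes I: "ideal I P" and mn: "m \<le> n"
  shows "lead_ideal m I \<subseteq> lead_ideal n I"
proof
  fix a assume "a \<in> lead_ideal m I"
  then obtain p where p: "p \<in> I" "deg R p \<le> m" "up_ring.coeff P p m = a" by (rule lead_idealE)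
  show "a \<in> lead_ideal n I"
    using p mn X_pow_mult[OF ideal.Icarr[OF I p(1)] p(2), of "n - m"]
    by (intro lead_idealI[OF ideal.I_l_closed[OF I p(1), of "up_ring.monom P \<one> (n - m)"]]) auto
qed

text \<open>An element of \<open>J\<close> with the same top coefficient is subtracted from
  \<open>p\<close>; the difference stays in \<open>I\<close> because \<open>J \<subseteq> I\<close>,
  and its degree has dropped.\<close>

lemma subset_if_lead_ideals_subset:
  assumes I: "ideal I P" and J: "ideal J P" and JI: "J \<subseteq> I"
    and lead: "\<And>n. lead_ideal n I \<subseteq> lead_ideal n J"
  shows "I \<subseteq> J"
proof
  \<comment> \<open>The bound \<open>n\<close> is exclusive, so the base case is the zero polynomial
    alone; the degree would not separate it from nonzero constants.\<close>
  have "p \<in> J" if "p \<in> I" "\<And>m. n \<le> m \<Longrightarrow> up_ring.coeff P p m = \<zero>" for p n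
    using that
  proof (induction n arbitrary: p)
    case 0
    have "p = \<zero>\<^bsub>P\<^esub>"
      using 0(2) ideal.Icarr[OF I 0(1)] by (intro up_eqI) auto
    then show ?case
      using additive_subgroup.zero_closed[OF ideal.axioms(1)[OF J]] by simp
  next
    case (Suc n)
    have pP: "p \<in> carrier P" using ideal.Icarr[OF I Suc(2)] .
    have "deg R p \<le> n" using Suc(3) pP by (intro deg_aboveI) auto
    then have "up_ring.coeff P p n \<in> lead_ideal n J"
      using lead lead_idealI[OF Suc(2)] by blast
    then obtain q where q: "q \<in> J" "deg R q \<le> n" "up_ring.coeff P q n = up_ring.coeff P p n"
      by (rule lead_idealE)
    have qP: "q \<in> carrier P" using ideal.Icarr[OF J q(1)] .
    have "p \<ominus>\<^bsub>P\<^esub> q \<in> J"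
    proof (rule Suc.IH)
      show "p \<ominus>\<^bsub>P\<^esub> q \<in> I" using ideal.I_minus_closed[OF I Suc(2)] q(1) JI by blast
      fix m assume m: "n \<le> m"
      show "up_ring.coeff P (p \<ominus>\<^bsub>P\<^esub> q) m = \<zero>"
      proof (cases "m = n")
        case True
        then show ?thesis using q(3) pP qP by (simp add: coeff_minus R.r_neg a_minus_def)
      next
        case False
        then have "up_ring.coeff P p m = \<zero>" "up_ring.coeff P q m = \<zero>"
          using m Suc(3) q(2) qP by (auto intro!: deg_aboveD)
        then show ?thesis using pP qP by (simp add: coeff_minus)
      qed
    qed
    then have "p \<ominus>\<^bsub>P\<^esub> q \<oplus>\<^bsub>P\<^esub> q \<in> J"
      using additive_subgroup.a_closed[OF ideal.axioms(1)[OF J]] q(1) by blast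
    then show ?case using pP qP by (simp add: a_minus_def P.a_assoc P.l_neg)
  qed
  note * = this
  fix p assume p: "p \<in> I"
  show "p \<in> J"
    using p by (rule *[of p "Suc (deg R p)"]) (use ideal.Icarr[OF I p] in \<open>auto intro!: deg_aboveD\<close>)
qed

text \<open>The ideals \<open>lead_ideal n I\<close> increase with \<open>n\<close> and stabilise at
  some \<open>N\<close>. Lifting finite generating sets of those with \<open>n \<le> N\<close> gives
  a finite \<open>U\<close> whose ideal has at least the same lead ideals in all degrees, hence is
  all of \<open>I\<close>.\<close>

theorem noetherian_UP:
  assumes "noetherian_ring R"
  shows "noetherian_ring P"
proof (rule P.noetherian_ringI)
  interpret noetherian_ring R by fact
  fix I assume I: "ideal I P"
  have "\<Union>(range (\<lambda>n. lead_ideal n I)) \<in> range (\<lambda>n. lead_ideal n I)"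
  proof (rule ideal_chain_is_trivial)
    show "subset.chain {J. ideal J R} (range (\<lambda>n. lead_ideal n I))"
      unfolding subset_chain_def
    proof (intro conjI ballI)
      show "range (\<lambda>n. lead_ideal n I) \<subseteq> {J. ideal J R}" using ideal_lead_ideal[OF I] by blast
      fix Y Z assume "Y \<in> range (\<lambda>n. lead_ideal n I)" "Z \<in> range (\<lambda>n. lead_ideal n I)"
      then obtain m n where "Y = lead_ideal m I" "Z = lead_ideal n I" by blast
      then show "Y \<subseteq> Z \<or> Z \<subseteq> Y" using lead_ideal_mono[OF I] nle_le by metis
    qed
  qed simp
  then obtain N where "\<Union>(range (\<lambda>n. lead_ideal n I)) = lead_ideal N I" by blast
  then have N: "lead_ideal n I \<subseteq> lead_ideal N I" for n by blast
  \<comment> \<open>Quantifying over all ideals \<open>J\<close> containing the lifts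
    \<open>T\<close> allows the lifts for different \<open>n\<close> to be collected in one
    set.\<close>
  have "\<exists>T. finite T \<and> T \<subseteq> I \<and> (\<forall>J. ideal J P \<longrightarrow> T \<subseteq> J \<longrightarrow> lead_ideal n I \<subseteq> lead_ideal n J)" for n
  proof -
    obtain A where A: "A \<subseteq> carrier R" "finite A" "lead_ideal n I = Idl A"
      using finetely_gen[OF ideal_lead_ideal[OF I]] by blast
    then have "\<forall>a\<in>A. \<exists>p. p \<in> I \<and> deg R p \<le> n \<and> up_ring.coeff P p n = a"
      using R.genideal_self[OF A(1)] by (metis lead_idealE subsetD)
    then obtain f where f: "\<And>a. a \<in> A \<Longrightarrow> f a \<in> I \<and> deg R (f a) \<le> n \<and> up_ring.coeff P (f a) n = a"
      by metis
    show ?thesis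
    proof (intro exI[of _ "f ` A"] conjI allI impI)
      fix J assume J: "ideal J P" "f ` A \<subseteq> J"
      have "A \<subseteq> lead_ideal n J" using f J(2) by (auto intro!: lead_idealI)
      then show "lead_ideal n I \<subseteq> lead_ideal n J"
        unfolding A(3) by (rule R.genideal_minimal[OF ideal_lead_ideal[OF J(1)]])
    qed (use A f in auto)
  qed
  then obtain T where T: "\<And>n. finite (T n)" "\<And>n. T n \<subseteq> I"
    "\<And>n J. \<lbrakk>ideal J P; T n \<subseteq> J\<rbrakk> \<Longrightarrow> lead_ideal n I \<subseteq> lead_ideal n J"
    by metis
  define U where "U = (\<Union>n\<in>{..N}. T n)"
  have UI: "U \<subseteq> I" using T(2) by (auto simp: U_def)
  have UP: "U \<subseteq> carrier P" using UI ideal.Icarr[OF I] by blast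
  have J: "ideal (Idl\<^bsub>P\<^esub> U) P" using UP by (rule P.genideal_ideal)
  have JI: "Idl\<^bsub>P\<^esub> U \<subseteq> I" using I UI by (rule P.genideal_minimal)
  have lead: "lead_ideal n I \<subseteq> lead_ideal n (Idl\<^bsub>P\<^esub> U)" for n
  proof -
    have le: "lead_ideal m I \<subseteq> lead_ideal m (Idl\<^bsub>P\<^esub> U)" if "m \<le> N" for m
      using that P.genideal_self[OF UP] by (intro T(3)[OF J]) (auto simp: U_def)
    show ?thesis
    proof (cases "n \<le> N")
      case False
      then show ?thesis
        using N[of n] le[of N] lead_ideal_mono[OF J, of N n] by simp
    qed (rule le)
  qed
  have "I = Idl\<^bsub>P\<^esub> U"
    using subset_if_lead_ideals_subset[OF I J JI lead] JI by blast
  moreover have "finite U" using T(1) by (simp add: U_def)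
  ultimately show "\<exists>A\<subseteq>carrier P. finite A \<and> I = Idl\<^bsub>P\<^esub> A" using UP by blast
qed

end

lemma (in ring_hom_ring) noetherian_image:
  assumes "noetherian_ring R" and surj: "h ` carrier R = carrier S"
  shows "noetherian_ring S"
proof (rule S.noetherian_ringI)
  interpret noetherian_ring R by fact
  fix I assume I: "ideal I S"
  have pre: "ideal {r \<in> carrier R. h r \<in> I} R" using I by (rule ideal_vimage)
  then obtain A where A: "A \<subseteq> carrier R" "finite A" "{r \<in> carrier R. h r \<in> I} = Idl A"
    using finetely_gen by blast
  have hA: "h ` A \<subseteq> carrier S" using A(1) by auto
  have "I \<subseteq> Idl\<^bsub>S\<^esub> (h ` A)"
  proof
    fix s assume s: "s \<in> I"
    then obtain r where r: "r \<in> carrier R" "h r = s"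
      using surj ideal.Icarr[OF I s] by (metis imageE)
    have "ideal {r \<in> carrier R. h r \<in> Idl\<^bsub>S\<^esub> (h ` A)} R"
      using S.genideal_ideal[OF hA] by (rule ideal_vimage)
    moreover have "A \<subseteq> {r \<in> carrier R. h r \<in> Idl\<^bsub>S\<^esub> (h ` A)}"
      using A(1) S.genideal_self[OF hA] by blast
    ultimately have "Idl A \<subseteq> {r \<in> carrier R. h r \<in> Idl\<^bsub>S\<^esub> (h ` A)}"
      by (rule R.genideal_minimal)
    then show "s \<in> Idl\<^bsub>S\<^esub> (h ` A)" using r s A(3) by blast
  qed
  moreover have "Idl\<^bsub>S\<^esub> (h ` A) \<subseteq> I"
    using A R.genideal_self[OF A(1)] by (intro S.genideal_minimal[OF I]) blast
  ultimately show "\<exists>A\<subseteq>carrier S. finite A \<and> I = Idl\<^bsub>S\<^esub> A"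
    using hA A(2) by blast
qed

lemma (in field) noetherian_field: "noetherian_ring R"
proof (rule noetherian_ringI)
  fix I assume "ideal I R"
  then have "I = Idl {\<zero>} \<or> I = Idl {\<one>}"
    using all_ideals genideal_zero genideal_one by blast
  then show "\<exists>A\<subseteq>carrier R. finite A \<and> I = Idl A"
    by (metis empty_subsetI finite.intros insert_subset one_closed zero_closed)
qed

lemma (in field) jacobson_semisimple_field: "jacobson_semisimple R"
  using zeromaximalideal by (auto simp: jacobson_semisimple_def)

section \<open>Affine domains\<close>

text \<open>Evaluation at \<open>x\<close> maps the polynomials over \<open>A\<close> onto
  \<open>B\<close>, because its image is a subring containing \<open>A\<close> and \<open>x\<close>.
  So \<open>B\<close> is a quotient of a polynomial ring, and the earlier results for such quotients
  apply.\<close>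

lemma (in domain) noetherian_jacobson_adjoin:
  fixes A x
  defines "B \<equiv> generate_ring R (insert x A)"
  assumes A: "subring A R" and x: "x \<in> carrier R"
    and noeth: "noetherian_ring (R\<lparr>carrier := A\<rparr>)"
    and jac: "jacobson_semisimple (R\<lparr>carrier := A\<rparr>)"
  shows "noetherian_ring (R\<lparr>carrier := B\<rparr>)" "jacobson_semisimple (R\<lparr>carrier := B\<rparr>)"
proof -
  let ?A = "R\<lparr>carrier := A\<rparr>" and ?B = "R\<lparr>carrier := B\<rparr>"
  have gen: "insert x A \<subseteq> carrier R" using subringE(1)[OF A] x by simp
  have B: "subring B R" unfolding B_def using gen by (rule generate_ring_is_subring)
  have sub: "insert x A \<subseteq> B" unfolding B_def by (auto intro: generate_ring.incl)
  interpret A: domain ?A using A by (rule subring_is_domain)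
  interpret B: domain ?B using B by (rule subring_is_domain)
  have pre: "UP_pre_univ_prop ?A ?B id"
    using sub by (intro UP_pre_univ_propI A.is_cring B.is_cring ring_hom_memI) auto
  have xB: "x \<in> carrier ?B" using sub by simp
  define e where "e = UnivPoly.eval ?A ?B id x"
  interpret e: ring_hom_cring "UP ?A" ?B e
    unfolding e_def
    by (rule UP_pre_univ_prop.ring_homD[OF pre UP_pre_univ_prop.eval_ring_hom[OF pre xB]])
  have e_const: "e (up_ring.monom (UP ?A) a 0) = a" if "a \<in> A" for a
    using UP_pre_univ_prop.eval_const[OF pre xB] that by (simp add: e_def)
  have e_X: "e (up_ring.monom (UP ?A) \<one> 1) = x"
    using UP_pre_univ_prop.eval_monom1[OF pre xB] by (simp add: e_def)
  have monom: "up_ring.monom (UP ?A) a n \<in> carrier (UP ?A)" if "a \<in> A" for a n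
    using UP_ring.monom_closed[of ?A a n] that A.ring_axioms by (simp add: UP_ring_def)
  define im where "im = e ` carrier (UP ?A)"
  have "subring im ?B"
    unfolding im_def by (rule e.ring.img_is_subring[OF e.R.carrier_is_subring])
  then have im: "im \<subseteq> B" "ring (R\<lparr>carrier := im\<rparr>)"
    using B.subring_is_ring[of im] subringE(1)[of im ?B] by auto
  have "subring im R"
    using im subringE(1)[OF B] by (intro ring_incl_imp_subring) auto
  moreover have "insert x A \<subseteq> im"
  proof -
    have "a \<in> im" if "a \<in> A" for a
      unfolding im_def using monom[OF that, of 0] e_const[OF that] by (metis imageI)
    moreover have "x \<in> im"
      unfolding im_def using monom[OF subringE(3)[OF A], of 1] e_X by (metis imageI)
    ultimately show ?thesis by blast
  qed
  ultimately have "B \<subseteq> im"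
    unfolding B_def using gen by (intro generate_ring_min_subring1)
  with im(1) have surj: "e ` carrier (UP ?A) = carrier ?B" by (auto simp: im_def)
  have "noetherian_ring (UP ?A)"
    by (rule UP_cring.noetherian_UP[OF _ noeth]) (simp add: UP_cring_def A.is_cring)
  then show "noetherian_ring ?B" by (rule e.ring.noetherian_image[OF _ surj])
  have "one_generator_extension ?A ?B id x"
    by (intro one_generator_extension.intro one_generator_extension_axioms.intro pre xB
        A.domain_axioms B.domain_axioms) (use surj in \<open>simp_all add: e_def\<close>)
  then show "jacobson_semisimple ?B"
    using jac by (rule one_generator_extension.jacobson_semione_generator_extension)
qed

text \<open>Induction on a finite generating set, starting from the image of \<open>K\<close>. That
  image is a field because the structure map is a homomorphism into a nonzero ring.\<close>

lemma affine_domain_noetherian_jacobson: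
  assumes K: "field K" and aff: "affine_algebra K R" and R: "domain R"
  shows "noetherian_ring R" "jacobson_semisimple R"
proof -
  interpret K: field K by fact
  interpret domain R by fact
  interpret algebra K R using aff by (simp add: affine_algebra_def)
  define h where "h k = k \<odot>\<^bsub>R\<^esub> \<one>\<^bsub>R\<^esub>" for k
  define H where "H = h ` carrier K"
  interpret h: ring_hom_ring K R h
  proof (rule ring_hom_ringI2)
    show "h \<in> ring_hom K R"
    proof (rule ring_hom_memI)
      fix a b assume ab: "a \<in> carrier K" "b \<in> carrier K"
      have "h a \<otimes>\<^bsub>R\<^esub> h b = a \<odot>\<^bsub>R\<^esub> (b \<odot>\<^bsub>R\<^esub> \<one>\<^bsub>R\<^esub>)"
        using ab by (simp add: h_def smult_assoc2)
      then show "h (a \<otimes>\<^bsub>K\<^esub> b) = h a \<otimes>\<^bsub>R\<^esub> h b"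
        using ab by (simp add: h_def smult_assoc1)
      show "h (a \<oplus>\<^bsub>K\<^esub> b) = h a \<oplus>\<^bsub>R\<^esub> h b" using ab by (simp add: h_def smult_l_distr)
    qed (simp_all add: h_def)
  qed (rule K.ring_axioms ring_axioms)+
  have "subfield H R"
    unfolding H_def using K.carrier_is_subfield by (rule h.img_is_subfield) simp
  then have H: "subring H R" and fld: "field (R\<lparr>carrier := H\<rparr>)"
    using subfieldE(1) subfield_iff(2) by blast+
  have HR: "H \<subseteq> carrier R" using subringE(1)[OF H] .
  obtain F where F: "finite F" "F \<subseteq> carrier R" "generate_ring R (H \<union> F) = carrier R"
    using aff unfolding affine_algebra_def H_def h_def by blast
  have "noetherian_ring (R\<lparr>carrier := generate_ring R (H \<union> F)\<rparr>) \<and>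
    jacobson_semisimple (R\<lparr>carrier := generate_ring R (H \<union> F)\<rparr>)"
    using F(1,2)
  proof (induction F)
    case empty
    have "generate_ring R (H \<union> {}) = H"
      using generate_ringI[of H H] HR H by auto
    then show ?case
      using field.noetherian_field[OF fld] field.jacobson_semisimple_field[OF fld] by simp
  next
    case (insert x F)
    let ?A = "generate_ring R (H \<union> F)"
    have HF: "H \<union> F \<subseteq> carrier R" "H \<union> insert x F \<subseteq> carrier R" using HR insert by auto
    have A: "subring ?A R" using HF(1) by (rule generate_ring_is_subring)
    have xA: "insert x ?A \<subseteq> carrier R" using subringE(1)[OF A] insert by auto
    have "generate_ring R (H \<union> insert x F) = generate_ring R (insert x ?A)"
    proof (rule equalityI; rule generate_ring_min_subring1)
      show "H \<union> insert x F \<subseteq> generate_ring R (insert x ?A)"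
        by (auto intro!: generate_ring.incl)
      show "insert x ?A \<subseteq> generate_ring R (H \<union> insert x F)"
        using mono_generate_ring[of "H \<union> F" "H \<union> insert x F"] HF(2)
        by (auto intro: generate_ring.incl)
    qed (use HF xA in \<open>auto intro: generate_ring_is_subring\<close>)
    then show ?case
      using noetherian_jacobson_adjoin[OF A] insert by simp
  qed
  then show "noetherian_ring R" "jacobson_semisimple R" using F(3) by simp_all
qed

text \<open>The inverse comes from \<open>K\<close> through the structure map. Being units, and not
  merely nonzero, positive integers lie outside every prime ideal of \<open>R\<close>.\<close>

lemma affine_nat_unit:
  assumes K: "field K" "char_zero K" and alg: "algebra K R" and n: "n > 0"
  shows "add_pow R (n::nat) \<one>\<^bsub>R\<^esub> \<in> Units R"
proof -
  interpret K: field K by fact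
  interpret algebra K R by fact
  define a where "a = add_pow K n \<one>\<^bsub>K\<^esub>"
  have a: "a \<in> carrier K" "a \<noteq> \<zero>\<^bsub>K\<^esub>" using K(2) n by (auto simp: a_def char_zero_def)
  then have b: "inv\<^bsub>K\<^esub> a \<in> carrier K" "a \<otimes>\<^bsub>K\<^esub> inv\<^bsub>K\<^esub> a = \<one>\<^bsub>K\<^esub>" "inv\<^bsub>K\<^esub> a \<otimes>\<^bsub>K\<^esub> a = \<one>\<^bsub>K\<^esub>"
    using K.field_Units by (auto intro: K.Units_inv_closed)
  have eq: "add_pow R m \<one>\<^bsub>R\<^esub> = add_pow K m \<one>\<^bsub>K\<^esub> \<odot>\<^bsub>R\<^esub> \<one>\<^bsub>R\<^esub>" for m :: nat
    by (induction m) (simp_all add: smult_l_distr)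
  have "(a \<odot>\<^bsub>R\<^esub> \<one>\<^bsub>R\<^esub>) \<otimes>\<^bsub>R\<^esub> (inv\<^bsub>K\<^esub> a \<odot>\<^bsub>R\<^esub> \<one>\<^bsub>R\<^esub>) = \<one>\<^bsub>R\<^esub>"
    "(inv\<^bsub>K\<^esub> a \<odot>\<^bsub>R\<^esub> \<one>\<^bsub>R\<^esub>) \<otimes>\<^bsub>R\<^esub> (a \<odot>\<^bsub>R\<^esub> \<one>\<^bsub>R\<^esub>) = \<one>\<^bsub>R\<^esub>"
    using a b by (simp_all add: smult_assoc2 flip: smult_assoc1)
  then show ?thesis
    using a b unfolding eq a_def[symmetric] Units_def by auto
qed

section \<open>The largest differential ideal inside an ideal\<close>

lemma (in ideal) add_minus_add_closed:
  assumes "x \<ominus> u \<in> I" "y \<ominus> v \<in> I"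
    and "x \<in> carrier R" "y \<in> carrier R" "u \<in> carrier R" "v \<in> carrier R"
  shows "(x \<oplus> y) \<ominus> (u \<oplus> v) \<in> I"
proof -
  have "(x \<oplus> y) \<ominus> (u \<oplus> v) = (x \<ominus> u) \<oplus> (y \<ominus> v)"
    using assms(3-6) by (simp add: a_minus_def minus_add a_ac)
  then show ?thesis using assms(1,2) by simp
qed

lemma (in ideal) mem_if_minus_mem:
  assumes "x \<ominus> y \<in> I" "y \<in> I" "x \<in> carrier R"
  shows "x \<in> I"
proof -
  have "(x \<ominus> y) \<oplus> y \<in> I" using assms by simp
  then show ?thesis using assms(3) Icarr[OF assms(2)] by (simp add: a_minus_def a_assoc l_neg)
qed

context derivation
begin

lemma delta_pow_closed [simp]: "a \<in> carrier R \<Longrightarrow> (\<delta> ^^ n) a \<in> carrier R"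
  by (induction n) (auto simp: derivation_closed)

lemma delta_pow_add:
  "\<lbrakk>a \<in> carrier R; b \<in> carrier R\<rbrakk> \<Longrightarrow> (\<delta> ^^ n) (a \<oplus> b) = (\<delta> ^^ n) a \<oplus> (\<delta> ^^ n) b"
  by (induction n) (auto simp: derivation_add)

lemma delta_minus: "a \<in> carrier R \<Longrightarrow> \<delta> (\<ominus> a) = \<ominus> \<delta> a"
  using derivation_add[of "\<ominus> a" a] derivation_closed[of a] derivation_closed[of "\<ominus> a"]
  by (simp add: l_neg delta_zero minus_equality)

lemma delta_pow_minus: "a \<in> carrier R \<Longrightarrow> (\<delta> ^^ n) (\<ominus> a) = \<ominus> (\<delta> ^^ n) a"
  by (induction n) (auto simp: delta_minus)

lemma delta_pow_zero: "(\<delta> ^^ n) \<zero> = \<zero>"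
  by (induction n) (auto simp: delta_zero)

text \<open>Peeling off the innermost \<open>\<delta>\<close> replaces the pair \<open>a, b\<close>
  by \<open>\<delta> a, b\<close> and \<open>a, \<delta> b\<close>, so later inductions never need
  the binomial Leibniz formula.\<close>

lemma delta_pow_Suc_mult:
  assumes "a \<in> carrier R" "b \<in> carrier R"
  shows "(\<delta> ^^ Suc n) (a \<otimes> b) = (\<delta> ^^ n) (\<delta> a \<otimes> b) \<oplus> (\<delta> ^^ n) (a \<otimes> \<delta> b)"
  using assms
  by (simp only: funpow_Suc_right o_apply derivation_mult delta_pow_add m_closed derivation_closed)

text \<open>For an ideal \<open>M\<close> this is the largest \<open>\<delta>\<close>-ideal inside
  it. The description by iterated derivatives gives every other element of \<open>R\<close> a least
  order at which its derivatives leave \<open>M\<close>.\<close>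

definition delta_core :: "'a set \<Rightarrow> 'a set" where
  "delta_core M = {a \<in> carrier R. \<forall>n. (\<delta> ^^ n) a \<in> M}"

lemma delta_core_delta:
  assumes "a \<in> delta_core M" shows "\<delta> a \<in> delta_core M"
proof -
  have "(\<delta> ^^ n) (\<delta> a) = (\<delta> ^^ Suc n) a" for n by (simp add: funpow_swap1)
  then show ?thesis
    using assms unfolding delta_core_def by (auto simp: derivation_closed simp del: funpow.simps)
qed

lemma delta_core_subset: "delta_core M \<subseteq> M"
  unfolding delta_core_def by (metis (mono_tags, lifting) funpow_0 mem_Collect_eq subsetI)

text \<open>Only absorption needs an argument: the derivative of \<open>x a\<close> is a sum of
  multiples of \<open>a\<close> and of \<open>\<delta> a\<close>, both in the core, so the induction
  generalises over both factors.\<close>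

lemma delta_ideal_delta_core:
  assumes M: "ideal M R"
  shows "delta_ideal R \<delta> (delta_core M)"
proof -
  interpret M: ideal M R by fact
  have mult: "(\<delta> ^^ n) (x \<otimes> a) \<in> M" if "a \<in> delta_core M" "x \<in> carrier R" for n x a
    using that
  proof (induction n arbitrary: x a)
    case 0
    then show ?case using delta_core_subset M.I_l_closed by auto
  next
    case (Suc n)
    have a: "a \<in> carrier R" using Suc(2) by (simp add: delta_core_def)
    show ?case
      unfolding delta_pow_Suc_mult[OF Suc(3) a]
      using Suc.IH[OF Suc(2) derivation_closed[OF Suc(3)]] Suc.IH[OF delta_core_delta[OF Suc(2)] Suc(3)]
      by (rule M.a_closed)
  qed
  have "ideal (delta_core M) R"
  proof (rule idealI[OF ring_axioms])
    show "subgroup (delta_core M) (add_monoid R)"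
    proof (rule add.subgroupI)
      have "\<zero> \<in> delta_core M" by (simp add: delta_core_def delta_pow_zero)
      then show "delta_core M \<noteq> {}" by blast
    qed (auto simp: delta_core_def delta_pow_add delta_pow_minus)
    fix a x assume ax: "a \<in> delta_core M" "x \<in> carrier R"
    then have "a \<in> carrier R" by (simp add: delta_core_def)
    then show "x \<otimes> a \<in> delta_core M" using mult[OF ax] ax by (simp add: delta_core_def)
    then show "a \<otimes> x \<in> delta_core M" using m_comm[OF \<open>a \<in> carrier R\<close> ax(2)] by simp
  qed
  then show ?thesis using delta_core_delta by (auto simp: delta_ideal_def)
qed

lemma delta_ideal_subset_delta_core:
  assumes "delta_ideal R \<delta> I" "I \<subseteq> M"
  shows "I \<subseteq> delta_core M"
proof
  fix a assume a: "a \<in> I"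
  have "(\<delta> ^^ n) a \<in> I" for n
    using assms(1) a by (induction n) (auto simp: delta_ideal_def)
  moreover have "a \<in> carrier R"
    using assms(1) a ideal.Icarr by (auto simp: delta_ideal_def)
  ultimately show "a \<in> delta_core M" using assms(2) by (auto simp: delta_core_def)
qed

text \<open>By the Leibniz rule the derivative of order \<open>n\<close> of \<open>a b\<close>
  combines products of a \<open>k\<close>-th derivative of \<open>a\<close> and an
  \<open>(n - k)\<close>-th one of \<open>b\<close>. For \<open>n = i + j\<close> all of them lie in
  \<open>M\<close> except possibly the one with \<open>k = i\<close>. Its coefficient is binomial,
  but only positivity matters, which the induction carries along as an existential
  \<open>N\<close>.\<close>

lemma delta_pow_mult_leading_term:
  assumes M: "ideal M R" and ab: "a \<in> carrier R" "b \<in> carrier R"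
    and i: "\<And>k. k < i \<Longrightarrow> (\<delta> ^^ k) a \<in> M" and j: "\<And>k. k < j \<Longrightarrow> (\<delta> ^^ k) b \<in> M"
  shows "(n < i + j \<longrightarrow> (\<delta> ^^ n) (a \<otimes> b) \<in> M) \<and>
    (n = i + j \<longrightarrow> (\<exists>N>0. (\<delta> ^^ n) (a \<otimes> b) \<ominus> add_pow R (N::nat) ((\<delta> ^^ i) a \<otimes> (\<delta> ^^ j) b) \<in> M))"
  using ab i j
proof (induction n arbitrary: a b i j)
  case 0
  interpret M: ideal M R by fact
  show ?case
  proof (intro conjI impI)
    assume "0 < i + j"
    then have "a \<in> M \<or> b \<in> M" using 0(3)[of 0] 0(4)[of 0] by auto
    then show "(\<delta> ^^ 0) (a \<otimes> b) \<in> M" using 0(1,2) M.I_l_closed M.I_r_closed by auto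
  next
    assume "0 = i + j"
    then have "(\<delta> ^^ 0) (a \<otimes> b) \<ominus> add_pow R (1::nat) ((\<delta> ^^ i) a \<otimes> (\<delta> ^^ j) b) = \<zero>"
      using 0(1,2) by (simp add: a_minus_def r_neg)
    then show "\<exists>N>0. (\<delta> ^^ 0) (a \<otimes> b) \<ominus> add_pow R (N::nat) ((\<delta> ^^ i) a \<otimes> (\<delta> ^^ j) b) \<in> M"
      using M.zero_closed by (metis zero_less_one)
  qed
next
  case (Suc n)
  interpret M: ideal M R by fact
  have da: "\<delta> a \<in> carrier R" and db: "\<delta> b \<in> carrier R" using Suc.prems by (auto simp: derivation_closed)
  have oa: "(\<delta> ^^ k) (\<delta> a) \<in> M" if "k < i - 1" for k
    using Suc.prems(3)[of "Suc k"] that by (simp add: funpow_swap1)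
  have ob: "(\<delta> ^^ k) (\<delta> b) \<in> M" if "k < j - 1" for k
    using Suc.prems(4)[of "Suc k"] that by (simp add: funpow_swap1)
  have IHa: "n < i - 1 + j \<Longrightarrow> (\<delta> ^^ n) (\<delta> a \<otimes> b) \<in> M"
    "n = i - 1 + j \<Longrightarrow> \<exists>N>0. (\<delta> ^^ n) (\<delta> a \<otimes> b)
      \<ominus> add_pow R (N::nat) ((\<delta> ^^ (i - 1)) (\<delta> a) \<otimes> (\<delta> ^^ j) b) \<in> M"
    using Suc.IH[of "\<delta> a" b "i - 1" j] da Suc.prems oa by blast+
  have IHb: "n < i + (j - 1) \<Longrightarrow> (\<delta> ^^ n) (a \<otimes> \<delta> b) \<in> M"
    "n = i + (j - 1) \<Longrightarrow> \<exists>N>0. (\<delta> ^^ n) (a \<otimes> \<delta> b)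
      \<ominus> add_pow R (N::nat) ((\<delta> ^^ i) a \<otimes> (\<delta> ^^ (j - 1)) (\<delta> b)) \<in> M"
    using Suc.IH[of a "\<delta> b" i "j - 1"] db Suc.prems ob by blast+
  let ?t = "(\<delta> ^^ i) a \<otimes> (\<delta> ^^ j) b"
  have t: "?t \<in> carrier R" using Suc.prems by simp
  show ?case
  proof (intro conjI impI)
    assume "Suc n < i + j"
    then have "n < i - 1 + j" "n < i + (j - 1)" by auto
    then show "(\<delta> ^^ Suc n) (a \<otimes> b) \<in> M"
      unfolding delta_pow_Suc_mult[OF Suc.prems(1,2)] using IHa(1) IHb(1) by (intro M.a_closed)
  next
    assume n: "Suc n = i + j"
    \<comment> \<open>If \<open>i = 0\<close>, this half lies in \<open>M\<close> because
      \<open>n < j\<close>, and it contributes \<open>N1 = 0\<close>. Since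
      \<open>i + j = Suc n\<close>, at least one of \<open>N1\<close> and \<open>N2\<close> is
      positive.\<close>
    have "\<exists>N1. (i > 0 \<longrightarrow> N1 > 0) \<and> (\<delta> ^^ n) (\<delta> a \<otimes> b) \<ominus> add_pow R (N1::nat) ?t \<in> M"
    proof (cases i)
      case 0
      then have "(\<delta> ^^ n) (\<delta> a \<otimes> b) \<in> M" using IHa(1) n by simp
      then show ?thesis using 0 M.Icarr by (intro exI[of _ 0]) (simp add: a_minus_def)
    next
      case (Suc i')
      then have "n = i - 1 + j" "(\<delta> ^^ (i - 1)) (\<delta> a) = (\<delta> ^^ i) a"
        using n by (auto simp: funpow_swap1)
      then show ?thesis using IHa(2) by metis
    qed
    then obtain N1 :: nat where N1: "i > 0 \<Longrightarrow> N1 > 0" "(\<delta> ^^ n) (\<delta> a \<otimes> b) \<ominus> add_pow R N1 ?t \<in> M"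
      by blast
    have "\<exists>N2. (j > 0 \<longrightarrow> N2 > 0) \<and> (\<delta> ^^ n) (a \<otimes> \<delta> b) \<ominus> add_pow R (N2::nat) ?t \<in> M"
    proof (cases j)
      case 0
      then have "(\<delta> ^^ n) (a \<otimes> \<delta> b) \<in> M" using IHb(1) n by simp
      then show ?thesis using 0 M.Icarr by (intro exI[of _ 0]) (simp add: a_minus_def)
    next
      case (Suc j')
      then have "n = i + (j - 1)" "(\<delta> ^^ (j - 1)) (\<delta> b) = (\<delta> ^^ j) b"
        using n by (auto simp: funpow_swap1)
      then show ?thesis using IHb(2) by metis
    qed
    then obtain N2 :: nat where N2: "j > 0 \<Longrightarrow> N2 > 0" "(\<delta> ^^ n) (a \<otimes> \<delta> b) \<ominus> add_pow R N2 ?t \<in> M"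
      by blast
    have "(\<delta> ^^ Suc n) (a \<otimes> b) \<ominus> add_pow R (N1 + N2) ?t \<in> M"
      unfolding delta_pow_Suc_mult[OF Suc.prems(1,2)] add.nat_pow_mult[OF t, symmetric]
      using N1(2) N2(2) Suc.prems da db t by (intro M.add_minus_add_closed) auto
    moreover have "N1 + N2 > 0" using N1(1) N2(1) n by (cases "i = 0") auto
    ultimately show "\<exists>N>0. (\<delta> ^^ Suc n) (a \<otimes> b) \<ominus> add_pow R (N::nat) ?t \<in> M"
      by (intro exI[of _ "N1 + N2"] conjI)
  qed
qed

text \<open>Let \<open>i\<close> and \<open>j\<close> be the least orders at which the derivatives
  of \<open>a\<close> and \<open>b\<close> leave \<open>M\<close>. Modulo \<open>M\<close>, the
  derivative of order \<open>i + j\<close> of \<open>a b\<close> is a positive multiple of a product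
  of two elements outside \<open>M\<close>; the integer is a unit, so that product would lie in the
  prime ideal \<open>M\<close>.\<close>

lemma primeideal_delta_core:
  assumes nat_unit: "\<And>n::nat. n > 0 \<Longrightarrow> add_pow R n \<one> \<in> Units R" and M: "primeideal M R"
  shows "primeideal (delta_core M) R"
proof (rule primeidealI)
  interpret M: primeideal M R by fact
  show "ideal (delta_core M) R"
    using delta_ideal_delta_core[OF M.is_ideal] by (simp add: delta_ideal_def)
  show "cring R" by (rule is_cring)
  show "carrier R \<noteq> delta_core M"
    using delta_core_subset[of M] M.I_notcarr M.a_subset by blast
  fix a b assume ab: "a \<in> carrier R" "b \<in> carrier R" "a \<otimes> b \<in> delta_core M"
  show "a \<in> delta_core M \<or> b \<in> delta_core M"
  proof (rule ccontr)
    assume "\<not> (a \<in> delta_core M \<or> b \<in> delta_core M)"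
    then have ex: "\<exists>k. (\<delta> ^^ k) a \<notin> M" "\<exists>k. (\<delta> ^^ k) b \<notin> M" using ab by (auto simp: delta_core_def)
    define i where "i = (LEAST k. (\<delta> ^^ k) a \<notin> M)"
    define j where "j = (LEAST k. (\<delta> ^^ k) b \<notin> M)"
    have i: "(\<delta> ^^ i) a \<notin> M" "\<And>k. k < i \<Longrightarrow> (\<delta> ^^ k) a \<in> M"
      and j: "(\<delta> ^^ j) b \<notin> M" "\<And>k. k < j \<Longrightarrow> (\<delta> ^^ k) b \<in> M"
      using LeastI_ex[OF ex(1)] LeastI_ex[OF ex(2)] not_less_Least unfolding i_def j_def by blast+
    let ?t = "(\<delta> ^^ i) a \<otimes> (\<delta> ^^ j) b"
    have t: "?t \<in> carrier R" using ab by simp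
    obtain N :: nat where N: "N > 0" "(\<delta> ^^ (i + j)) (a \<otimes> b) \<ominus> add_pow R N ?t \<in> M"
      using delta_pow_mult_leading_term[OF M.is_ideal ab(1,2) i(2) j(2)] by blast
    have "(\<delta> ^^ (i + j)) (a \<otimes> b) \<in> M" using ab(3) unfolding delta_core_def by blast
    then have "(\<delta> ^^ (i + j)) (a \<otimes> b) \<ominus> ((\<delta> ^^ (i + j)) (a \<otimes> b) \<ominus> add_pow R N ?t) \<in> M"
      using N(2) by (rule M.I_minus_closed)
    then have "add_pow R N ?t \<in> M"
      using ab t by (simp add: a_minus_def minus_add a_assoc[symmetric] r_neg)
    then have "add_pow R N \<one> \<otimes> ?t \<in> M" using t by (simp add: add_pow_ldistr)
    moreover have "inv (add_pow R N \<one>) \<in> carrier R" using nat_unit[OF N(1)] by simp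
    ultimately have "inv (add_pow R N \<one>) \<otimes> (add_pow R N \<one> \<otimes> ?t) \<in> M"
      by (rule M.I_l_closed)
    then have "?t \<in> M" using nat_unit[OF N(1)] t by (simp add: m_assoc[symmetric])
    then show False using M.I_prime[of "(\<delta> ^^ i) a" "(\<delta> ^^ j) b"] i(1) j(1) ab by auto
  qed
qed

lemma delta_prime_ideal_if_prime:
  assumes Q: "primeideal Q R" "delta_ideal R \<delta> Q"
  shows "delta_prime_ideal R \<delta> Q"
  unfolding delta_prime_ideal_def
proof (intro conjI allI impI Q(2))
  interpret Q: primeideal Q R by fact
  show "Q \<noteq> carrier R" using Q.I_notcarr by blast
  fix I J assume "delta_ideal R \<delta> I \<and> delta_ideal R \<delta> J \<and> I \<cdot> J \<subseteq> Q"
  then have IJ: "ideal I R" "ideal J R" "I \<cdot> J \<subseteq> Q" by (auto simp: delta_ideal_def)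
  have "b \<in> Q" if "a \<in> I" "a \<notin> Q" "b \<in> J" for a b
  proof -
    have "a \<otimes> b \<in> Q" using ideal_prod.prod[OF that(1,3)] IJ(3) by blast
    then show ?thesis
      using Q.I_prime[of a b] that ideal.Icarr[OF IJ(1) that(1)] ideal.Icarr[OF IJ(2) that(3)] by blast
  qed
  then show "I \<subseteq> Q \<or> J \<subseteq> Q" by blast
qed

lemma delta_primitive_if_delta_core_zero:
  assumes "maximalideal M R" "delta_core M = {\<zero>}"
  shows "delta_primitive R \<delta>"
  unfolding delta_primitive_def
proof (intro exI[of _ M] conjI allI impI assms(1))
  fix I assume "delta_ideal R \<delta> I \<and> I \<subseteq> M"
  then have "I \<subseteq> {\<zero>}" "ideal I R"
    using delta_ideal_subset_delta_core[of I M] assms(2) by (auto simp: delta_ideal_def)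
  then show "I = {\<zero>}" using additive_subgroup.zero_closed[OF ideal.axioms(1)] by blast
qed

theorem delta_primitive_if_delta_G_ring:
  assumes nat_unit: "\<And>n::nat. n > 0 \<Longrightarrow> add_pow R n \<one> \<in> Units R"
    and jac: "jacobson_semisimple R" and G: "delta_G_ring R \<delta>"
  shows "delta_primitive R \<delta>"
proof -
  let ?I = "carrier R \<inter> \<Inter> {P. delta_prime_ideal R \<delta> P \<and> P \<noteq> {\<zero>}}"
  \<comment> \<open>The hypothesis only says that the intersection differs from
    \<open>{\<zero>}\<close>; a nonzero element follows once \<open>\<zero>\<close> is known to be a
    member.\<close>
  have "\<zero> \<in> ?I"
    using additive_subgroup.zero_closed[OF ideal.axioms(1)]
    by (auto simp: delta_prime_ideal_def delta_ideal_def)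
  moreover have "?I \<noteq> {\<zero>}" using G by (simp add: delta_G_ring_def)
  ultimately obtain f where f: "f \<in> ?I" "f \<noteq> \<zero>" by blast
  then obtain M where M: "maximalideal M R" "f \<notin> M"
    using jac unfolding jacobson_semisimple_def by blast
  have Mp: "primeideal M R" using M(1) by (rule maximalideal_prime)
  have "delta_prime_ideal R \<delta> (delta_core M)"
    using primeideal_delta_core[OF nat_unit Mp] delta_ideal_delta_core[OF primeideal.axioms(1)[OF Mp]]
    by (intro delta_prime_ideal_if_prime)
  \<comment> \<open>A nonzero core would be a nonzero \<open>\<delta>\<close>-prime ideal and so
    contain \<open>f\<close>, but it lies inside \<open>M\<close>.\<close>
  then have "delta_core M = {\<zero>}" using f(1) M(2) delta_core_subset[of M] by blast
  then show ?thesis using M(1) by (rule delta_primitive_if_delta_core_zero[rotated])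
qed

end

section \<open>Primitivity of the differential operator ring\<close>

definition left_ideal :: "('a, 'm) ring_scheme \<Rightarrow> 'a set \<Rightarrow> bool" where
  "left_ideal S L \<longleftrightarrow> subgroup L (add_monoid S) \<and>
     (\<forall>s\<in>carrier S. \<forall>x\<in>L. s \<otimes>\<^bsub>S\<^esub> x \<in> L)"

definition maximal_left_ideal :: "('a, 'm) ring_scheme \<Rightarrow> 'a set \<Rightarrow> bool" where
  "maximal_left_ideal S L \<longleftrightarrow> left_ideal S L \<and> \<one>\<^bsub>S\<^esub> \<notin> L \<and>
     (\<forall>J. left_ideal S J \<and> L \<subseteq> J \<and> \<one>\<^bsub>S\<^esub> \<notin> J \<longrightarrow> J = L)"

context ring
begin

lemma left_ideal_Union_chain:
  assumes C: "C \<noteq> {}" "subset.chain {L. left_ideal R L} C"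
  shows "left_ideal R (\<Union>C)"
proof -
  have lC: "left_ideal R J" "subgroup J (add_monoid R)" if "J \<in> C" for J
    using C that by (auto simp: subset_chain_def left_ideal_def)
  have "subgroup (\<Union>C) (add_monoid R)"
  proof (rule add.subgroupI)
    show "\<Union>C \<subseteq> carrier R" using lC(2) subgroup.subset by force
    obtain J where "J \<in> C" using C(1) by blast
    then show "\<Union>C \<noteq> {}" using subgroup.one_closed[OF lC(2)] by blast
    show "\<ominus> a \<in> \<Union>C" if "a \<in> \<Union>C" for a
      using that subgroup.m_inv_closed[OF lC(2)] by (auto simp: a_inv_def)
    show "a \<oplus> b \<in> \<Union>C" if ab: "a \<in> \<Union>C" "b \<in> \<Union>C" for a b
    proof -
      obtain J where J: "J \<in> C" "a \<in> J" "b \<in> J"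
        using ab C(2) unfolding subset_chain_def by blast
      then show ?thesis using subgroup.m_closed[OF lC(2)[OF J(1)] J(2,3)] by auto
    qed
  qed
  then show ?thesis using lC(1) unfolding left_ideal_def by blast
qed

lemma exists_maximal_left_ideal:
  assumes I: "left_ideal R I" "\<one> \<notin> I"
  obtains L where "maximal_left_ideal R L" "I \<subseteq> L"
proof -
  define F where "F = {J. left_ideal R J \<and> I \<subseteq> J \<and> \<one> \<notin> J}"
  have "\<exists>M\<in>F. \<forall>J\<in>F. M \<subseteq> J \<longrightarrow> J = M"
  proof (rule subset_Zorn_nonempty)
    show "F \<noteq> {}" using I by (auto simp: F_def)
    fix C assume C: "C \<noteq> {}" "subset.chain F C"
    then have "subset.chain {J. left_ideal R J} C"
      by (auto simp: subset_chain_def F_def)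
    then have "left_ideal R (\<Union>C)" using left_ideal_Union_chain C(1) by blast
    moreover have "I \<subseteq> J" "\<one> \<notin> J" if "J \<in> C" for J
      using C that by (auto simp: subset_chain_def F_def)
    ultimately show "\<Union>C \<in> F" using C(1) by (auto simp: F_def)
  qed
  then obtain M where "M \<in> F" and max_F: "\<forall>J\<in>F. M \<subseteq> J \<longrightarrow> J = M" by blast
  then have M: "left_ideal R M" "I \<subseteq> M" "\<one> \<notin> M" by (simp_all add: F_def)
  then have "maximal_left_ideal R M"
    using max_F unfolding maximal_left_ideal_def F_def by (simp add: subset_trans)
  then show thesis using M(2) by (rule that)
qed

lemma left_ideal_minus_closed:
  assumes "left_ideal R L" "a \<in> L" "b \<in> L"
  shows "a \<ominus> b \<in> L"
  using assms subgroup.m_closed[of L "add_monoid R" a "\<ominus> b"] subgroup.m_inv_closed[of L "add_monoid R" b]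
  by (simp add: left_ideal_def a_minus_def a_inv_def)

text \<open>The module is the quotient by \<open>L\<close>, whose annihilator consists of the
  \<open>s\<close> with all \<open>s \<otimes> t\<close> in \<open>L\<close>. Cosets are replaced by
  chosen representatives, so the operations are those of \<open>R\<close> followed by
  \<open>rep\<close>.\<close>

theorem primitive_ring_if_maximal_left_ideal:
  assumes max: "maximal_left_ideal R L"
    and faithful: "\<And>s. \<lbrakk>s \<in> carrier R; \<And>t. t \<in> carrier R \<Longrightarrow> s \<otimes> t \<in> L\<rbrakk> \<Longrightarrow> s = \<zero>"
  shows "primitive_ring R"
proof -
  have L: "left_ideal R L" and one: "\<one> \<notin> L" using max by (simp_all add: maximal_left_ideal_def)
  then have sub: "subgroup L (add_monoid R)" and l_closed: "\<And>s x. \<lbrakk>s \<in> carrier R; x \<in> L\<rbrakk> \<Longrightarrow> s \<otimes> x \<in> L"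
    by (simp_all add: left_ideal_def)
  have LR: "x \<in> carrier R" if "x \<in> L" for x using subgroup.subset[OF sub] that by auto
  have zero: "\<zero> \<in> L" using subgroup.one_closed[OF sub] by simp
  have add: "x \<oplus> y \<in> L" if "x \<in> L" "y \<in> L" for x y using subgroup.m_closed[OF sub that] by simp
  note minus = left_ideal_minus_closed[OF L]
  \<comment> \<open>Congruent elements admit the same candidates \<open>q\<close>, so the choice
    depends only on the coset.\<close>
  define rep where "rep p = (SOME q. q \<in> carrier R \<and> p \<ominus> q \<in> L)" for p
  have rep: "rep p \<in> carrier R" "p \<ominus> rep p \<in> L" if "p \<in> carrier R" for p
  proof -
    have "p \<in> carrier R \<and> p \<ominus> p \<in> L" using that zero by (simp add: a_minus_def r_neg)
    then have "rep p \<in> carrier R \<and> p \<ominus> rep p \<in> L" unfolding rep_def by (rule someI)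
    then show "rep p \<in> carrier R" "p \<ominus> rep p \<in> L" by auto
  qed
  have telescope: "p \<ominus> q = (p \<ominus> r) \<ominus> (q \<ominus> r)" if "p \<in> carrier R" "q \<in> carrier R" "r \<in> carrier R" for p q r
    using that by (simp add: a_minus_def minus_add a_assoc a_comm[of "\<ominus> q" r] r_neg1)
  have telescope2: "p \<ominus> r = (p \<ominus> q) \<oplus> (q \<ominus> r)" if "p \<in> carrier R" "q \<in> carrier R" "r \<in> carrier R" for p q r
    using that by (simp add: a_minus_def a_assoc r_neg1)
  have rep_eq: "rep p = rep q \<longleftrightarrow> p \<ominus> q \<in> L" if pq: "p \<in> carrier R" "q \<in> carrier R" for p q
  proof
    assume "rep p = rep q"
    then show "p \<ominus> q \<in> L" using telescope[OF pq rep(1)[OF pq(1)]] minus rep(2)[OF pq(1)] rep(2)[OF pq(2)] by simp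
  next
    assume pqL: "p \<ominus> q \<in> L"
    then have qpL: "q \<ominus> p \<in> L" using minus[OF zero pqL] pq by (simp add: a_minus_def minus_add a_comm)
    have "(r \<in> carrier R \<and> p \<ominus> r \<in> L) = (r \<in> carrier R \<and> q \<ominus> r \<in> L)" for r
      using telescope2[OF pq, of r] telescope2[OF pq(2,1), of r] add pqL qpL by metis
    then show "rep p = rep q" by (simp add: rep_def)
  qed
  have rep_rep: "rep (rep p) = rep p" if "p \<in> carrier R" for p
    using rep_eq[OF that rep(1)[OF that]] rep(2)[OF that] by simp
  have rep_add: "rep (x \<oplus> rep y) = rep (x \<oplus> y)" "rep (rep y \<oplus> x) = rep (y \<oplus> x)"
    if xy: "x \<in> carrier R" "y \<in> carrier R" for x y
  proof -
    have "(x \<oplus> y) \<ominus> (x \<oplus> rep y) = y \<ominus> rep y"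
      using xy rep(1)[OF xy(2)] by (simp add: a_minus_def minus_add a_assoc a_lcomm[of y] r_neg2)
    then have "rep (x \<oplus> y) = rep (x \<oplus> rep y)"
      using rep_eq[of "x \<oplus> y" "x \<oplus> rep y"] rep[OF xy(2)] xy by simp
    then show "rep (x \<oplus> rep y) = rep (x \<oplus> y)" by simp
    then show "rep (rep y \<oplus> x) = rep (y \<oplus> x)"
      using xy rep(1)[OF xy(2)] by (simp add: a_comm)
  qed
  have rep_mult: "rep (s \<otimes> rep x) = rep (s \<otimes> x)" if sx: "s \<in> carrier R" "x \<in> carrier R" for s x
  proof -
    have "s \<otimes> x \<ominus> s \<otimes> rep x = s \<otimes> (x \<ominus> rep x)"
      using sx rep(1)[OF sx(2)] by (simp add: a_minus_def r_distr r_minus)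
    then show ?thesis
      using rep_eq[of "s \<otimes> x" "s \<otimes> rep x"] rep[OF sx(2)] l_closed[OF sx(1)] sx by simp
  qed
  define M :: "('a, 'a) module" where
    "M = \<lparr>carrier = rep ` carrier R, monoid.mult = (\<lambda>x y. x), monoid.one = rep \<zero>,
       ring.zero = rep \<zero>, ring.add = (\<lambda>x y. rep (x \<oplus> y)), smult = (\<lambda>s x. rep (s \<otimes> x))\<rparr>"
  have sel: "carrier M = rep ` carrier R" "\<zero>\<^bsub>M\<^esub> = rep \<zero>" "x \<oplus>\<^bsub>M\<^esub> y = rep (x \<oplus> y)"
    "s \<odot>\<^bsub>M\<^esub> x = rep (s \<otimes> x)" for x y s
    by (simp_all add: M_def)
  have M: "left_module R M"
  proof (intro left_module.intro left_module_axioms.intro ring_axioms)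
    show "abelian_group M"
    proof (rule abelian_groupI)
      fix x assume "x \<in> carrier M"
      then obtain y where "y \<in> carrier R" "x = rep y" by (auto simp: sel)
      then show "\<exists>z\<in>carrier M. z \<oplus>\<^bsub>M\<^esub> x = \<zero>\<^bsub>M\<^esub>"
        by (intro bexI[of _ "rep (\<ominus> y)"]) (simp_all add: sel rep_add rep l_neg)
    next
      fix x y z assume "x \<in> carrier M" "y \<in> carrier M" "z \<in> carrier M"
      then show "(x \<oplus>\<^bsub>M\<^esub> y) \<oplus>\<^bsub>M\<^esub> z = x \<oplus>\<^bsub>M\<^esub> (y \<oplus>\<^bsub>M\<^esub> z)"
        by (auto simp: sel rep_add rep a_assoc)
    next
      fix x y assume "x \<in> carrier M" "y \<in> carrier M"
      then show "x \<oplus>\<^bsub>M\<^esub> y = y \<oplus>\<^bsub>M\<^esub> x"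
        by (auto simp: sel rep a_comm)
    qed (auto simp: sel rep_add rep rep_rep)
  qed ((auto simp: sel rep_add rep rep_mult rep_rep; simp add: l_distr r_distr m_assoc)+)
  have simple: "N = {\<zero>\<^bsub>M\<^esub>} \<or> N = carrier M" if N: "submodule N R M" for N
  proof -
    interpret M: left_module R M by (rule M)
    interpret N: submodule N R M by (rule N)
    have NM: "N \<subseteq> rep ` carrier R" using N.subset by (simp add: sel)
    \<comment> \<open>The preimage of \<open>N\<close> is a left ideal containing \<open>L\<close>,
      so by maximality it is \<open>L\<close> or contains \<open>\<one>\<close>.\<close>
    define J where "J = {s \<in> carrier R. rep s \<in> N}"
    have rep0: "rep \<zero> \<in> N" using N.one_closed by (simp add: sel)
    have "left_ideal R J"
      unfolding left_ideal_def
    proof (intro conjI ballI)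
      have smultJ: "s \<otimes> x \<in> J" if "s \<in> carrier R" "x \<in> J" for s x
        using that N.smult_closed[of s "rep x"] by (simp add: J_def sel rep_mult)
      then show "\<And>s x. s \<in> carrier R \<Longrightarrow> x \<in> J \<Longrightarrow> s \<otimes> x \<in> J" .
      show "subgroup J (add_monoid R)"
      proof (rule add.subgroupI)
        show "J \<noteq> {}" using rep0 by (auto simp: J_def)
        show "a \<oplus> b \<in> J" if "a \<in> J" "b \<in> J" for a b
          using that N.m_closed[of "rep a" "rep b"] by (simp add: J_def sel rep_add rep)
        show "\<ominus> a \<in> J" if "a \<in> J" for a
          using smultJ[of "\<ominus> \<one>" a] that by (simp add: J_def l_minus)
      qed (auto simp: J_def)
    qed
    moreover have "L \<subseteq> J"
    proof
      fix x assume x: "x \<in> L"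
      then have "rep x = rep \<zero>" using rep_eq[of x \<zero>] LR by (simp add: a_minus_def)
      then show "x \<in> J" using rep0 LR[OF x] by (simp add: J_def)
    qed
    ultimately have "\<one> \<in> J \<or> J = L"
      using max unfolding maximal_left_ideal_def by blast
    then show ?thesis
    proof
      assume "\<one> \<in> J"
      then have "rep s \<in> N" if "s \<in> carrier R" for s
        using that N.smult_closed[of s "rep \<one>"] by (simp add: J_def sel rep_mult)
      then show ?thesis using NM by (auto simp: sel)
    next
      assume JL: "J = L"
      have "x = rep \<zero>" if x: "x \<in> N" for x
      proof -
        obtain s where s: "s \<in> carrier R" "x = rep s" using x NM by blast
        then have "s \<in> L" using x JL by (auto simp: J_def)
        then show ?thesis using s rep_eq[of s \<zero>] by (simp add: a_minus_def)
      qed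
      then have "N = {rep \<zero>}" using rep0 by blast
      then show ?thesis by (simp add: sel)
    qed
  qed
  have nz: "carrier M \<noteq> {\<zero>\<^bsub>M\<^esub>}"
  proof
    assume "carrier M = {\<zero>\<^bsub>M\<^esub>}"
    then have "rep \<one> = rep \<zero>" by (auto simp: sel)
    then show False using rep_eq[of \<one> \<zero>] one by (simp add: a_minus_def)
  qed
  have "faithful_left_module R M"
    unfolding faithful_left_module_def
  proof (intro conjI ballI impI M)
    fix s assume s: "s \<in> carrier R" "\<forall>x\<in>carrier M. s \<odot>\<^bsub>M\<^esub> x = \<zero>\<^bsub>M\<^esub>"
    show "s = \<zero>"
    proof (rule faithful[OF s(1)])
      fix t assume t: "t \<in> carrier R"
      then have "rep (s \<otimes> t) = rep \<zero>" using s by (auto simp: sel rep_mult)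
      then show "s \<otimes> t \<in> L" using rep_eq[of "s \<otimes> t" \<zero>] s t by (simp add: a_minus_def)
    qed
  qed
  moreover have "simple_left_module R M"
    unfolding simple_left_module_def using M simple nz by blast
  ultimately show ?thesis by (rule primitive_ringI[rotated])
qed

end

section \<open>Right constant terms and commutators in the differential operator ring\<close>

context derivation_UP
begin

lemma a_inv_D: "\<ominus>\<^bsub>D\<^esub> p = \<ominus>\<^bsub>P\<^esub> p"
  by (simp add: a_inv_def m_inv_def D_sel)

lemma subgroup_add_monoid_D: "subgroup I (add_monoid D) \<longleftrightarrow> subgroup I (add_monoid P)"
  using a_inv_D by (simp add: subgroup_def D_sel a_inv_def)

text \<open>This is \<open>\<theta>^i a = a \<theta>^i + i \<delta>(a) \<theta>^(i-1) + ...\<close>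
  read off by degree. Nothing is claimed about the lower terms: the last branch repeats the
  left-hand side so that one equation covers all degrees.\<close>

lemma coeff_Theta_pow_monom:
  assumes a: "a \<in> carrier R"
  shows "up_ring.coeff P ((\<Theta> ^^ i) (up_ring.monom P a 0)) j =
    (if i < j then \<zero> else if j = i then a
     else if Suc j = i then add_pow R i (\<delta> a)
     else up_ring.coeff P ((\<Theta> ^^ i) (up_ring.monom P a 0)) j)"
proof -
  have "(i < j \<longrightarrow> up_ring.coeff P ((\<Theta> ^^ i) (up_ring.monom P a 0)) j = \<zero>) \<and>
    (j = i \<longrightarrow> up_ring.coeff P ((\<Theta> ^^ i) (up_ring.monom P a 0)) j = a) \<and>
    (Suc j = i \<longrightarrow> up_ring.coeff P ((\<Theta> ^^ i) (up_ring.monom P a 0)) j = add_pow R i (\<delta> a))"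
  proof (induction i arbitrary: j)
    case 0
    then show ?case using a by auto
  next
    case (Suc i)
    let ?q = "(\<Theta> ^^ i) (up_ring.monom P a 0)"
    have q: "?q \<in> carrier P" using a by simp
    have co: "up_ring.coeff P ((\<Theta> ^^ Suc i) (up_ring.monom P a 0)) j
        = (case j of 0 \<Rightarrow> \<zero> | Suc m \<Rightarrow> up_ring.coeff P ?q m) \<oplus> \<delta> (up_ring.coeff P ?q j)"
      using coeff_Theta[OF q] by simp
    show ?case
    proof (cases j)
      case 0
      then show ?thesis unfolding co using Suc.IH[of 0] a by (auto simp: derivation_closed)
    next
      case (Suc m)
      then show ?thesis unfolding co using Suc.IH[of m] Suc.IH[of j] a
        by (auto simp: derivation_closed delta_zero)
    qed
  qed
  then show ?thesis by auto
qed

text \<open>Writing \<open>p = \<Sum>\<^sub>i \<theta>\<^sup>i r\<^sub>i\<close> with coefficients on the right, this is \<open>r\<^sub>0\<close>.\<close>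

definition right_const :: "(nat \<Rightarrow> 'a) \<Rightarrow> 'a" where
  "right_const p = (\<Oplus>i\<in>{..deg R p}. ((\<lambda>a. \<ominus> \<delta> a) ^^ i) (up_ring.coeff P p i))"

lemma neg_delta_pow:
  shows "a \<in> carrier R \<Longrightarrow> ((\<lambda>a. \<ominus> \<delta> a) ^^ i) a \<in> carrier R"
    and "\<lbrakk>a \<in> carrier R; b \<in> carrier R\<rbrakk> \<Longrightarrow>
      ((\<lambda>a. \<ominus> \<delta> a) ^^ i) (a \<oplus> b) = ((\<lambda>a. \<ominus> \<delta> a) ^^ i) a \<oplus> ((\<lambda>a. \<ominus> \<delta> a) ^^ i) b"
    and "((\<lambda>a. \<ominus> \<delta> a) ^^ i) \<zero> = \<zero>"
proof -
  show cl: "((\<lambda>a. \<ominus> \<delta> a) ^^ i) a \<in> carrier R" if "a \<in> carrier R" for a i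
    using that by (induction i) (auto simp: derivation_closed)
  show "((\<lambda>a. \<ominus> \<delta> a) ^^ i) (a \<oplus> b) = ((\<lambda>a. \<ominus> \<delta> a) ^^ i) a \<oplus> ((\<lambda>a. \<ominus> \<delta> a) ^^ i) b"
    if "a \<in> carrier R" "b \<in> carrier R"
    using that cl by (induction i) (auto simp: derivation_add derivation_closed R.minus_add)
  show "((\<lambda>a. \<ominus> \<delta> a) ^^ i) \<zero> = \<zero>" by (induction i) (auto simp: delta_zero)
qed

lemma right_const_bound:
  assumes "p \<in> carrier P" "deg R p \<le> n"
  shows "right_const p = (\<Oplus>i\<in>{..n}. ((\<lambda>a. \<ominus> \<delta> a) ^^ i) (up_ring.coeff P p i))"
  unfolding right_const_def
  using assms deg_aboveD[OF _ assms(1)]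
  by (intro R.add.finprod_mono_neutral_cong_left) (auto simp: neg_delta_pow)

lemma right_const_closed [simp]: "p \<in> carrier P \<Longrightarrow> right_const p \<in> carrier R"
  unfolding right_const_def by (intro R.finsum_closed) (auto simp: neg_delta_pow)

lemma right_const_add:
  assumes pq: "p \<in> carrier P" "q \<in> carrier P"
  shows "right_const (p \<oplus>\<^bsub>P\<^esub> q) = right_const p \<oplus> right_const q"
proof -
  define n where "n = max (deg R (p \<oplus>\<^bsub>P\<^esub> q)) (max (deg R p) (deg R q))"
  have "right_const (p \<oplus>\<^bsub>P\<^esub> q)
      = (\<Oplus>i\<in>{..n}. ((\<lambda>a. \<ominus> \<delta> a) ^^ i) (up_ring.coeff P p i) \<oplus> ((\<lambda>a. \<ominus> \<delta> a) ^^ i) (up_ring.coeff P q i))"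
    using pq right_const_bound[of "p \<oplus>\<^bsub>P\<^esub> q" n] by (simp add: n_def neg_delta_pow)
  also have "\<dots> = right_const p \<oplus> right_const q"
    using pq right_const_bound[of p n] right_const_bound[of q n]
    by (subst R.finsum_addf) (auto simp: n_def neg_delta_pow)
  finally show ?thesis .
qed

lemma right_const_zero: "right_const \<zero>\<^bsub>P\<^esub> = \<zero>"
  by (simp add: right_const_def neg_delta_pow)

lemma right_const_monom: "a \<in> carrier R \<Longrightarrow> right_const (up_ring.monom P a 0) = a"
  by (simp add: right_const_def)

lemma right_const_minus:
  assumes "p \<in> carrier P" shows "right_const (\<ominus>\<^bsub>P\<^esub> p) = \<ominus> right_const p"
  using assms right_const_add[of "\<ominus>\<^bsub>P\<^esub> p" p]
  by (simp add: P.l_neg right_const_zero R.minus_equality)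

text \<open>The shifted part and the \<open>\<delta>\<close> part of \<open>\<Theta> p\<close>
  cancel index by index, because applying \<open>-\<delta>\<close> once more to a coefficient is the
  negative of differentiating it first.\<close>

lemma right_const_Theta:
  assumes p: "p \<in> carrier P"
  shows "right_const (\<Theta> p) = \<zero>"
proof -
  let ?e = "\<lambda>i. (\<lambda>a. \<ominus> \<delta> a) ^^ i"
  define n where "n = max (deg R (\<Theta> p)) (deg R p)"
  have top: "up_ring.coeff P p (Suc n) = \<zero>" using p by (intro deg_aboveD) (auto simp: n_def)
  let ?f = "\<lambda>i. case i of 0 \<Rightarrow> \<zero> | Suc m \<Rightarrow> ?e i (up_ring.coeff P p m)"
  let ?g = "\<lambda>i. ?e i (\<delta> (up_ring.coeff P p i))"
  have fg: "?f i \<in> carrier R" "?g i \<in> carrier R" for i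
    using p by (auto simp: derivation_closed split: nat.split intro!: neg_delta_pow(1) simp del: funpow.simps)
  have f': "?e (Suc i) (up_ring.coeff P p i) \<in> carrier R" for i
    using p by (intro neg_delta_pow(1)) auto
  have "right_const (\<Theta> p) = (\<Oplus>i\<in>{..Suc n}. ?f i \<oplus> ?g i)"
  proof -
    have "?e i (up_ring.coeff P (\<Theta> p) i) = ?f i \<oplus> ?g i" for i
      using p by (cases i) (simp_all add: coeff_Theta neg_delta_pow derivation_closed del: funpow.simps)
    then show ?thesis using p right_const_bound[of "\<Theta> p" "Suc n"] by (simp add: n_def)
  qed
  also have "\<dots> = (\<Oplus>i\<in>{..Suc n}. ?f i) \<oplus> (\<Oplus>i\<in>{..Suc n}. ?g i)"
    using fg by (intro R.finsum_addf) auto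
  also have "(\<Oplus>i\<in>{..Suc n}. ?f i) = (\<Oplus>i\<in>{..n}. ?e (Suc i) (up_ring.coeff P p i))"
  proof -
    have "(\<Oplus>i\<in>{..Suc n}. ?f i) = (\<Oplus>i\<in>{..n}. ?f (Suc i)) \<oplus> ?f 0"
      using fg by (intro R.finsum_Suc2) auto
    also have "(\<Oplus>i\<in>{..n}. ?f (Suc i)) = (\<Oplus>i\<in>{..n}. ?e (Suc i) (up_ring.coeff P p i))"
      by (simp only: nat.case)
    also have "\<dots> \<oplus> ?f 0 = \<dots>"
      using f' by (simp del: funpow.simps)
    finally show ?thesis .
  qed
  also have "(\<Oplus>i\<in>{..Suc n}. ?g i) = (\<Oplus>i\<in>{..n}. ?g i)"
    using fg top by (subst R.finsum_Suc) (auto simp: delta_zero neg_delta_pow(3) simp del: funpow.simps)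
  also have "(\<Oplus>i\<in>{..n}. ?e (Suc i) (up_ring.coeff P p i)) \<oplus> (\<Oplus>i\<in>{..n}. ?g i)
      = (\<Oplus>i\<in>{..n}. ?e (Suc i) (up_ring.coeff P p i) \<oplus> ?g i)"
    using fg f' by (intro R.finsum_addf[symmetric]) (auto simp del: funpow.simps)
  also have "\<dots> = (\<Oplus>i\<in>{..n}. \<zero>)"
  proof (intro R.finsum_cong')
    fix i
    let ?a = "up_ring.coeff P p i"
    have a: "?a \<in> carrier R" "\<delta> ?a \<in> carrier R" using p by (auto simp: derivation_closed)
    have "?e (Suc i) ?a = ?e i (\<ominus> \<delta> ?a)" by (simp only: funpow_Suc_right o_apply)
    then have "?e (Suc i) ?a \<oplus> ?g i = ?e i (\<ominus> \<delta> ?a \<oplus> \<delta> ?a)"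
      using a neg_delta_pow(2)[of "\<ominus> \<delta> ?a" "\<delta> ?a" i] by (simp del: funpow.simps)
    then show "?e (Suc i) ?a \<oplus> ?g i = \<zero>"
      using a by (simp add: R.l_neg neg_delta_pow(3) del: funpow.simps)
  qed auto
  finally show ?thesis by simp
qed

text \<open>Modulo elements \<open>\<theta> p\<close>, on which \<open>right_const\<close> vanishes,
  \<open>a \<theta> q\<close> equals \<open>-\<delta>(a) q\<close>; so each \<open>\<theta>\<close>
  moved to the left costs one application of \<open>-\<delta>\<close>.\<close>

lemma right_const_smult_Theta_pow:
  assumes "a \<in> carrier R" "m \<in> carrier R"
  shows "right_const (a \<odot>\<^bsub>P\<^esub> (\<Theta> ^^ i) (up_ring.monom P m 0)) = ((\<lambda>a. \<ominus> \<delta> a) ^^ i) a \<otimes> m"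
  using assms(1)
proof (induction i arbitrary: a)
  case 0
  then show ?case
    using assms(2) by (simp add: right_const_monom flip: monom_mult_smult)
next
  case (Suc i)
  let ?q = "(\<Theta> ^^ i) (up_ring.monom P m 0)"
  have q: "?q \<in> carrier P" using assms(2) by simp
  have da: "\<delta> a \<in> carrier R" using Suc.prems by (rule derivation_closed)
  have "right_const (a \<odot>\<^bsub>P\<^esub> \<Theta> ?q) \<oplus> right_const (\<delta> a \<odot>\<^bsub>P\<^esub> ?q) = \<zero>"
    using right_const_Theta[of "a \<odot>\<^bsub>P\<^esub> ?q"] q da Suc.prems
    by (simp add: Theta_smult right_const_add)
  then have "right_const (a \<odot>\<^bsub>P\<^esub> \<Theta> ?q) = \<ominus> right_const (\<delta> a \<odot>\<^bsub>P\<^esub> ?q)"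
    using q da Suc.prems by (intro R.minus_equality[symmetric]) auto
  also have "\<dots> = right_const ((\<ominus> \<delta> a) \<odot>\<^bsub>P\<^esub> ?q)"
  proof -
    have "\<ominus>\<^bsub>P\<^esub> (\<delta> a \<odot>\<^bsub>P\<^esub> ?q) = (\<ominus> \<delta> a) \<odot>\<^bsub>P\<^esub> ?q"
      using q da by (intro up_eqI) (simp_all add: R.l_minus)
    then show ?thesis using q da right_const_minus[of "\<delta> a \<odot>\<^bsub>P\<^esub> ?q"] by simp
  qed
  also have "\<dots> = ((\<lambda>a. \<ominus> \<delta> a) ^^ i) (\<ominus> \<delta> a) \<otimes> m"
    using da by (intro Suc.IH) simp
  also have "((\<lambda>a. \<ominus> \<delta> a) ^^ i) (\<ominus> \<delta> a) = ((\<lambda>a. \<ominus> \<delta> a) ^^ Suc i) a"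
    by (simp only: funpow_Suc_right o_apply)
  finally show ?case by simp
qed

text \<open>This right linearity is the reason for using right coefficients: for \<open>m\<close> in
  an ideal \<open>M\<close> of \<open>R\<close>, the product \<open>q m\<close> keeps its right
  constant term in \<open>M\<close>, whereas already \<open>\<theta> m\<close> has the left constant
  term \<open>\<delta> m\<close>.\<close>

lemma right_const_mult_monom:
  assumes q: "q \<in> carrier P" and m: "m \<in> carrier R"
  shows "right_const (opmult q (up_ring.monom P m 0)) = right_const q \<otimes> m"
proof -
  have "right_const (\<Oplus>\<^bsub>P\<^esub>i\<in>{..n}. q i \<odot>\<^bsub>P\<^esub> (\<Theta> ^^ i) (up_ring.monom P m 0))
      = (\<Oplus>i\<in>{..n}. ((\<lambda>a. \<ominus> \<delta> a) ^^ i) (up_ring.coeff P q i)) \<otimes> m" for n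
  proof (induction n)
    case 0
    then show ?case using assms right_const_smult_Theta_pow[of "q 0" m 0] by (simp add: coeff_eq)
  next
    case (Suc n)
    let ?t = "q (Suc n) \<odot>\<^bsub>P\<^esub> (\<Theta> ^^ Suc n) (up_ring.monom P m 0)"
    let ?s = "\<Oplus>\<^bsub>P\<^esub>i\<in>{..n}. q i \<odot>\<^bsub>P\<^esub> (\<Theta> ^^ i) (up_ring.monom P m 0)"
    have t: "?t \<in> carrier P" "?s \<in> carrier P"
      using assms by (auto intro!: P.finsum_closed simp del: funpow.simps)
    have e: "((\<lambda>a. \<ominus> \<delta> a) ^^ i) (up_ring.coeff P q i) \<in> carrier R" for i
      using q by (intro neg_delta_pow(1)) auto
    have s: "(\<Oplus>i\<in>{..n}. ((\<lambda>a. \<ominus> \<delta> a) ^^ i) (up_ring.coeff P q i)) \<in> carrier R"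
      using e by (intro R.finsum_closed) auto
    have "(\<Oplus>\<^bsub>P\<^esub>i\<in>{..Suc n}. q i \<odot>\<^bsub>P\<^esub> (\<Theta> ^^ i) (up_ring.monom P m 0)) = ?t \<oplus>\<^bsub>P\<^esub> ?s"
      using assms by (intro P.finsum_Suc) (auto simp del: funpow.simps)
    then have "right_const (\<Oplus>\<^bsub>P\<^esub>i\<in>{..Suc n}. q i \<odot>\<^bsub>P\<^esub> (\<Theta> ^^ i) (up_ring.monom P m 0))
        = ((\<lambda>a. \<ominus> \<delta> a) ^^ Suc n) (up_ring.coeff P q (Suc n)) \<otimes> m
          \<oplus> (\<Oplus>i\<in>{..n}. ((\<lambda>a. \<ominus> \<delta> a) ^^ i) (up_ring.coeff P q i)) \<otimes> m"
      using t right_const_add[OF t] right_const_smult_Theta_pow[of "q (Suc n)" m "Suc n"] Suc assms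
      by (simp add: coeff_eq del: funpow.simps)
    also have "\<dots> = (\<Oplus>i\<in>{..Suc n}. ((\<lambda>a. \<ominus> \<delta> a) ^^ i) (up_ring.coeff P q i)) \<otimes> m"
      using e s m by (subst R.finsum_Suc) (auto simp: R.l_distr simp del: funpow.simps)
    finally show ?case .
  qed
  then show ?thesis by (simp add: right_const_def)
qed

lemma sum_coeff_const:
  assumes f: "f \<in> carrier P" and b: "b \<in> carrier R"
  shows "m < j \<Longrightarrow> (\<Oplus>i\<in>{..m}. up_ring.coeff P f i
      \<otimes> up_ring.coeff P ((\<Theta> ^^ i) (up_ring.monom P b 0)) j) = \<zero>"
    and "(\<Oplus>i\<in>{..m}. up_ring.coeff P f i
      \<otimes> up_ring.coeff P ((\<Theta> ^^ i) (up_ring.monom P b 0)) m) = up_ring.coeff P f m \<otimes> b"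
proof -
  let ?c = "\<lambda>i j. up_ring.coeff P f i \<otimes> up_ring.coeff P ((\<Theta> ^^ i) (up_ring.monom P b 0)) j"
  show zero_sum: "(\<Oplus>i\<in>{..m}. ?c i j) = \<zero>" if "m < j" for m j
  proof -
    have "(\<Oplus>i\<in>{..m}. ?c i j) = (\<Oplus>i\<in>{..m}. \<zero>)"
      using that f b by (intro R.finsum_cong') (auto simp: coeff_Theta_pow_monom[of b _ j])
    then show ?thesis by simp
  qed
  show "(\<Oplus>i\<in>{..m}. ?c i m) = up_ring.coeff P f m \<otimes> b"
  proof (cases m)
    case 0
    then show ?thesis using b f by simp
  next
    case (Suc k)
    have "(\<Oplus>i\<in>{..Suc k}. ?c i m) = ?c (Suc k) m \<oplus> (\<Oplus>i\<in>{..k}. ?c i m)"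
      using f b by (intro R.finsum_Suc) auto
    then show ?thesis
      using b f coeff_Theta_pow_monom[of b m m] zero_sum[of k m] Suc
      by (simp del: funpow.simps)
  qed
qed

lemma coeff_mult_const:
  assumes f: "f \<in> carrier P" "\<And>j. n < j \<Longrightarrow> up_ring.coeff P f j = \<zero>" and b: "b \<in> carrier R"
  shows "up_ring.coeff P (opmult f (up_ring.monom P b 0)) j =
      (\<Oplus>i\<in>{..n}. up_ring.coeff P f i \<otimes> up_ring.coeff P ((\<Theta> ^^ i) (up_ring.monom P b 0)) j)"
proof -
  have bP: "up_ring.monom P b 0 \<in> carrier P" using b by simp
  have "deg R f \<le> n" using f by (intro deg_aboveI)
  then show ?thesis
    unfolding opmult_bound[OF f(1) bP \<open>deg R f \<le> n\<close>] using f(1) bP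
    by (subst coeff_finsum)
      (auto simp: coeff_eq[OF f(1), symmetric] intro!: R.finsum_cong' simp del: funpow.simps)
qed

text \<open>In degree \<open>k + 1\<close> the two products agree because \<open>R\<close> is
  commutative. In degree \<open>k\<close> the contributions of the \<open>k\<close>-th coefficient
  cancel likewise, and what remains comes from the term \<open>(k+1) \<delta>(b) \<theta>^k\<close>
  of \<open>\<theta>^(k+1) b\<close>.\<close>

lemma commutator_coeff:
  fixes f b k
  defines "h \<equiv> opmult f (up_ring.monom P b 0) \<ominus>\<^bsub>P\<^esub> b \<odot>\<^bsub>P\<^esub> f"
  assumes f: "f \<in> carrier P" "\<And>j. Suc k < j \<Longrightarrow> up_ring.coeff P f j = \<zero>" and b: "b \<in> carrier R"
  shows "k < j \<Longrightarrow> up_ring.coeff P h j = \<zero>"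
    and "up_ring.coeff P h k = up_ring.coeff P f (Suc k) \<otimes> add_pow R (Suc k) (\<delta> b)"
proof -
  let ?b = "up_ring.monom P b 0"
  have bP: "?b \<in> carrier P" and db: "\<delta> b \<in> carrier R" using b by (auto simp: derivation_closed)
  have fb: "up_ring.coeff P (opmult f ?b) j
      = (\<Oplus>i\<in>{..Suc k}. up_ring.coeff P f i \<otimes> up_ring.coeff P ((\<Theta> ^^ i) ?b) j)" for j
    using f b by (intro coeff_mult_const)
  have h_coeff: "up_ring.coeff P h j = up_ring.coeff P (opmult f ?b) j \<ominus> b \<otimes> up_ring.coeff P f j" for j
    unfolding h_def using f(1) bP b by (simp add: coeff_minus)
  show "up_ring.coeff P h j = \<zero>" if "k < j"
  proof (cases "j = Suc k")
    case True
    have "up_ring.coeff P (opmult f ?b) (Suc k) = up_ring.coeff P f (Suc k) \<otimes> b"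
      unfolding fb by (rule sum_coeff_const(2)[OF f(1) b])
    then show ?thesis
      unfolding h_coeff True using f(1) b by (simp add: R.m_comm R.r_neg a_minus_def)
  next
    case False
    then have "Suc k < j" using that by simp
    then show ?thesis
      unfolding h_coeff fb using sum_coeff_const(1)[OF f(1) b] f(2)[of j] b by (simp add: a_minus_def)
  qed
  let ?c = "\<lambda>i. up_ring.coeff P f i \<otimes> up_ring.coeff P ((\<Theta> ^^ i) ?b) k"
  have "(\<Oplus>i\<in>{..Suc k}. ?c i) = ?c (Suc k) \<oplus> (\<Oplus>i\<in>{..k}. ?c i)"
    using f(1) bP by (intro R.finsum_Suc) auto
  then have fb_k: "up_ring.coeff P (opmult f ?b) k
      = up_ring.coeff P f (Suc k) \<otimes> add_pow R (Suc k) (\<delta> b) \<oplus> up_ring.coeff P f k \<otimes> b"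
    unfolding fb sum_coeff_const(2)[OF f(1) b]
    using coeff_Theta_pow_monom[OF b, of "Suc k" k] by (simp del: funpow.simps R.add.nat_pow_Suc)
  show "up_ring.coeff P h k = up_ring.coeff P f (Suc k) \<otimes> add_pow R (Suc k) (\<delta> b)"
    unfolding h_coeff fb_k using f(1) db b
    by (simp add: a_minus_def R.a_assoc R.m_comm[of b] R.r_neg del: R.add.nat_pow_Suc)
qed

end

section \<open>Two-sided ideals and the construction of a faithful simple module\<close>

context derivation_domain
begin

text \<open>The least degree \<open>n\<close> in \<open>I\<close> is zero: otherwise the commutator
  of \<open>f\<close> with \<open>b\<close> lies in \<open>I\<close>, has smaller degree, and is
  nonzero because \<open>n\<close> times \<open>\<delta> b\<close> times the leading coefficient of
  \<open>f\<close> is nonzero in the domain \<open>R\<close>.\<close>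

lemma nonzero_ideal_meets_R:
  assumes nontrivial: "b \<in> carrier R" "\<delta> b \<noteq> \<zero>"
    and char: "\<And>n::nat. n > 0 \<Longrightarrow> add_pow R n \<one> \<noteq> \<zero>"
    and I: "ideal I D" and g: "g \<in> I" "g \<noteq> \<zero>\<^bsub>P\<^esub>"
  obtains a where "a \<in> carrier R" "a \<noteq> \<zero>" "up_ring.monom P a 0 \<in> I"
proof -
  note l_closed = ideal.I_l_closed[OF I, simplified D_sel]
  note r_closed = ideal.I_r_closed[OF I, simplified D_sel]
  have IP: "p \<in> carrier P" if "p \<in> I" for p using ideal.Icarr[OF I that] by (simp add: D_sel)
  have sub: "subgroup I (add_monoid P)"
    using additive_subgroup.a_subgroup[OF ideal.axioms(1)[OF I]] by (rule subgroup_add_monoid_D[THEN iffD1])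
  have minus: "p \<ominus>\<^bsub>P\<^esub> q \<in> I" if "p \<in> I" "q \<in> I" for p q
    using subgroup.m_closed[OF sub that(1) subgroup.m_inv_closed[OF sub that(2)]]
    by (simp add: a_minus_def a_inv_def)
  define f where "f = arg_min (deg R) (\<lambda>g. g \<in> I \<and> g \<noteq> \<zero>\<^bsub>P\<^esub>)"
  have f: "f \<in> I" "f \<noteq> \<zero>\<^bsub>P\<^esub>" and f_min: "\<And>h. \<lbrakk>h \<in> I; h \<noteq> \<zero>\<^bsub>P\<^esub>\<rbrakk> \<Longrightarrow> deg R f \<le> deg R h"
    using arg_min_nat_lemma[of "\<lambda>g. g \<in> I \<and> g \<noteq> \<zero>\<^bsub>P\<^esub>" g "deg R"] g unfolding f_def by blast+
  have fP: "f \<in> carrier P" using f(1) by (rule IP)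
  define n where "n = deg R f"
  have lc: "up_ring.coeff P f n \<in> carrier R" "up_ring.coeff P f n \<noteq> \<zero>"
    using lcoeff_nonzero[OF f(2) fP] fP by (auto simp: n_def)
  have n0: "n = 0"
  proof (rule ccontr)
    assume "n \<noteq> 0"
    then obtain k where k: "n = Suc k" by (cases n) auto
    let ?b = "up_ring.monom P b 0"
    define h where "h = opmult f ?b \<ominus>\<^bsub>P\<^esub> b \<odot>\<^bsub>P\<^esub> f"
    have bP: "?b \<in> carrier P" using nontrivial by simp
    have hI: "h \<in> I"
      unfolding h_def opmult_monom_zero[OF nontrivial(1) fP, symmetric]
      using f(1) bP by (intro minus l_closed r_closed)
    have hP: "h \<in> carrier P" using hI by (rule IP)
    have db: "\<delta> b \<in> carrier R" using nontrivial(1) by (rule derivation_closed)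
    have above: "up_ring.coeff P f j = \<zero>" if "Suc k < j" for j
      using that fP k by (intro deg_aboveD) (simp_all add: n_def)
    note h_coeff = commutator_coeff[OF fP above nontrivial(1), folded h_def]
    have "deg R h \<le> k" using h_coeff(1) hP by (intro deg_aboveI) auto
    moreover have "h \<noteq> \<zero>\<^bsub>P\<^esub>"
    proof
      assume "h = \<zero>\<^bsub>P\<^esub>"
      then have "up_ring.coeff P f n \<otimes> add_pow R n (\<delta> b) = \<zero>"
        using h_coeff(2) k by (simp del: R.add.nat_pow_Suc)
      moreover have "add_pow R n (\<delta> b) = add_pow R n \<one> \<otimes> \<delta> b" using db by (simp add: R.add_pow_ldistr)
      ultimately show False
        using lc char[of n] \<open>n \<noteq> 0\<close> nontrivial db by (auto simp: R.integral_iff)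
    qed
    ultimately show False using f_min[OF hI] k by (simp add: n_def)
  qed
  define a where "a = up_ring.coeff P f 0"
  have "f = up_ring.monom P a 0"
    unfolding a_def using fP n0 by (intro deg_zero_impl_monom) (simp_all add: n_def)
  then show thesis using that[of a] lc n0 f(1) by (simp add: a_def)
qed

lemma left_ideal_contraction:
  assumes L: "left_ideal D L"
  shows "ideal {a \<in> carrier R. up_ring.monom P a 0 \<in> L} R"
proof -
  have sub: "subgroup L (add_monoid P)"
    using L subgroup_add_monoid_D by (auto simp: left_ideal_def)
  have l: "x \<odot>\<^bsub>P\<^esub> p \<in> L" if "x \<in> carrier R" "p \<in> L" for x p
  proof -
    have pP: "p \<in> carrier P" using subgroup.subset[OF sub] that(2) by auto
    have "up_ring.monom P x 0 \<otimes>\<^bsub>D\<^esub> p \<in> L"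
      using L that by (simp add: left_ideal_def D_sel(1))
    then show ?thesis using opmult_monom_zero[OF that(1) pP] by (simp add: D_sel)
  qed
  have mult: "up_ring.monom P (x \<otimes> a) 0 \<in> L"
    if "a \<in> carrier R" "x \<in> carrier R" "up_ring.monom P a 0 \<in> L" for a x
    using l[OF that(2,3)] that monom_mult_smult[of x a 0] by simp
  show ?thesis
  proof (rule idealI[OF R.ring_axioms])
    show "subgroup {a \<in> carrier R. up_ring.monom P a 0 \<in> L} (add_monoid R)"
    proof (rule R.add.subgroupI)
      have "up_ring.monom P \<zero> 0 \<in> L" using subgroup.one_closed[OF sub] by simp
      then show "{a \<in> carrier R. up_ring.monom P a 0 \<in> L} \<noteq> {}" by blast
      fix a assume a: "a \<in> {a \<in> carrier R. up_ring.monom P a 0 \<in> L}"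
      then show "\<ominus> a \<in> {a \<in> carrier R. up_ring.monom P a 0 \<in> L}"
        using mult[of a "\<ominus> \<one>"] by (simp add: R.l_minus)
      fix b assume b: "b \<in> {a \<in> carrier R. up_ring.monom P a 0 \<in> L}"
      then show "a \<oplus> b \<in> {a \<in> carrier R. up_ring.monom P a 0 \<in> L}"
        using a subgroup.m_closed[OF sub, of "up_ring.monom P a 0" "up_ring.monom P b 0"]
        by (simp add: monom_add)
    qed auto
    fix a x assume ax: "a \<in> {a \<in> carrier R. up_ring.monom P a 0 \<in> L}" "x \<in> carrier R"
    then show "x \<otimes> a \<in> {a \<in> carrier R. up_ring.monom P a 0 \<in> L}" using mult by simp
    then show "a \<otimes> x \<in> {a \<in> carrier R. up_ring.monom P a 0 \<in> L}" using ax by (simp add: R.m_comm)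
  qed
qed

text \<open>The derivative \<open>\<delta> a\<close> is the commutator of \<open>\<theta>\<close>
  and \<open>a\<close>, which a two-sided ideal contains along with \<open>a\<close>.\<close>

lemma delta_ideal_contraction:
  assumes I: "ideal I D"
  shows "delta_ideal R \<delta> {a \<in> carrier R. up_ring.monom P a 0 \<in> I}"
proof -
  interpret D: ring D by (rule ring_diff_op_ring)
  note sub = additive_subgroup.a_subgroup[OF ideal.axioms(1)[OF I]]
  have "left_ideal D I"
    using sub ideal.I_l_closed[OF I] by (simp add: left_ideal_def)
  then have "ideal {a \<in> carrier R. up_ring.monom P a 0 \<in> I} R" by (rule left_ideal_contraction)
  moreover have "up_ring.monom P (\<delta> a) 0 \<in> I" if a: "a \<in> carrier R" "up_ring.monom P a 0 \<in> I" for a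
  proof -
    let ?x = "up_ring.monom P \<one> 1" and ?a = "up_ring.monom P a 0" and ?d = "up_ring.monom P (\<delta> a) 0"
    have cl: "?x \<in> carrier D" "?a \<in> carrier D" "?d \<in> carrier D"
      using a(1) by (auto simp: D_sel derivation_closed)
    have "?x \<otimes>\<^bsub>D\<^esub> ?a \<ominus>\<^bsub>D\<^esub> ?a \<otimes>\<^bsub>D\<^esub> ?x \<in> I"
      using ideal.I_minus_closed[OF I] ideal.I_l_closed[OF I a(2) cl(1)] ideal.I_r_closed[OF I a(2) cl(1)]
      by blast
    moreover have "?x \<otimes>\<^bsub>D\<^esub> ?a \<ominus>\<^bsub>D\<^esub> ?a \<otimes>\<^bsub>D\<^esub> ?x = ?d"
      unfolding diff_op_ring_relation[OF a(1)] a_minus_def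
      using cl D.m_closed[OF cl(2,1)] by (simp add: D.a_comm[of _ ?d] D.a_assoc D.r_neg)
    ultimately show ?thesis by simp
  qed
  ultimately show ?thesis by (auto simp: delta_ideal_def derivation_closed)
qed

theorem primitive_ring_if_delta_primitive:
  assumes nontrivial: "b \<in> carrier R" "\<delta> b \<noteq> \<zero>"
    and char: "\<And>n::nat. n > 0 \<Longrightarrow> add_pow R n \<one> \<noteq> \<zero>"
    and prim: "delta_primitive R \<delta>"
  shows "primitive_ring D"
proof -
  interpret D: ring D by (rule ring_diff_op_ring)
  obtain M where M: "maximalideal M R"
    and M_delta: "\<And>I. \<lbrakk>delta_ideal R \<delta> I; I \<subseteq> M\<rbrakk> \<Longrightarrow> I = {\<zero>}"
    using prim unfolding delta_primitive_def by blast
  interpret M: maximalideal M R by fact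
  have M1: "\<one> \<notin> M" using M.I_notcarr M.one_imp_carrier by auto
  \<comment> \<open>The largest left ideal on which \<open>right_const\<close> takes values in
    \<open>M\<close>. It contains \<open>M\<close> by right linearity and omits
    \<open>\<one>\<close>, so \<open>M\<close> does lie in a proper left ideal.\<close>
  define L0 where "L0 = {p \<in> carrier P. \<forall>q\<in>carrier P. right_const (opmult q p) \<in> M}"
  have "left_ideal D L0"
    unfolding left_ideal_def
  proof (intro conjI ballI)
    show "s \<otimes>\<^bsub>D\<^esub> p \<in> L0" if "s \<in> carrier D" "p \<in> L0" for s p
      using that by (simp add: L0_def D_sel flip: opmult_assoc)
    show "subgroup L0 (add_monoid D)"
      unfolding subgroup_add_monoid_D
    proof (rule P.add.subgroupI)
      have zero: "opmult q \<zero>\<^bsub>P\<^esub> = \<zero>\<^bsub>P\<^esub>" if "q \<in> carrier P" for q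
        using D.r_null[of q] that by (simp add: D_sel)
      then have "\<zero>\<^bsub>P\<^esub> \<in> L0" using M.zero_closed by (simp add: L0_def right_const_zero)
      then show "L0 \<noteq> {}" by blast
      show "\<ominus>\<^bsub>P\<^esub> p \<in> L0" if p: "p \<in> L0" for p
      proof -
        have "opmult q (\<ominus>\<^bsub>P\<^esub> p) = \<ominus>\<^bsub>P\<^esub> opmult q p" if "q \<in> carrier P" for q
          using D.r_minus[of q p] that p by (simp add: D_sel a_inv_D L0_def)
        then show ?thesis using p by (simp add: L0_def right_const_minus M.a_inv_closed)
      qed
      show "p \<oplus>\<^bsub>P\<^esub> q \<in> L0" if "p \<in> L0" "q \<in> L0" for p q
        using that by (simp add: L0_def opmult_add_right right_const_add M.a_closed)
    qed (auto simp: L0_def)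
  qed
  moreover have "\<one>\<^bsub>D\<^esub> \<notin> L0"
  proof
    assume "\<one>\<^bsub>D\<^esub> \<in> L0"
    then have "right_const (opmult \<one>\<^bsub>P\<^esub> \<one>\<^bsub>P\<^esub>) \<in> M" unfolding L0_def D_sel by blast
    then have "right_const \<one>\<^bsub>P\<^esub> \<in> M" using opmult_one_right[of "\<one>\<^bsub>P\<^esub>"] by simp
    then show False using right_const_monom[of \<one>] M1 monom_one by simp
  qed
  ultimately obtain L where L: "maximal_left_ideal D L" "L0 \<subseteq> L"
    using D.exists_maximal_left_ideal by blast
  have lL: "left_ideal D L" and L1: "\<one>\<^bsub>D\<^esub> \<notin> L" using L(1) by (auto simp: maximal_left_ideal_def)
  have contraction: "{a \<in> carrier R. up_ring.monom P a 0 \<in> L} = M"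
  proof -
    have "m \<in> {a \<in> carrier R. up_ring.monom P a 0 \<in> L}" if m: "m \<in> M" for m
    proof -
      have mR: "m \<in> carrier R" using m by (rule M.Icarr)
      have "up_ring.monom P m 0 \<in> L0"
        using mR right_const_mult_monom[OF _ mR] M.I_l_closed[OF m] by (simp add: L0_def)
      then show ?thesis using mR L(2) by blast
    qed
    moreover have "\<one> \<notin> {a \<in> carrier R. up_ring.monom P a 0 \<in> L}"
      using L1 monom_one by (simp add: D_sel)
    ultimately show ?thesis
      using M.I_maximal[OF left_ideal_contraction[OF lL]] by blast
  qed
  have "s = \<zero>\<^bsub>D\<^esub>" if s: "s \<in> carrier D" "\<And>t. t \<in> carrier D \<Longrightarrow> s \<otimes>\<^bsub>D\<^esub> t \<in> L" for s
  proof (rule ccontr)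
    assume "s \<noteq> \<zero>\<^bsub>D\<^esub>"
    \<comment> \<open>The annihilator of the quotient by \<open>L\<close>, a two-sided ideal inside
      \<open>L\<close>. Its contraction to \<open>R\<close> is a \<open>\<delta>\<close>-ideal
      inside \<open>M\<close>, hence zero, against \<open>nonzero_ideal_meets_R\<close>.\<close>
    define I where "I = {s \<in> carrier D. \<forall>t\<in>carrier D. s \<otimes>\<^bsub>D\<^esub> t \<in> L}"
    have sub: "subgroup L (add_monoid D)" and l: "\<And>s x. \<lbrakk>s \<in> carrier D; x \<in> L\<rbrakk> \<Longrightarrow> s \<otimes>\<^bsub>D\<^esub> x \<in> L"
      using lL by (auto simp: left_ideal_def)
    have I: "ideal I D"
    proof (rule idealI[OF D.ring_axioms])
      show "subgroup I (add_monoid D)"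
      proof (rule D.add.subgroupI)
        have "\<zero>\<^bsub>D\<^esub> \<in> I" using subgroup.one_closed[OF sub] by (simp add: I_def)
        then show "I \<noteq> {}" by blast
        show "\<ominus>\<^bsub>D\<^esub> a \<in> I" if "a \<in> I" for a
          using that subgroup.m_inv_closed[OF sub, folded a_inv_def] by (simp add: I_def D.l_minus)
        show "a \<oplus>\<^bsub>D\<^esub> b \<in> I" if "a \<in> I" "b \<in> I" for a b
          using that subgroup.m_closed[OF sub] by (simp add: I_def D.l_distr)
      qed (auto simp: I_def)
      fix a x assume ax: "a \<in> I" "x \<in> carrier D"
      show "x \<otimes>\<^bsub>D\<^esub> a \<in> I" using ax l by (simp add: I_def D.m_assoc)
      show "a \<otimes>\<^bsub>D\<^esub> x \<in> I" using ax by (simp add: I_def D.m_assoc)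
    qed
    have "s \<in> I" "s \<noteq> \<zero>\<^bsub>P\<^esub>" using s \<open>s \<noteq> \<zero>\<^bsub>D\<^esub>\<close> by (auto simp: I_def D_sel(3))
    then obtain a where a: "a \<in> carrier R" "a \<noteq> \<zero>" "up_ring.monom P a 0 \<in> I"
      using nonzero_ideal_meets_R[OF nontrivial char I] by blast
    have "x \<in> L" if "x \<in> I" for x
    proof -
      have "x \<in> carrier D" "x \<otimes>\<^bsub>D\<^esub> \<one>\<^bsub>D\<^esub> \<in> L" using that D.one_closed unfolding I_def by blast+
      then show ?thesis by simp
    qed
    then have "{a \<in> carrier R. up_ring.monom P a 0 \<in> I} = {\<zero>}"
      using contraction by (intro M_delta delta_ideal_contraction[OF I]) blast
    then show False using a by blast
  qed
  then show ?thesis by (rule D.primitive_ring_if_maximal_left_ideal[OF L(1)])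
qed

end

section \<open>Faithful simple modules over the differential operator ring\<close>

lemma (in abelian_group) minus_eq_zero_iff:
  assumes "x \<in> carrier G" "y \<in> carrier G"
  shows "x \<ominus> y = \<zero> \<longleftrightarrow> x = y"
proof
  assume "x \<ominus> y = \<zero>"
  then have "(x \<ominus> y) \<oplus> y = y" using assms by simp
  then show "x = y" using assms by (simp add: a_minus_def a_assoc l_neg)
qed (use assms in \<open>simp add: a_minus_def r_neg\<close>)

section \<open>Annihilators and cyclic submodules of left modules\<close>

context left_module
begin

lemma smult_l_zero: "x \<in> carrier M \<Longrightarrow> \<zero> \<odot>\<^bsub>M\<^esub> x = \<zero>\<^bsub>M\<^esub>"
  using smult_l_distr[of \<zero> \<zero> x] smult_closed[of \<zero> x] by (simp add: M.add.l_cancel_one')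

lemma smult_r_zero: "a \<in> carrier R \<Longrightarrow> a \<odot>\<^bsub>M\<^esub> \<zero>\<^bsub>M\<^esub> = \<zero>\<^bsub>M\<^esub>"
  using smult_r_distr[of a "\<zero>\<^bsub>M\<^esub>" "\<zero>\<^bsub>M\<^esub>"] smult_closed[of a "\<zero>\<^bsub>M\<^esub>"] by (simp add: M.add.l_cancel_one')

lemma smult_l_minus:
  assumes "a \<in> carrier R" "x \<in> carrier M"
  shows "(\<ominus> a) \<odot>\<^bsub>M\<^esub> x = \<ominus>\<^bsub>M\<^esub> (a \<odot>\<^bsub>M\<^esub> x)"
proof -
  have "(\<ominus> a) \<odot>\<^bsub>M\<^esub> x \<oplus>\<^bsub>M\<^esub> a \<odot>\<^bsub>M\<^esub> x = \<zero>\<^bsub>M\<^esub>"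
    using assms smult_l_distr[of "\<ominus> a" a x] by (simp add: R.l_neg smult_l_zero)
  then show ?thesis using assms by (intro M.minus_equality[symmetric]) (auto simp: smult_closed)
qed

lemma smult_eq_iff:
  assumes "a \<in> carrier R" "b \<in> carrier R" "x \<in> carrier M"
  shows "(a \<ominus> b) \<odot>\<^bsub>M\<^esub> x = \<zero>\<^bsub>M\<^esub> \<longleftrightarrow> a \<odot>\<^bsub>M\<^esub> x = b \<odot>\<^bsub>M\<^esub> x"
proof -
  have "(a \<ominus> b) \<odot>\<^bsub>M\<^esub> x = a \<odot>\<^bsub>M\<^esub> x \<ominus>\<^bsub>M\<^esub> b \<odot>\<^bsub>M\<^esub> x"
    using assms by (simp add: a_minus_def smult_l_distr smult_l_minus)
  then show ?thesis using assms by (simp add: smult_closed M.minus_eq_zero_iff)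
qed

lemma left_ideal_annihilator:
  assumes x: "x \<in> carrier M"
  shows "left_ideal R {a \<in> carrier R. a \<odot>\<^bsub>M\<^esub> x = \<zero>\<^bsub>M\<^esub>}"
  unfolding left_ideal_def
proof (intro conjI ballI)
  show "subgroup {a \<in> carrier R. a \<odot>\<^bsub>M\<^esub> x = \<zero>\<^bsub>M\<^esub>} (add_monoid R)"
  proof (rule R.add.subgroupI)
    show "{a \<in> carrier R. a \<odot>\<^bsub>M\<^esub> x = \<zero>\<^bsub>M\<^esub>} \<noteq> {}" using smult_l_zero[OF x] by blast
  qed (use x in \<open>auto simp: smult_l_minus smult_l_distr\<close>)
qed (use x in \<open>auto simp: smult_assoc smult_r_zero\<close>)

lemma submodule_left_ideal_smult:
  assumes J: "left_ideal R J" and x: "x \<in> carrier M"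
  shows "submodule ((\<lambda>a. a \<odot>\<^bsub>M\<^esub> x) ` J) R M"
proof (intro submodule.intro submodule_axioms.intro)
  have sub: "subgroup J (add_monoid R)" using J by (simp add: left_ideal_def)
  have JR: "a \<in> carrier R" if "a \<in> J" for a using subgroup.subset[OF sub] that by auto
  show "subgroup ((\<lambda>a. a \<odot>\<^bsub>M\<^esub> x) ` J) (add_monoid M)"
  proof (rule M.add.subgroupI)
    show "(\<lambda>a. a \<odot>\<^bsub>M\<^esub> x) ` J \<subseteq> carrier M" using JR x by (auto simp: smult_closed)
    show "(\<lambda>a. a \<odot>\<^bsub>M\<^esub> x) ` J \<noteq> {}" using subgroup.one_closed[OF sub] by blast
    show "\<ominus>\<^bsub>M\<^esub> y \<in> (\<lambda>a. a \<odot>\<^bsub>M\<^esub> x) ` J" if y: "y \<in> (\<lambda>a. a \<odot>\<^bsub>M\<^esub> x) ` J" for y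
    proof -
      obtain a where a: "a \<in> J" "y = a \<odot>\<^bsub>M\<^esub> x" using y by blast
      show ?thesis
        using a JR[OF a(1)] x subgroup.m_inv_closed[OF sub a(1), folded a_inv_def]
        by (intro image_eqI[of _ _ "\<ominus> a"]) (simp_all add: smult_l_minus)
    qed
    show "y \<oplus>\<^bsub>M\<^esub> z \<in> (\<lambda>a. a \<odot>\<^bsub>M\<^esub> x) ` J"
      if yz: "y \<in> (\<lambda>a. a \<odot>\<^bsub>M\<^esub> x) ` J" "z \<in> (\<lambda>a. a \<odot>\<^bsub>M\<^esub> x) ` J" for y z
    proof -
      obtain a b where a: "a \<in> J" "y = a \<odot>\<^bsub>M\<^esub> x" and b: "b \<in> J" "z = b \<odot>\<^bsub>M\<^esub> x" using yz by blast
      show ?thesis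
        using a b JR x subgroup.m_closed[OF sub a(1) b(1)]
        by (intro image_eqI[of _ _ "a \<oplus> b"]) (simp_all add: smult_l_distr)
    qed
  qed
  fix s y assume s: "s \<in> carrier R" and "y \<in> (\<lambda>a. a \<odot>\<^bsub>M\<^esub> x) ` J"
  then obtain a where a: "a \<in> J" "y = a \<odot>\<^bsub>M\<^esub> x" by blast
  then show "s \<odot>\<^bsub>M\<^esub> y \<in> (\<lambda>a. a \<odot>\<^bsub>M\<^esub> x) ` J"
    using J s x JR[OF a(1)]
    by (intro image_eqI[of _ _ "s \<otimes> a"]) (auto simp: smult_assoc left_ideal_def)
qed

text \<open>The elements \<open>b x\<close> with \<open>b\<close> in \<open>J\<close> form a nonzero
  submodule, hence everything. A general \<open>J\<close> is allowed so that an operator fixing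
  \<open>x\<close> can be found with all its coefficients in a given
  \<open>\<delta>\<close>-ideal.\<close>

lemma simple_left_ideal_smult:
  assumes "simple_left_module R M" and J: "left_ideal R J" and x: "x \<in> carrier M"
    and a: "a \<in> J" "a \<odot>\<^bsub>M\<^esub> x \<noteq> \<zero>\<^bsub>M\<^esub>" and y: "y \<in> carrier M"
  obtains b where "b \<in> J" "b \<odot>\<^bsub>M\<^esub> x = y"
proof -
  have "(\<lambda>a. a \<odot>\<^bsub>M\<^esub> x) ` J \<noteq> {\<zero>\<^bsub>M\<^esub>}" using a by blast
  then have "(\<lambda>a. a \<odot>\<^bsub>M\<^esub> x) ` J = carrier M"
    using assms(1) submodule_left_ideal_smult[OF J x] unfolding simple_left_module_def by blast
  then obtain b where "b \<in> J" "y = b \<odot>\<^bsub>M\<^esub> x" using y by blast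
  then show thesis using that by blast
qed

lemma simple_cyclic:
  assumes "simple_left_module R M" and x: "x \<in> carrier M" "x \<noteq> \<zero>\<^bsub>M\<^esub>" and y: "y \<in> carrier M"
  obtains b where "b \<in> carrier R" "b \<odot>\<^bsub>M\<^esub> x = y"
proof -
  have "left_ideal R (carrier R)"
    using R.add.subgroup_self by (simp add: left_ideal_def)
  then show thesis
    using simple_left_ideal_smult[OF assms(1) _ x(1) R.one_closed _ y] x(2) smult_one[OF x(1)] that
    by auto
qed

end

context derivation_UP
begin

lemma left_ideal_DI:
  assumes sub: "subgroup J (add_monoid P)"
    and smult: "\<And>a p. \<lbrakk>a \<in> carrier R; p \<in> J\<rbrakk> \<Longrightarrow> a \<odot>\<^bsub>P\<^esub> p \<in> J"
    and Theta: "\<And>p. p \<in> J \<Longrightarrow> \<Theta> p \<in> J"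
  shows "left_ideal D J"
  unfolding left_ideal_def
proof (intro conjI ballI)
  show "subgroup J (add_monoid D)" using sub subgroup_add_monoid_D by blast
  fix s p assume s: "s \<in> carrier D" and p: "p \<in> J"
  have JP: "q \<in> carrier P" if "q \<in> J" for q using subgroup.subset[OF sub] that by auto
  have sP: "s \<in> carrier P" using s by (simp add: D_sel)
  have "(\<Theta> ^^ i) p \<in> J" for i by (induction i) (use p Theta in auto)
  then have t: "s i \<odot>\<^bsub>P\<^esub> (\<Theta> ^^ i) p \<in> J" for i using smult sP by auto
  have "(\<Oplus>\<^bsub>P\<^esub>i\<in>{..n}. s i \<odot>\<^bsub>P\<^esub> (\<Theta> ^^ i) p) \<in> J" for n
  proof (induction n)
    case 0
    then show ?case using t[of 0] JP[OF t[of 0]] by simp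
  next
    case (Suc n)
    have "(\<Oplus>\<^bsub>P\<^esub>i\<in>{..Suc n}. s i \<odot>\<^bsub>P\<^esub> (\<Theta> ^^ i) p)
      = s (Suc n) \<odot>\<^bsub>P\<^esub> (\<Theta> ^^ Suc n) p \<oplus>\<^bsub>P\<^esub> (\<Oplus>\<^bsub>P\<^esub>i\<in>{..n}. s i \<odot>\<^bsub>P\<^esub> (\<Theta> ^^ i) p)"
      using JP[OF t] by (intro P.finsum_Suc) blast
    then show ?case using subgroup.m_closed[OF sub t[of "Suc n"] Suc] by simp
  qed
  then show "s \<otimes>\<^bsub>D\<^esub> p \<in> J" by (simp add: D_sel)
qed

lemma monom_one_mult:
  assumes "p \<in> carrier P"
  shows "up_ring.monom P \<one> 1 \<otimes>\<^bsub>D\<^esub> p = \<Theta> p"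
proof -
  have "up_ring.monom P \<one> 1 = \<Theta> \<one>\<^bsub>P\<^esub>" using Theta_monom[of 0] monom_one by simp
  then have "opmult (up_ring.monom P \<one> 1) p = \<Theta> (opmult \<one>\<^bsub>P\<^esub> p)"
    using assms opmult_Theta[of "\<one>\<^bsub>P\<^esub>" p] by simp
  also have "opmult \<one>\<^bsub>P\<^esub> p = p"
    using opmult_monom_zero[of \<one> p] monom_one assms by simp
  finally show ?thesis by (simp add: D_sel)
qed

lemma const_mult:
  "\<lbrakk>a \<in> carrier R; p \<in> carrier P\<rbrakk> \<Longrightarrow> up_ring.monom P a 0 \<otimes>\<^bsub>D\<^esub> p = a \<odot>\<^bsub>P\<^esub> p"
  using opmult_monom_zero by (simp add: D_sel)

text \<open>Without \<open>\<delta>\<close>, left multiplication by \<open>\<theta>\<close> is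
  multiplication by the variable. The resulting commutativity serves to exclude the zero
  derivation.\<close>

lemma D_mult_commutative:
  assumes delta: "\<And>a. a \<in> carrier R \<Longrightarrow> \<delta> a = \<zero>" and pq: "p \<in> carrier P" "q \<in> carrier P"
  shows "p \<otimes>\<^bsub>D\<^esub> q = p \<otimes>\<^bsub>P\<^esub> q"
proof -
  have Theta: "\<Theta> r = up_ring.monom P \<one> 1 \<otimes>\<^bsub>P\<^esub> r" if "r \<in> carrier P" for r
    using theta_mult_zero[OF that] delta that by (simp add: theta_mult_def)
  have pow: "(\<Theta> ^^ i) q = up_ring.monom P \<one> i \<otimes>\<^bsub>P\<^esub> q" for i
  proof (induction i)
    case 0
    then show ?case using pq monom_one by simp
  next
    case (Suc i)
    then show ?case
      using pq Theta[of "up_ring.monom P \<one> i \<otimes>\<^bsub>P\<^esub> q"] monom_mult[of \<one> \<one> 1 i]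
      by (simp add: P.m_assoc[symmetric])
  qed
  have "p \<otimes>\<^bsub>D\<^esub> q = (\<Oplus>\<^bsub>P\<^esub>i\<in>{..deg R p}. up_ring.monom P (up_ring.coeff P p i) i \<otimes>\<^bsub>P\<^esub> q)"
    unfolding D_sel
  proof (intro P.finsum_cong')
    fix i
    show "p i \<odot>\<^bsub>P\<^esub> (\<Theta> ^^ i) q = up_ring.monom P (up_ring.coeff P p i) i \<otimes>\<^bsub>P\<^esub> q"
      using pq monom_mult_smult[of "p i" \<one> i] by (simp add: pow coeff_eq UP_smult_assoc2)
  qed (use pq in auto)
  also have "\<dots> = (\<Oplus>\<^bsub>P\<^esub>i\<in>{..deg R p}. up_ring.monom P (up_ring.coeff P p i) i) \<otimes>\<^bsub>P\<^esub> q"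
    using pq by (intro P.finsum_ldistr[symmetric]) auto
  also have "\<dots> = p \<otimes>\<^bsub>P\<^esub> q" using up_repr[OF pq(1)] by simp
  finally show ?thesis .
qed

end

section \<open>Annihilators in \<open>R\<close> of the elements of a faithful simple module\<close>

locale primitive_diff_op_ring = derivation_domain +
  fixes V :: "(nat \<Rightarrow> 'a, 'c) module"
  assumes simple: "simple_left_module D V" and faithful: "faithful_left_module D V"
begin

sublocale V: left_module D V
  using simple by (simp add: simple_left_module_def)

abbreviation const :: "'a \<Rightarrow> nat \<Rightarrow> 'a" where "const a \<equiv> up_ring.monom P a 0"

lemma const_D: "a \<in> carrier R \<Longrightarrow> const a \<in> carrier D"
  by (simp add: D_sel)

lemma obtain_nonzero:
  obtains v where "v \<in> carrier V" "v \<noteq> \<zero>\<^bsub>V\<^esub>"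
  using simple V.M.zero_closed unfolding simple_left_module_def by blast

lemma faithfulD:
  assumes "p \<in> carrier D" "\<And>v. v \<in> carrier V \<Longrightarrow> p \<odot>\<^bsub>V\<^esub> v = \<zero>\<^bsub>V\<^esub>"
  shows "p = \<zero>\<^bsub>P\<^esub>"
  using faithful assms by (simp add: faithful_left_module_def D_sel(3))

text \<open>For \<open>\<delta> = 0\<close> the ring is commutative, so what kills one nonzero
  \<open>v\<close> kills all of \<open>V\<close> and is zero. Simplicity then makes
  \<open>\<theta>\<close> invertible, although every \<open>\<theta> q\<close> has zero constant
  term.\<close>

lemma delta_nontrivial: "\<exists>a\<in>carrier R. \<delta> a \<noteq> \<zero>"
proof (rule ccontr)
  assume "\<not> (\<exists>a\<in>carrier R. \<delta> a \<noteq> \<zero>)"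
  then have delta: "\<delta> a = \<zero>" if "a \<in> carrier R" for a using that by blast
  note mult = D_mult_commutative[OF delta]
  have comm: "p \<otimes>\<^bsub>D\<^esub> q = q \<otimes>\<^bsub>D\<^esub> p" if "p \<in> carrier D" "q \<in> carrier D" for p q
    using that mult[of p q] mult[of q p] P.m_comm[of p q] by (simp add: D_sel(1))
  obtain v where v: "v \<in> carrier V" "v \<noteq> \<zero>\<^bsub>V\<^esub>" by (rule obtain_nonzero)
  have ann: "p = \<zero>\<^bsub>P\<^esub>" if p: "p \<in> carrier D" "p \<odot>\<^bsub>V\<^esub> v = \<zero>\<^bsub>V\<^esub>" for p
  proof (rule faithfulD[OF p(1)])
    fix w assume "w \<in> carrier V"
    then obtain q where q: "q \<in> carrier D" "q \<odot>\<^bsub>V\<^esub> v = w"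
      using V.simple_cyclic[OF simple v] by blast
    then have "p \<odot>\<^bsub>V\<^esub> w = (q \<otimes>\<^bsub>D\<^esub> p) \<odot>\<^bsub>V\<^esub> v"
      using p(1) v(1) comm[OF q(1) p(1)] by (simp add: V.smult_assoc)
    then show "p \<odot>\<^bsub>V\<^esub> w = \<zero>\<^bsub>V\<^esub>"
      using p q v(1) by (simp add: V.smult_assoc V.smult_r_zero)
  qed
  define x where "x = up_ring.monom P \<one> 1"
  have x: "x \<in> carrier D" by (simp add: x_def D_sel)
  have "x \<odot>\<^bsub>V\<^esub> v \<noteq> \<zero>\<^bsub>V\<^esub>"
  proof
    assume "x \<odot>\<^bsub>V\<^esub> v = \<zero>\<^bsub>V\<^esub>"
    then have "up_ring.coeff P x 1 = \<zero>" using ann[OF x] by simp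
    then show False by (simp add: x_def)
  qed
  then obtain q where q: "q \<in> carrier D" "q \<odot>\<^bsub>V\<^esub> (x \<odot>\<^bsub>V\<^esub> v) = v"
    using V.simple_cyclic[OF simple _ _ v(1)] V.smult_closed[OF x v(1)] by blast
  have "(\<one>\<^bsub>D\<^esub> \<ominus>\<^bsub>D\<^esub> x \<otimes>\<^bsub>D\<^esub> q) \<odot>\<^bsub>V\<^esub> v = \<zero>\<^bsub>V\<^esub>"
    using q x v(1) comm[OF x q(1)] by (simp add: V.smult_eq_iff V.smult_one V.smult_assoc)
  then have "\<one>\<^bsub>D\<^esub> \<ominus>\<^bsub>D\<^esub> x \<otimes>\<^bsub>D\<^esub> q = \<zero>\<^bsub>D\<^esub>"
    using ann x q(1) by (simp add: D_sel(3))
  then have "\<one>\<^bsub>D\<^esub> = x \<otimes>\<^bsub>D\<^esub> q" using x q(1) by (simp add: V.R.minus_eq_zero_iff)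
  then have "\<one>\<^bsub>P\<^esub> = \<Theta> q" using monom_one_mult[of q] q(1) by (simp add: x_def D_sel)
  then have "up_ring.coeff P \<one>\<^bsub>P\<^esub> 0 = up_ring.coeff P (\<Theta> q) 0" by simp
  then show False
    using q(1) delta[of "up_ring.coeff P q 0"] by (simp add: coeff_Theta D_sel(1))
qed

definition ann :: "'c \<Rightarrow> 'a set" where
  "ann v = {a \<in> carrier R. const a \<odot>\<^bsub>V\<^esub> v = \<zero>\<^bsub>V\<^esub>}"

lemma ideal_ann:
  assumes "v \<in> carrier V" shows "ideal (ann v) R"
proof -
  have "ann v = {a \<in> carrier R. const a \<in> {p \<in> carrier D. p \<odot>\<^bsub>V\<^esub> v = \<zero>\<^bsub>V\<^esub>}}"
    using const_D by (auto simp: ann_def)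
  then show ?thesis using left_ideal_contraction[OF V.left_ideal_annihilator[OF assms]] by simp
qed

text \<open>Were the largest \<open>\<delta>\<close>-ideal \<open>Q\<close> inside \<open>M\<close>
  nonzero, simplicity would give \<open>p\<close> with coefficients in \<open>Q\<close> and
  \<open>p v = v\<close>. Then \<open>1 - p\<close> kills \<open>v\<close> and has its higher
  coefficients in \<open>Q\<close>, so by the choice of \<open>c\<close> its constant coefficient
  lies in \<open>Q\<close> too, and \<open>1\<close> would lie in \<open>Q\<close>.\<close>

lemma delta_primitive_if_torsion_free:
  assumes nat_unit: "\<And>n::nat. n > 0 \<Longrightarrow> add_pow R n \<one> \<in> Units R"
    and jac: "jacobson_semisimple R"
    and v: "v \<in> carrier V" and ann_v: "ann v = {\<zero>}"
  shows "delta_primitive R \<delta>"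
proof -
  define L where "L = {p \<in> carrier P. p \<odot>\<^bsub>V\<^esub> v = \<zero>\<^bsub>V\<^esub>}"
  have L: "left_ideal D L" using V.left_ideal_annihilator[OF v] by (simp add: L_def D_sel(1))
  have sub: "subgroup L (add_monoid P)"
    using L unfolding left_ideal_def subgroup_add_monoid_D by blast
  have l: "s \<otimes>\<^bsub>D\<^esub> p \<in> L" if "s \<in> carrier P" "p \<in> L" for s p
    using L that by (simp add: left_ideal_def D_sel(1))
  have LP: "p \<in> carrier P" if "p \<in> L" for p using that by (simp add: L_def)
  obtain c where c: "c \<in> carrier R" "c \<noteq> \<zero>" and avoid:
    "\<And>Q f. \<lbrakk>primeideal Q R; c \<notin> Q; f \<in> L; \<And>i. 0 < i \<Longrightarrow> up_ring.coeff P f i \<in> Q\<rbrakk> \<Longrightarrow> up_ring.coeff P f 0 \<in> Q"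
  proof (rule avoid_primes)
    show "L \<subseteq> carrier P" using LP by blast
    show "f \<ominus>\<^bsub>P\<^esub> g \<in> L" if "f \<in> L" "g \<in> L" for f g
      using subgroup.m_closed[OF sub that(1) subgroup.m_inv_closed[OF sub that(2)]]
      by (simp add: a_minus_def a_inv_def)
    show "a \<odot>\<^bsub>P\<^esub> f \<in> L" if "a \<in> carrier R" "f \<in> L" for a f
      using l[of "const a" f] const_mult[of a f] that LP by simp
    show "\<Theta> f \<in> L" if "f \<in> L" for f
      using l[of "up_ring.monom P \<one> 1" f] monom_one_mult[of f] that LP by simp
    show "f = \<zero>\<^bsub>P\<^esub>" if f: "f \<in> L" "deg R f = 0" for f
    proof -
      define a where "a = up_ring.coeff P f 0"
      have a: "a \<in> carrier R" using LP f(1) by (simp add: a_def)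
      have eq: "f = const a" unfolding a_def using f LP by (intro deg_zero_impl_monom)
      then have "a \<in> ann v" using f(1) a by (simp add: ann_def L_def)
      then show ?thesis using ann_v eq by simp
    qed
  qed blast
  obtain M where M: "maximalideal M R" "c \<notin> M" using jac c unfolding jacobson_semisimple_def by blast
  have Mp: "primeideal M R" using M(1) by (rule R.maximalideal_prime)
  \<comment> \<open>The property of \<open>c\<close> is applied to this prime and not to
    \<open>M\<close>: stability under \<open>\<delta>\<close> makes the operators with coefficients
    in \<open>Q\<close> a left ideal.\<close>
  define Q where "Q = delta_core M"
  have Q: "primeideal Q R" unfolding Q_def using nat_unit Mp by (rule primeideal_delta_core)
  have cQ: "c \<notin> Q" using M(2) delta_core_subset by (auto simp: Q_def)
  have Qd: "\<delta> a \<in> Q" if "a \<in> Q" for a using that delta_core_delta by (simp add: Q_def)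
  interpret Q: primeideal Q R by fact
  have "Q = {\<zero>}"
  proof (rule ccontr)
    assume "Q \<noteq> {\<zero>}"
    then obtain a where a: "a \<in> Q" "a \<noteq> \<zero>" using Q.zero_closed by blast
    have aR: "a \<in> carrier R" using a(1) by (rule Q.Icarr)
    define J where "J = {p \<in> carrier P. \<forall>i. up_ring.coeff P p i \<in> Q}"
    have J: "left_ideal D J"
    proof (rule left_ideal_DI)
      show "subgroup J (add_monoid P)"
      proof (rule P.add.subgroupI)
        have "\<zero>\<^bsub>P\<^esub> \<in> J" by (simp add: J_def Q.zero_closed)
        then show "J \<noteq> {}" by blast
      qed (auto simp: J_def Q.a_closed Q.a_inv_closed)
      show "a \<odot>\<^bsub>P\<^esub> p \<in> J" if "a \<in> carrier R" "p \<in> J" for a p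
        using that by (simp add: J_def Q.I_l_closed)
      show "\<Theta> p \<in> J" if p: "p \<in> J" for p
      proof -
        have "up_ring.coeff P (\<Theta> p) i \<in> Q" for i
          using p Qd by (cases i) (auto simp: J_def coeff_Theta intro: Q.a_closed)
        then show ?thesis using p by (simp add: J_def)
      qed
    qed
    have "const a \<in> J" using a aR by (simp add: J_def Q.zero_closed)
    moreover have "const a \<odot>\<^bsub>V\<^esub> v \<noteq> \<zero>\<^bsub>V\<^esub>" using a(2) ann_v aR by (auto simp: ann_def)
    ultimately obtain p where p: "p \<in> J" "p \<odot>\<^bsub>V\<^esub> v = v"
      using V.simple_left_ideal_smult[OF simple J v _ _ v] by blast
    have pP: "p \<in> carrier P" and pQ: "up_ring.coeff P p i \<in> Q" for i using p(1) by (auto simp: J_def)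
    have "(\<one>\<^bsub>D\<^esub> \<ominus>\<^bsub>D\<^esub> p) \<odot>\<^bsub>V\<^esub> v = \<zero>\<^bsub>V\<^esub>"
    proof -
      have "p \<in> carrier D" using pP by (simp add: D_sel(1))
      then show ?thesis
        using p(2) v V.smult_eq_iff[OF V.R.one_closed _ v, of p] V.smult_one[OF v] by simp
    qed
    moreover have "\<one>\<^bsub>D\<^esub> \<ominus>\<^bsub>D\<^esub> p = \<one>\<^bsub>P\<^esub> \<ominus>\<^bsub>P\<^esub> p" by (simp add: a_minus_def a_inv_D D_sel)
    ultimately have f: "\<one>\<^bsub>P\<^esub> \<ominus>\<^bsub>P\<^esub> p \<in> L" using pP by (simp add: L_def)
    have "up_ring.coeff P (\<one>\<^bsub>P\<^esub> \<ominus>\<^bsub>P\<^esub> p) 0 \<in> Q"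
    proof (rule avoid[OF Q cQ f])
      fix i :: nat assume "0 < i"
      then show "up_ring.coeff P (\<one>\<^bsub>P\<^esub> \<ominus>\<^bsub>P\<^esub> p) i \<in> Q"
        using pP pQ[of i] by (simp add: coeff_minus Q.I_minus_closed Q.zero_closed)
    qed
    then have "\<one> \<ominus> up_ring.coeff P p 0 \<in> Q" using pP by (simp add: coeff_minus)
    then have "\<one> \<in> Q" using pQ[of 0] by (intro Q.mem_if_minus_mem[of \<one> "up_ring.coeff P p 0"]) auto
    then show False using Q.one_imp_carrier Q.I_notcarr by simp
  qed
  then show ?thesis using M(1) delta_primitive_if_delta_core_zero by (simp add: Q_def)
qed

lemma exists_maximal_ann:
  assumes "noetherian_ring R"
  obtains v where "v \<in> carrier V" "v \<noteq> \<zero>\<^bsub>V\<^esub>"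
    "\<And>w. \<lbrakk>w \<in> carrier V; w \<noteq> \<zero>\<^bsub>V\<^esub>; ann v \<subseteq> ann w\<rbrakk> \<Longrightarrow> ann w = ann v"
proof -
  interpret N: noetherian_ring R by fact
  define F where "F = ann ` (carrier V - {\<zero>\<^bsub>V\<^esub>})"
  have "\<exists>M\<in>F. \<forall>J\<in>F. M \<subseteq> J \<longrightarrow> J = M"
  proof (rule subset_Zorn_nonempty)
    show "F \<noteq> {}" unfolding F_def using obtain_nonzero by blast
    fix C assume C: "C \<noteq> {}" "subset.chain F C"
    then have "subset.chain {I. ideal I R} C"
      using ideal_ann by (auto simp: subset_chain_def F_def)
    then have "\<Union>C \<in> C" using C(1) N.ideal_chain_is_trivial by blast
    then show "\<Union>C \<in> F" using C(2) by (auto simp: subset_chain_def)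
  qed
  then show thesis using that unfolding F_def by auto
qed

text \<open>Commutativity of \<open>R\<close> makes everything that kills \<open>v\<close> kill
  \<open>b v\<close>. If \<open>b v\<close> is nonzero, both annihilators agree by maximality, and
  \<open>a b v = 0\<close> puts \<open>a\<close> into \<open>ann v\<close>.\<close>

lemma primeideal_maximal_ann:
  assumes v: "v \<in> carrier V" "v \<noteq> \<zero>\<^bsub>V\<^esub>"
    and max: "\<And>w. \<lbrakk>w \<in> carrier V; w \<noteq> \<zero>\<^bsub>V\<^esub>; ann v \<subseteq> ann w\<rbrakk> \<Longrightarrow> ann w = ann v"
  shows "primeideal (ann v) R"
proof (rule primeidealI[OF ideal_ann[OF v(1)] R.is_cring])
  have "\<one> \<notin> ann v" using v monom_one V.smult_one[OF v(1)] by (simp add: ann_def D_sel(2))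
  then show "carrier R \<noteq> ann v" by blast
  fix a b assume a: "a \<in> carrier R" and b: "b \<in> carrier R" and ab: "a \<otimes> b \<in> ann v"
  have const_const: "const x \<odot>\<^bsub>V\<^esub> (const y \<odot>\<^bsub>V\<^esub> v) = const (x \<otimes> y) \<odot>\<^bsub>V\<^esub> v"
    if "x \<in> carrier R" "y \<in> carrier R" for x y
    using that v(1) by (simp add: const_D diff_op_ring_extends flip: V.smult_assoc)
  show "a \<in> ann v \<or> b \<in> ann v"
  proof (rule disjCI)
    assume nb: "b \<notin> ann v"
    define w where "w = const b \<odot>\<^bsub>V\<^esub> v"
    have w: "w \<in> carrier V" "w \<noteq> \<zero>\<^bsub>V\<^esub>"
      using nb b v(1) by (auto simp: w_def ann_def V.smult_closed const_D)
    have "x \<in> ann w" if x: "x \<in> ann v" for x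
    proof -
      have xR: "x \<in> carrier R" using x by (simp add: ann_def)
      have "x \<otimes> b \<in> ann v" using ideal.I_r_closed[OF ideal_ann[OF v(1)] x b] .
      then show ?thesis using const_const[OF xR b] xR by (simp add: ann_def w_def)
    qed
    then have "ann w = ann v" using max w by blast
    moreover have "a \<in> ann w" using ab const_const[OF a b] a by (simp add: ann_def w_def)
    ultimately show "a \<in> ann v" by simp
  qed
qed

text \<open>Since \<open>a \<theta> p = \<theta> a p - \<delta>(a) p\<close> and \<open>I\<close> is
  stable under \<open>\<delta>\<close>, the condition that \<open>I p\<close> kills \<open>v\<close>
  persists when \<open>p\<close> is multiplied by \<open>\<theta>\<close>. Starting from
  \<open>p = 1\<close>, it holds for all \<open>p\<close>, so \<open>I\<close> kills all of
  \<open>V\<close> and faithfulness applies.\<close>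

lemma delta_ideal_in_ann:
  assumes v: "v \<in> carrier V" "v \<noteq> \<zero>\<^bsub>V\<^esub>" and I: "delta_ideal R \<delta> I" "I \<subseteq> ann v"
  shows "I = {\<zero>}"
proof -
  have II: "ideal I R" and Id: "\<And>a. a \<in> I \<Longrightarrow> \<delta> a \<in> I" using I(1) by (auto simp: delta_ideal_def)
  have IR: "a \<in> carrier R" if "a \<in> I" for a using ideal.Icarr[OF II that] .
  define J where "J = {p \<in> carrier P. \<forall>a\<in>I. (a \<odot>\<^bsub>P\<^esub> p) \<odot>\<^bsub>V\<^esub> v = \<zero>\<^bsub>V\<^esub>}"
  have PD: "carrier P = carrier D" by (simp add: D_sel(1))
  have PD_add: "(p \<oplus>\<^bsub>P\<^esub> q) \<odot>\<^bsub>V\<^esub> v = p \<odot>\<^bsub>V\<^esub> v \<oplus>\<^bsub>V\<^esub> q \<odot>\<^bsub>V\<^esub> v" if "p \<in> carrier P" "q \<in> carrier P" for p q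
    using V.smult_l_distr[of p q v] that v(1) by (simp add: D_sel)
  have PD_minus: "(\<ominus>\<^bsub>P\<^esub> p) \<odot>\<^bsub>V\<^esub> v = \<ominus>\<^bsub>V\<^esub> (p \<odot>\<^bsub>V\<^esub> v)" if "p \<in> carrier P" for p
    using V.smult_l_minus[of p v] that v(1) by (simp add: D_sel a_inv_D)
  have smult_minus: "a \<odot>\<^bsub>P\<^esub> (\<ominus>\<^bsub>P\<^esub> p) = \<ominus>\<^bsub>P\<^esub> (a \<odot>\<^bsub>P\<^esub> p)" if "a \<in> carrier R" "p \<in> carrier P" for a p
    using that by (intro up_eqI) (simp_all add: R.r_minus)
  have "left_ideal D J"
  proof (rule left_ideal_DI)
    show "subgroup J (add_monoid P)"
    proof (rule P.add.subgroupI)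
      have "\<zero>\<^bsub>P\<^esub> \<odot>\<^bsub>V\<^esub> v = \<zero>\<^bsub>V\<^esub>" using V.smult_l_zero[OF v(1)] by (simp add: D_sel(3))
      then have "\<zero>\<^bsub>P\<^esub> \<in> J" using IR by (simp add: J_def)
      then show "J \<noteq> {}" by blast
      show "\<ominus>\<^bsub>P\<^esub> p \<in> J" if "p \<in> J" for p
        using that IR by (simp add: J_def smult_minus PD_minus)
      show "p \<oplus>\<^bsub>P\<^esub> q \<in> J" if "p \<in> J" "q \<in> J" for p q
        using that IR by (simp add: J_def UP_smult_r_distr PD_add)
    qed (auto simp: J_def)
    show "r \<odot>\<^bsub>P\<^esub> p \<in> J" if "r \<in> carrier R" "p \<in> J" for r p
      using that IR ideal.I_r_closed[OF II] by (simp add: J_def flip: UP_smult_assoc1)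
    show "\<Theta> p \<in> J" if p: "p \<in> J" for p
    proof -
      have pP: "p \<in> carrier P" using p by (simp add: J_def)
      have "(a \<odot>\<^bsub>P\<^esub> \<Theta> p) \<odot>\<^bsub>V\<^esub> v = \<zero>\<^bsub>V\<^esub>" if a: "a \<in> I" for a
      proof -
        have aR: "a \<in> carrier R" "\<delta> a \<in> carrier R" using IR a Id by auto
        have "\<Theta> (a \<odot>\<^bsub>P\<^esub> p) \<odot>\<^bsub>V\<^esub> v = up_ring.monom P \<one> 1 \<odot>\<^bsub>V\<^esub> ((a \<odot>\<^bsub>P\<^esub> p) \<odot>\<^bsub>V\<^esub> v)"
          using aR pP v(1) monom_one_mult[of "a \<odot>\<^bsub>P\<^esub> p"] V.smult_assoc[of "up_ring.monom P \<one> 1" "a \<odot>\<^bsub>P\<^esub> p" v]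
          by (simp add: D_sel(1))
        also have "\<dots> = \<zero>\<^bsub>V\<^esub>" using p a V.smult_r_zero[of "up_ring.monom P \<one> 1"] by (simp add: J_def D_sel(1))
        finally have "(a \<odot>\<^bsub>P\<^esub> \<Theta> p \<oplus>\<^bsub>P\<^esub> \<delta> a \<odot>\<^bsub>P\<^esub> p) \<odot>\<^bsub>V\<^esub> v = \<zero>\<^bsub>V\<^esub>"
          using aR pP by (simp add: Theta_smult)
        moreover have "(\<delta> a \<odot>\<^bsub>P\<^esub> p) \<odot>\<^bsub>V\<^esub> v = \<zero>\<^bsub>V\<^esub>" using p Id[OF a] by (simp add: J_def)
        moreover have "(a \<odot>\<^bsub>P\<^esub> \<Theta> p) \<odot>\<^bsub>V\<^esub> v \<in> carrier V"
          using aR pP v(1) by (intro V.smult_closed) (auto simp: D_sel(1))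
        ultimately show ?thesis using PD_add[of "a \<odot>\<^bsub>P\<^esub> \<Theta> p" "\<delta> a \<odot>\<^bsub>P\<^esub> p"] aR pP by simp
      qed
      then show ?thesis using pP by (simp add: J_def)
    qed
  qed
  moreover have "\<one>\<^bsub>P\<^esub> \<in> J"
  proof -
    have "(a \<odot>\<^bsub>P\<^esub> \<one>\<^bsub>P\<^esub>) \<odot>\<^bsub>V\<^esub> v = \<zero>\<^bsub>V\<^esub>" if "a \<in> I" for a
    proof -
      have "a \<odot>\<^bsub>P\<^esub> \<one>\<^bsub>P\<^esub> = const a"
        using monom_mult_smult[of a \<one> 0] IR[OF that] monom_one by simp
      then show ?thesis using I(2) that by (auto simp: ann_def)
    qed
    then show ?thesis by (simp add: J_def)
  qed
  ultimately have all: "p \<in> J" if "p \<in> carrier D" for p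
    using V.R.r_one[OF that] that unfolding left_ideal_def by (metis D_sel(2))
  have "a = \<zero>" if a: "a \<in> I" for a
  proof -
    have "const a = \<zero>\<^bsub>P\<^esub>"
    proof (rule faithfulD[OF const_D[OF IR[OF a]]])
      fix w assume "w \<in> carrier V"
      then obtain q where q: "q \<in> carrier D" "q \<odot>\<^bsub>V\<^esub> v = w"
        using V.simple_cyclic[OF simple v] by blast
      then have "const a \<odot>\<^bsub>V\<^esub> w = (const a \<otimes>\<^bsub>D\<^esub> q) \<odot>\<^bsub>V\<^esub> v"
        using V.smult_assoc[OF const_D[OF IR[OF a]] q(1) v(1)] by simp
      also have "\<dots> = (a \<odot>\<^bsub>P\<^esub> q) \<odot>\<^bsub>V\<^esub> v" using const_mult[OF IR[OF a]] q(1) by (simp add: PD)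
      also have "\<dots> = \<zero>\<^bsub>V\<^esub>" using all[OF q(1)] a by (simp add: J_def)
      finally show "const a \<odot>\<^bsub>V\<^esub> w = \<zero>\<^bsub>V\<^esub>" .
    qed
    then show ?thesis using coeff_monom[OF IR[OF a], of 0 0] by simp
  qed
  then show ?thesis using additive_subgroup.zero_closed[OF ideal.axioms(1)[OF II]] by blast
qed

text \<open>Induction on \<open>n\<close>: the commutator \<open>f p - p f\<close> also annihilates \<open>v\<close>, has degree below \<open>n\<close>, and has
  leading coefficient \<open>n f\<^sub>n \<delta> p\<close>.\<close>

lemma lead_coeff_annihilator_in_ann:
  assumes nat_unit: "\<And>n::nat. n > 0 \<Longrightarrow> add_pow R n \<one> \<in> Units R"
    and v: "v \<in> carrier V" and prime: "primeideal (ann v) R"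
    and p: "p \<in> ann v" "\<delta> p \<notin> ann v"
    and f: "f \<in> carrier P" "f \<odot>\<^bsub>V\<^esub> v = \<zero>\<^bsub>V\<^esub>" "\<And>j. n < j \<Longrightarrow> up_ring.coeff P f j = \<zero>"
  shows "up_ring.coeff P f n \<in> ann v"
  using f
proof (induction n arbitrary: f)
  case 0
  have "deg R f \<le> 0" using 0 by (intro deg_aboveI)
  then have "f = const (up_ring.coeff P f 0)"
    using 0(1) by (intro deg_zero_impl_monom) auto
  then have "const (up_ring.coeff P f 0) \<odot>\<^bsub>V\<^esub> v = \<zero>\<^bsub>V\<^esub>" using 0(2) by metis
  then show ?case using 0(1) by (simp add: ann_def)
next
  case (Suc n)
  have I: "ideal (ann v) R" using prime by (rule primeideal.axioms)
  have pR: "p \<in> carrier R" and dp: "\<delta> p \<in> carrier R" using p(1) by (auto simp: ann_def derivation_closed)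
  let ?p = "const p"
  define h where "h = opmult f ?p \<ominus>\<^bsub>P\<^esub> p \<odot>\<^bsub>P\<^esub> f"
  have hP: "h \<in> carrier P" using Suc.prems(1) pR by (simp add: h_def)
  have cl: "f \<in> carrier D" "?p \<in> carrier D" using Suc.prems(1) pR by (auto simp: D_sel(1))
  have "h = f \<otimes>\<^bsub>D\<^esub> ?p \<ominus>\<^bsub>D\<^esub> ?p \<otimes>\<^bsub>D\<^esub> f"
    using const_mult[OF pR Suc.prems(1)] by (simp add: h_def a_minus_def a_inv_D D_sel)
  moreover have "(f \<otimes>\<^bsub>D\<^esub> ?p) \<odot>\<^bsub>V\<^esub> v = (?p \<otimes>\<^bsub>D\<^esub> f) \<odot>\<^bsub>V\<^esub> v"
    using cl v p(1) Suc.prems(2) by (simp add: V.smult_assoc V.smult_r_zero ann_def)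
  ultimately have hv: "h \<odot>\<^bsub>V\<^esub> v = \<zero>\<^bsub>V\<^esub>"
    using V.smult_eq_iff[of "f \<otimes>\<^bsub>D\<^esub> ?p" "?p \<otimes>\<^bsub>D\<^esub> f" v] cl v by simp
  note h_coeff = commutator_coeff[OF Suc.prems(1) Suc.prems(3) pR, folded h_def]
  have "up_ring.coeff P h n \<in> ann v" using Suc.IH[OF hP hv] h_coeff(1) by blast
  then have "up_ring.coeff P f (Suc n) \<otimes> add_pow R (Suc n) (\<delta> p) \<in> ann v"
    using h_coeff(2) by simp
  moreover have "add_pow R (Suc n) (\<delta> p) \<notin> ann v"
  proof
    let ?u = "add_pow R (Suc n) \<one>"
    assume "add_pow R (Suc n) (\<delta> p) \<in> ann v"
    moreover have "add_pow R (Suc n) (\<delta> p) = ?u \<otimes> \<delta> p"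
      using dp R.add_pow_ldistr[of \<one> "\<delta> p" "Suc n"] by (simp del: R.add.nat_pow_Suc)
    ultimately have "?u \<otimes> \<delta> p \<in> ann v" by simp
    then have u: "?u \<in> ann v" using primeideal.I_prime[OF prime, of ?u "\<delta> p"] dp p(2) by blast
    have "?u \<in> Units R" using nat_unit by blast
    then have "\<one> \<in> ann v"
      using ideal.I_l_closed[OF I u, of "inv ?u"] by (simp del: R.add.nat_pow_Suc)
    then show False using ideal.one_imp_carrier[OF I] primeideal.I_notcarr[OF prime] by simp
  qed
  ultimately show ?case
    using primeideal.I_prime[OF prime, of "up_ring.coeff P f (Suc n)" "add_pow R (Suc n) (\<delta> p)"] Suc.prems(1) dp by auto
qed

text \<open>For \<open>m\<close> outside \<open>ann v\<close> but in a larger ideal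
  \<open>J\<close>, take \<open>d\<close> of least degree \<open>n\<close> with
  \<open>d m v = v\<close>. As \<open>1 - d m\<close> kills \<open>v\<close>, its coefficient of
  degree \<open>n\<close> lies in \<open>ann v\<close>. For \<open>n = 0\<close> this puts
  \<open>1\<close> into \<open>J\<close>; for \<open>n > 0\<close> the leading coefficient of
  \<open>d\<close> kills \<open>m v\<close>, so the leading term of \<open>d\<close> can be removed,
  against minimality.\<close>

lemma delta_primitive_if_torsion:
  assumes nat_unit: "\<And>n::nat. n > 0 \<Longrightarrow> add_pow R n \<one> \<in> Units R"
    and noeth: "noetherian_ring R"
    and torsion: "\<And>v. \<lbrakk>v \<in> carrier V; v \<noteq> \<zero>\<^bsub>V\<^esub>\<rbrakk> \<Longrightarrow> ann v \<noteq> {\<zero>}"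
  shows "delta_primitive R \<delta>"
proof -
  obtain v where v: "v \<in> carrier V" "v \<noteq> \<zero>\<^bsub>V\<^esub>"
    and max: "\<And>w. \<lbrakk>w \<in> carrier V; w \<noteq> \<zero>\<^bsub>V\<^esub>; ann v \<subseteq> ann w\<rbrakk> \<Longrightarrow> ann w = ann v"
    using exists_maximal_ann[OF noeth] by blast
  have prime: "primeideal (ann v) R" using v max by (rule primeideal_maximal_ann)
  have I: "ideal (ann v) R" using prime by (rule primeideal.axioms)
  have "\<not> delta_ideal R \<delta> (ann v)" using delta_ideal_in_ann[OF v] torsion[OF v] by blast
  then obtain p where p: "p \<in> ann v" "\<delta> p \<notin> ann v"
    using I by (auto simp: delta_ideal_def)
  have lead: "up_ring.coeff P f n \<in> ann v"
    if "f \<in> carrier P" "f \<odot>\<^bsub>V\<^esub> v = \<zero>\<^bsub>V\<^esub>" "\<And>j. n < j \<Longrightarrow> up_ring.coeff P f j = \<zero>" for f n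
    using nat_unit v(1) prime p that by (rule lead_coeff_annihilator_in_ann)
  have "maximalideal (ann v) R"
  proof (rule maximalidealI[OF I primeideal.I_notcarr[OF prime]])
    fix J assume J: "ideal J R" "ann v \<subseteq> J"
    show "J = ann v \<or> J = carrier R"
    proof (rule disjCI)
      assume "J \<noteq> carrier R"
      show "J = ann v"
      proof (rule ccontr)
        assume "J \<noteq> ann v"
        then obtain m where m: "m \<in> J" "m \<notin> ann v" using J(2) by blast
        have mR: "m \<in> carrier R" using ideal.Icarr[OF J(1) m(1)] .
        have mD: "const m \<in> carrier D" using mR by (rule const_D)
        define S where "S = {d \<in> carrier P. d \<odot>\<^bsub>V\<^esub> (const m \<odot>\<^bsub>V\<^esub> v) = v}"
        have "const m \<odot>\<^bsub>V\<^esub> v \<noteq> \<zero>\<^bsub>V\<^esub>" using m(2) mR by (simp add: ann_def)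
        then obtain d0 where "d0 \<in> carrier D" "d0 \<odot>\<^bsub>V\<^esub> (const m \<odot>\<^bsub>V\<^esub> v) = v"
          using V.simple_cyclic[OF simple V.smult_closed[OF mD v(1)] _ v(1)] by blast
        then have d0: "d0 \<in> S" by (simp add: S_def D_sel(1))
        define d where "d = arg_min (deg R) (\<lambda>d. d \<in> S)"
        have dS: "d \<in> S" and d_min: "\<And>e. e \<in> S \<Longrightarrow> deg R d \<le> deg R e"
          using arg_min_nat_lemma[of "\<lambda>d. d \<in> S" d0 "deg R"] d0 unfolding d_def by blast+
        have dP: "d \<in> carrier P" and dv: "d \<odot>\<^bsub>V\<^esub> (const m \<odot>\<^bsub>V\<^esub> v) = v" using dS by (auto simp: S_def)
        define n where "n = deg R d"
        define e where "e = \<one>\<^bsub>P\<^esub> \<ominus>\<^bsub>P\<^esub> opmult d (const m)"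
        have eP: "e \<in> carrier P" using dP mR by (simp add: e_def)
        have ev: "e \<odot>\<^bsub>V\<^esub> v = \<zero>\<^bsub>V\<^esub>"
        proof -
          have "e = \<one>\<^bsub>D\<^esub> \<ominus>\<^bsub>D\<^esub> d \<otimes>\<^bsub>D\<^esub> const m" by (simp add: e_def a_minus_def a_inv_D D_sel)
          moreover have dD: "d \<in> carrier D" using dP by (simp add: D_sel(1))
          moreover have "(d \<otimes>\<^bsub>D\<^esub> const m) \<odot>\<^bsub>V\<^esub> v = \<one>\<^bsub>D\<^esub> \<odot>\<^bsub>V\<^esub> v"
            using V.smult_assoc[OF dD mD v(1)] dv V.smult_one[OF v(1)] by simp
          ultimately show ?thesis
            using mD v(1) V.smult_eq_iff[of "\<one>\<^bsub>D\<^esub>" "d \<otimes>\<^bsub>D\<^esub> const m" v] by simp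
        qed
        have d_above: "up_ring.coeff P d j = \<zero>" if "n < j" for j
          using that dP by (intro deg_aboveD) (simp_all add: n_def)
        have dn: "up_ring.coeff P d n \<in> carrier R" using dP by simp
        have dm: "up_ring.coeff P (opmult d (const m)) j
            = (\<Oplus>i\<in>{..n}. up_ring.coeff P d i \<otimes> up_ring.coeff P ((\<Theta> ^^ i) (const m)) j)" for j
          using dP d_above mR by (intro coeff_mult_const)
        have e_coeff: "up_ring.coeff P e j = (if j = 0 then \<one> else \<zero>) \<ominus> up_ring.coeff P (opmult d (const m)) j" for j
          using dP mR by (simp add: e_def coeff_minus)
        have "up_ring.coeff P e n \<in> ann v"
        proof (rule lead[OF eP ev])
          show "up_ring.coeff P e j = \<zero>" if "n < j" for j
            using that unfolding e_coeff dm sum_coeff_const(1)[OF dP mR that] by (simp add: a_minus_def)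
        qed
        then have en: "(if n = 0 then \<one> else \<zero>) \<ominus> up_ring.coeff P d n \<otimes> m \<in> ann v"
          unfolding e_coeff dm sum_coeff_const(2)[OF dP mR] .
        show False
        proof (cases "n = 0")
          case True
          have "up_ring.coeff P d n \<otimes> m \<in> J" using ideal.I_l_closed[OF J(1) m(1) dn] .
          then have "\<one> \<in> J"
            using en True J(2) ideal.mem_if_minus_mem[OF J(1), of \<one> "up_ring.coeff P d n \<otimes> m"] by auto
          then show False using ideal.one_imp_carrier[OF J(1)] \<open>J \<noteq> carrier R\<close> by blast
        next
          case False
          let ?a = "up_ring.coeff P d n"
          have "\<ominus> (\<zero> \<ominus> ?a \<otimes> m) \<in> ann v" using en False additive_subgroup.a_inv_closed[OF ideal.axioms(1)[OF I]] by simp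
          then have am: "?a \<otimes> m \<in> ann v" using dn mR by (simp add: a_minus_def)
          \<comment> \<open>The leading coefficient stands to the right of \<open>\<theta>^n\<close>
            so that it meets \<open>m v\<close> first and kills it; \<open>t\<close> differs from
            the leading term of \<open>d\<close> only in lower degrees.\<close>
          define t where "t = (\<Theta> ^^ n) (const ?a)"
          have tP: "t \<in> carrier P" using dn by (simp add: t_def)
          have X: "up_ring.monom P \<one> n \<in> carrier D" by (simp add: D_sel(1))
          have "t = up_ring.monom P \<one> n \<otimes>\<^bsub>D\<^esub> const ?a"
          proof -
            have "opmult ((\<Theta> ^^ n) \<one>\<^bsub>P\<^esub>) (const ?a) = (\<Theta> ^^ n) (opmult \<one>\<^bsub>P\<^esub> (const ?a))"
              using dn by (intro opmult_Theta_pow) auto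
            also have "opmult \<one>\<^bsub>P\<^esub> (const ?a) = const ?a"
              using opmult_monom_zero[of \<one> "const ?a"] monom_one dn by simp
            finally show ?thesis by (simp only: t_def D_sel Theta_pow_one)
          qed
          then have "t \<odot>\<^bsub>V\<^esub> (const m \<odot>\<^bsub>V\<^esub> v)
              = up_ring.monom P \<one> n \<odot>\<^bsub>V\<^esub> ((const ?a \<otimes>\<^bsub>D\<^esub> const m) \<odot>\<^bsub>V\<^esub> v)"
            using X const_D[OF dn] mD v(1) by (simp add: V.smult_assoc V.smult_closed)
          also have "\<dots> = \<zero>\<^bsub>V\<^esub>"
            using am dn mR X by (simp add: diff_op_ring_extends ann_def V.smult_r_zero)
          finally have tv: "t \<odot>\<^bsub>V\<^esub> (const m \<odot>\<^bsub>V\<^esub> v) = \<zero>\<^bsub>V\<^esub>" .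
          have "(d \<ominus>\<^bsub>P\<^esub> t) \<odot>\<^bsub>V\<^esub> (const m \<odot>\<^bsub>V\<^esub> v) = v"
          proof -
            have mv: "const m \<odot>\<^bsub>V\<^esub> v \<in> carrier V" using V.smult_closed[OF mD v(1)] .
            have "d \<ominus>\<^bsub>P\<^esub> t = d \<oplus>\<^bsub>D\<^esub> \<ominus>\<^bsub>D\<^esub> t" by (simp add: a_minus_def a_inv_D D_sel)
            then show ?thesis
              using dP tP mv tv dv v(1) V.smult_l_distr[of d "\<ominus>\<^bsub>D\<^esub> t" "const m \<odot>\<^bsub>V\<^esub> v"]
                V.smult_l_minus[of t "const m \<odot>\<^bsub>V\<^esub> v"]
              by (simp add: D_sel(1) a_inv_D)
          qed
          then have "d \<ominus>\<^bsub>P\<^esub> t \<in> S" using dP tP by (simp add: S_def)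
          then have "n \<le> deg R (d \<ominus>\<^bsub>P\<^esub> t)" unfolding n_def by (rule d_min)
          moreover have "deg R (d \<ominus>\<^bsub>P\<^esub> t) \<le> n - 1"
          proof (rule deg_aboveI)
            fix j assume "n - 1 < j"
            then have "n \<le> j" using False by simp
            then show "up_ring.coeff P (d \<ominus>\<^bsub>P\<^esub> t) j = \<zero>"
              using dP tP dn d_above[of j] coeff_Theta_pow_monom[OF dn, of n j]
              by (cases "j = n") (simp_all add: coeff_minus t_def R.r_neg a_minus_def del: funpow.simps)
          qed (use dP tP in simp)
          ultimately show False using False by simp
        qed
      qed
    qed
  qed
  then show ?thesis
    unfolding delta_primitive_def using delta_ideal_in_ann[OF v] by blast
qed

end

theorem theorem3p2:
  fixes K :: "('k, 'm) ring_scheme" and R :: "('k, 'a, 'n) module_scheme" and \<delta> :: "'a \<Rightarrow> 'a"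
  assumes "field K" and "char_zero K"
    and "affine_algebra K R" and "domain R" and "derivation R \<delta>"
  shows "(delta_G_ring R \<delta> \<longrightarrow> delta_primitive R \<delta>) \<and>
    (primitive_ring (diff_op_ring R \<delta>) \<longleftrightarrow>
       (\<exists>a\<in>carrier R. \<delta> a \<noteq> \<zero>\<^bsub>R\<^esub>) \<and> delta_primitive R \<delta>)"
proof -
  interpret domain R by fact
  interpret derivation R \<delta> by fact
  interpret derivation_domain R \<delta> "UP R" by unfold_locales
  have noeth: "noetherian_ring R" and jac: "jacobson_semisimple R"
    using affine_domain_noetherian_jacobson assms(1,3,4) by blast+
  have nat_unit: "add_pow R n \<one>\<^bsub>R\<^esub> \<in> Units R" if "n > 0" for n :: nat
    using assms(3) that unfolding affine_algebra_def
    by (intro affine_nat_unit[OF assms(1,2)]) blast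
  have char: "add_pow R n \<one>\<^bsub>R\<^esub> \<noteq> \<zero>\<^bsub>R\<^esub>" if "n > 0" for n :: nat
    using nat_unit[OF that] by (auto simp: Units_def)
  have "(\<exists>a\<in>carrier R. \<delta> a \<noteq> \<zero>\<^bsub>R\<^esub>) \<and> delta_primitive R \<delta>"
    if prim: "primitive_ring (diff_op_ring R \<delta>)"
  proof -
    obtain V :: "(nat \<Rightarrow> 'a, (nat \<Rightarrow> 'a) set) module"
      where V: "simple_left_module (diff_op_ring R \<delta>) V" "faithful_left_module (diff_op_ring R \<delta>) V"
      using prim unfolding primitive_ring_def by blast
    interpret V: primitive_diff_op_ring R \<delta> "UP R" V
      using V by unfold_locales
    have "delta_primitive R \<delta>"
    proof (cases "\<exists>v\<in>carrier V. V.ann v = {\<zero>\<^bsub>R\<^esub>}")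
      case True
      then show ?thesis using V.delta_primitive_if_torsion_free[OF nat_unit jac] by blast
    next
      case False
      then show ?thesis using V.delta_primitive_if_torsion[OF nat_unit noeth] by blast
    qed
    then show ?thesis using V.delta_nontrivial by blast
  qed
  then show ?thesis
    using delta_primitive_if_delta_G_ring[OF nat_unit jac] primitive_ring_if_delta_primitive[OF _ _ char]
    by blast
qed

end
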